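(* Let $T>0$, $s>3/2$ and $2\le p\le\infty$. Let $u\in C([0,T],H^s(\mathbb{R}))$ be a strong solution of the Cauchy problem for the Camassa--Holm equation \[ \partial_t u+u\partial_x u=P(D)\Bigl(u^2+\tfrac12(\partial_x u)^2\Bigr),\qquad P(D)=-\partial_x(1-\partial_x^2)^{-1}, \] with $u|_{t=0}=u_0$, and suppose that $u_0\phi\in L^p(\mathbb{R})$ and $(\partial_x u_0)\phi\in L^p(\mathbb{R})$, where $\phi$ is an admissible weight function for the Camassa--Holm equation (defined in the context). Then for all $t\in[0,T]$, \[ \|u(t)\phi\|_p+\|\partial_x u(t)\phi\|_p\le\Bigl(\|u_0\phi\|_p+\|\partial_x u_0\phi\|_p\Bigr)e^{CMt}, \] where $C>0$ depends only on $v$ and $\phi$ (through the constants $A$, $C_0$, $\inf_{\mathbb{R}}v$ and $\int_{\mathbb{R}}v(x)e^{-|x|}\,dx$), and \[ M=\sup_{t\in[0,T]}\bigl(\|u(t)\|_\infty+\|\partial_x u(t)\|_\infty\bigr)<\infty. \]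
   Context: A weight $v:\mathbb{R}\to\mathbb{R}$ (nonnegative, continuous) is sub-multiplicative if $v(x+y)\le v(x)v(y)$ for all $x,y$. Given a sub-multiplicative $v$, a positive continuous function $\phi$ is $v$-moderate if there is $C_0>0$ with $\phi(x+y)\le C_0\,v(x)\phi(y)$ for all $x,y\in\mathbb{R}$. An admissible weight function for the Camassa--Holm equation is a locally absolutely continuous function $\phi:\mathbb{R}\to\mathbb{R}$ such that for some $A>0$, $|\phi'(x)|\le A|\phi(x)|$ for a.e. $x$, and which is $v$-moderate for some sub-multiplicative weight $v$ with $\inf_{\mathbb{R}}v>0$ and $\int_{\mathbb{R}}v(x)e^{-|x|}\,dx<\infty$. Equivalently to the equation above, with $G(x)=\tfrac12 e^{-|x|}$ and $F(u)=u^2+\tfrac12(\partial_xu)^2$, strong solutions satisfy $\partial_t u+u\partial_xu+\partial_xG*F(u)=0$. $\|\cdot\|_p$ denotes the $L^p(\mathbb{R})$ norm. *)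

theory Defs
  imports "HOL-Analysis.Analysis"
begin

section \<open>Sobolev space H^s(R) (for s > 1/2, continuous representatives)\<close>

definition fourier_inv :: "(real \<Rightarrow> complex) \<Rightarrow> real \<Rightarrow> complex" where
  "fourier_inv g x = complex_of_real (1 / (2 * pi)) * (LINT \<xi>|lborel. g \<xi> * cis (x * \<xi>))"

definition Hs_transform :: "real \<Rightarrow> (real \<Rightarrow> real) \<Rightarrow> (real \<Rightarrow> complex) \<Rightarrow> bool" where
  "Hs_transform s f g \<longleftrightarrow>
     g \<in> borel_measurable lborel \<and>
     integrable lborel (\<lambda>\<xi>. (1 + \<xi>\<^sup>2) powr s * (cmod (g \<xi>))\<^sup>2) \<and>
     (\<forall>x. complex_of_real (f x) = fourier_inv g x)"

definition in_Hs :: "real \<Rightarrow> (real \<Rightarrow> real) \<Rightarrow> bool" where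
  "in_Hs s f \<longleftrightarrow> (\<exists>g. Hs_transform s f g)"

definition C_Hs :: "real \<Rightarrow> real \<Rightarrow> (real \<Rightarrow> real \<Rightarrow> real) \<Rightarrow> bool" where
  "C_Hs T s u \<longleftrightarrow> (\<exists>U. (\<forall>t\<in>{0..T}. Hs_transform s (u t) (U t)) \<and>
     (\<forall>t\<in>{0..T}. ((\<lambda>\<tau>. LINT \<xi>|lborel. (1 + \<xi>\<^sup>2) powr s * (cmod (U \<tau> \<xi> - U t \<xi>))\<^sup>2)
                      \<longlongrightarrow> 0) (at t within {0..T})))"

definition CH_G :: "real \<Rightarrow> real" where
  "CH_G x = exp (- \<bar>x\<bar>) / 2"

definition CH_F :: "(real \<Rightarrow> real) \<Rightarrow> real \<Rightarrow> real" where
  "CH_F f y = (f y)\<^sup>2 + (deriv f y)\<^sup>2 / 2"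

definition CH_conv :: "(real \<Rightarrow> real) \<Rightarrow> real \<Rightarrow> real" where
  "CH_conv f x = (LINT y|lborel. CH_G (x - y) * CH_F f y)"

definition CH_strong_solution ::
  "real \<Rightarrow> real \<Rightarrow> (real \<Rightarrow> real \<Rightarrow> real) \<Rightarrow> (real \<Rightarrow> real) \<Rightarrow> bool" where
  "CH_strong_solution T s u u0 \<longleftrightarrow>
     C_Hs T s u \<and> u 0 = u0 \<and>
     (\<forall>t\<in>{0..T}. \<forall>x.
        ((\<lambda>\<tau>. u \<tau> x) has_real_derivative
           (- (u t x * deriv (u t) x + deriv (CH_conv (u t)) x))) (at t within {0..T}))"

definition Linf_norm :: "(real \<Rightarrow> real) \<Rightarrow> ennreal" where
  "Linf_norm f = Inf {c. AE x in lborel. ennreal \<bar>f x\<bar> \<le> c}"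

definition Lp_norm :: "ennreal \<Rightarrow> (real \<Rightarrow> real) \<Rightarrow> ennreal" where
  "Lp_norm p f =
     (if p = \<infinity> then Linf_norm f
      else (let I = (\<integral>\<^sup>+ x. ennreal (\<bar>f x\<bar> powr enn2real p) \<partial>lborel)
            in if I = \<infinity> then \<infinity> else ennreal (enn2real I powr (1 / enn2real p))))"

definition in_Lp :: "ennreal \<Rightarrow> (real \<Rightarrow> real) \<Rightarrow> bool" where
  "in_Lp p f \<longleftrightarrow> f \<in> borel_measurable lborel \<and> Lp_norm p f < \<infinity>"

definition submultiplicative :: "(real \<Rightarrow> real) \<Rightarrow> bool" where
  "submultiplicative v \<longleftrightarrow> continuous_on UNIV v \<and> (\<forall>x. 0 \<le> v x) \<and>
     (\<forall>x y. v (x + y) \<le> v x * v y)"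

definition v_moderate :: "(real \<Rightarrow> real) \<Rightarrow> real \<Rightarrow> (real \<Rightarrow> real) \<Rightarrow> bool" where
  "v_moderate v C0 \<phi> \<longleftrightarrow> C0 > 0 \<and> continuous_on UNIV \<phi> \<and> (\<forall>x. 0 < \<phi> x) \<and>
     (\<forall>x y. \<phi> (x + y) \<le> C0 * v x * \<phi> y)"

definition locally_abs_cont :: "(real \<Rightarrow> real) \<Rightarrow> bool" where
  "locally_abs_cont f \<longleftrightarrow> (\<forall>\<alpha> \<beta>. \<forall>\<epsilon>>0. \<exists>\<delta>>0. \<forall>(n::nat) (a::nat \<Rightarrow> real) b.
      (\<forall>i<n. \<alpha> \<le> a i \<and> a i \<le> b i \<and> b i \<le> \<beta>) \<and> (\<forall>i. Suc i < n \<longrightarrow> b i \<le> a (Suc i)) \<and>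
      (\<Sum>i<n. b i - a i) < \<delta> \<longrightarrow> (\<Sum>i<n. \<bar>f (b i) - f (a i)\<bar>) < \<epsilon>)"

definition CH_admissible :: "(real \<Rightarrow> real) \<Rightarrow> (real \<Rightarrow> real) \<Rightarrow> real \<Rightarrow> real \<Rightarrow> bool" where
  "CH_admissible \<phi> v A C0 \<longleftrightarrow>
     locally_abs_cont \<phi> \<and> A > 0 \<and>
     (AE x in lborel. \<exists>D. (\<phi> has_real_derivative D) (at x) \<and> \<bar>D\<bar> \<le> A * \<bar>\<phi> x\<bar>) \<and>
     submultiplicative v \<and> v_moderate v C0 \<phi> \<and>
     (INF x. v x) > 0 \<and>
     integrable lborel (\<lambda>x. v x * exp (- \<bar>x\<bar>))"

end

(* Along a characteristic X' = u(s, X) neither u nor the derivative of u meets a second derivative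
   of u: d/ds u = -P and d/ds u_x = u^2 - u_x^2/2 - G*F, with |P| <= G*F. Both are therefore bounded
   by their initial values plus the time integral of F + G*F along the backward characteristic that
   ends at x. Multiply by the weight. Since the weight is log-Lipschitz, moving it along the
   characteristic costs a factor exp (A M t); backward characteristics expand distances by at least
   exp (- M t), so composition with them costs at most exp (M t) in L^p; moderateness moves the
   weight through the convolution with G. Minkowski's integral inequality then yields a linear
   integral inequality for the weighted norms of u and u_x, which is iterated as in Picard's method
   (so that no measurability in time of the norms is needed). Finally the truncation of the weight
   is removed by monotone convergence. *)

theory Submission
  imports Defs
begin

section \<open>Admissible weights\<close>

text \<open>The velocity u is only C^1 in x, so neither u_xx nor a Jacobian of a smooth flow is
  used: the change of variables rests on two-sided distance bounds between characteristics alone.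
  Norms are replaced by explicit positive upper bounds throughout. The cut-off exp (- |x| / 2)
  answers two demands: it must decay, so that bounded functions times the truncated weight lie in
  every L^p, and it must decay more slowly than G, so that G times its moderation factor exp (|x| /
  2) stays integrable. The constant C = A + C0 I + 8, with I the integral of v exp (- |x|), can be
  read off. Truncation raises A to A + 1, and the change of variables adds 1. Convolution with G has
  weighted norm at most K = C0 I / 2 + 2, the 2 being the integral of exp (- |z| / 2) / 2. Both u
  and u_x are driven by a source of size (1 + K) M times the sum of their norms, so this sum grows
  at the further rate 2 (1 + K) M, which is (C0 I + 6) M. None of this depends on p or on the
  truncation level.\<close>

text \<open>The exceptional null set is enclosed in an open set of small measure, on which absolute
  continuity controls the increments. The increments are collected in sorted lists of intervals, so
  that Bolzano's principle can glue neighbouring intervals together.\<close>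

lemma abs_cont_increment_le:
  fixes f :: "real \<Rightarrow> real"
  assumes ac: "locally_abs_cont f" and ab: "a \<le> b" and m: "0 \<le> m"
    and der: "AE x in lborel. x \<in> {a..b} \<longrightarrow> (\<exists>D. (f has_real_derivative D) (at x) \<and> \<bar>D\<bar> \<le> m)"
  shows "\<bar>f b - f a\<bar> \<le> m * (b - a)"
proof -
  have key: "\<bar>f b - f a\<bar> \<le> (m + e) * (b - a) + e" if e: "e > 0" for e
  proof -
    obtain d where d: "d > 0" and dac: "\<forall>(n::nat) (s::nat \<Rightarrow> real) t. (\<forall>i<n. a \<le> s i \<and> s i \<le> t i \<and> t i \<le> b) \<and>
        (\<forall>i. Suc i < n \<longrightarrow> t i \<le> s (Suc i)) \<and> (\<Sum>i<n. t i - s i) < d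
        \<longrightarrow> (\<Sum>i<n. \<bar>f (t i) - f (s i)\<bar>) < e"
      using ac[unfolded locally_abs_cont_def, rule_format, OF e] by blast
    obtain E where E: "E \<in> null_sets lborel"
      "\<And>x. x \<notin> E \<Longrightarrow> x \<in> {a..b} \<Longrightarrow> \<exists>D. (f has_real_derivative D) (at x) \<and> \<bar>D\<bar> \<le> m"
      using der by (auto elim!: AE_E3)
    have Es: "E \<in> sets lebesgue" using E(1) by auto
    obtain U where U: "open U" "E \<subseteq> U" "U - E \<in> lmeasurable" "emeasure lebesgue (U - E) < ennreal d"
      using sets_lebesgue_outer_open[OF Es d] by metis
    have Eneg: "E \<in> null_sets lebesgue" using E(1) by (rule null_sets_completionI)
    have UE: "U = (U - E) \<union> E" using U(2) by auto
    have Ul: "emeasure lebesgue U < ennreal d"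
      using U(4) by (subst UE) (subst emeasure_Un_null_set, use U Eneg in auto)
    have Um: "U \<in> lmeasurable"
      using Ul U(1) by (auto simp: fmeasurable_def less_top[symmetric] intro: less_trans)
    have mU: "measure lebesgue U < d"
      using Ul d by (simp add: emeasure_eq_measure2[OF Um] ennreal_less_iff)
    \<comment> \<open>The exceptional intervals are kept as a witness list and not only through
      their total length: concatenation then glues neighbouring pieces and keeps the list sorted, as
      \<open>locally_abs_cont\<close> demands. The half-open \<open>{c<..d}\<close> makes the
      measures of two pieces add up exactly.\<close>
    define P where "P c d \<longleftrightarrow> (\<exists>xs. sorted_wrt (\<lambda>p q. snd p \<le> fst q) xs \<and>
        (\<forall>p\<in>set xs. c \<le> fst p \<and> fst p \<le> snd p \<and> snd p \<le> d) \<and>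
        (\<Sum>p\<leftarrow>xs. snd p - fst p) \<le> measure lebesgue (U \<inter> {c<..d}) \<and>
        \<bar>f d - f c\<bar> \<le> (m + e) * (d - c) + (\<Sum>p\<leftarrow>xs. \<bar>f (snd p) - f (fst p)\<bar>))" for c d
    have "P a b" using ab
    proof (induction rule: Bolzano)
      case (trans x y z)
      from trans(1) obtain xs where xs: "sorted_wrt (\<lambda>p q. snd p \<le> fst q) xs"
        "\<forall>p\<in>set xs. x \<le> fst p \<and> fst p \<le> snd p \<and> snd p \<le> y"
        "(\<Sum>p\<leftarrow>xs. snd p - fst p) \<le> measure lebesgue (U \<inter> {x<..y})"
        "\<bar>f y - f x\<bar> \<le> (m + e) * (y - x) + (\<Sum>p\<leftarrow>xs. \<bar>f (snd p) - f (fst p)\<bar>)"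
        unfolding P_def by blast
      from trans(2) obtain ys where ys: "sorted_wrt (\<lambda>p q. snd p \<le> fst q) ys"
        "\<forall>p\<in>set ys. y \<le> fst p \<and> fst p \<le> snd p \<and> snd p \<le> z"
        "(\<Sum>p\<leftarrow>ys. snd p - fst p) \<le> measure lebesgue (U \<inter> {y<..z})"
        "\<bar>f z - f y\<bar> \<le> (m + e) * (z - y) + (\<Sum>p\<leftarrow>ys. \<bar>f (snd p) - f (fst p)\<bar>)"
        unfolding P_def by blast
      have "U \<inter> {x<..z} = (U \<inter> {x<..y}) \<union> (U \<inter> {y<..z})" using trans(3,4) by auto
      moreover have "measure lebesgue ((U \<inter> {x<..y}) \<union> (U \<inter> {y<..z}))
          = measure lebesgue (U \<inter> {x<..y}) + measure lebesgue (U \<inter> {y<..z})"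
        using Um by (intro measure_Union) (auto simp: less_top[symmetric] intro!: fmeasurableD2 fmeasurable_Int_fmeasurable)
      ultimately have M: "measure lebesgue (U \<inter> {x<..z}) = measure lebesgue (U \<inter> {x<..y}) + measure lebesgue (U \<inter> {y<..z})"
        by simp
      show ?case unfolding P_def
      proof (intro exI[of _ "xs @ ys"] conjI)
        show "sorted_wrt (\<lambda>p q. snd p \<le> fst q) (xs @ ys)"
          using xs(1,2) ys(1,2) by (fastforce simp: sorted_wrt_append)
        show "\<forall>p\<in>set (xs @ ys). x \<le> fst p \<and> fst p \<le> snd p \<and> snd p \<le> z"
          using xs(2) ys(2) trans(3,4) by fastforce
        show "(\<Sum>p\<leftarrow>xs @ ys. snd p - fst p) \<le> measure lebesgue (U \<inter> {x<..z})"
          using xs(3) ys(3) M by simp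
        show "\<bar>f z - f x\<bar> \<le> (m + e) * (z - x) + (\<Sum>p\<leftarrow>xs @ ys. \<bar>f (snd p) - f (fst p)\<bar>)"
          using xs(4) ys(4) by (simp add: algebra_simps)
      qed
    next
      case (local x)
      \<comment> \<open>Around a point of \<open>E\<close> a whole small interval is listed as
        exceptional, which is affordable because it lies in \<open>U\<close>. Elsewhere the
        derivative controls the increment and nothing is listed.\<close>
      show ?case
      proof (cases "x \<in> E")
        case True
        then obtain r where r: "r > 0" "ball x r \<subseteq> U" using U(1,2) open_contains_ball by blast
        have "P c d" if "c \<le> x" "x \<le> d" "d - c < r" for c d
          unfolding P_def
        proof (intro exI[of _ "[(c,d)]"] conjI)
          have "U \<inter> {c<..d} = {c<..d}" using that r(2) by (force simp: dist_real_def)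
          then show "(\<Sum>p\<leftarrow>[(c, d)]. snd p - fst p) \<le> measure lebesgue (U \<inter> {c<..d})"
            using that by simp
          then show "\<bar>f d - f c\<bar> \<le> (m + e) * (d - c) + (\<Sum>p\<leftarrow>[(c, d)]. \<bar>f (snd p) - f (fst p)\<bar>)"
            using that e m by auto
        qed (use that in auto)
        then show ?thesis using r(1) by blast
      next
        case False
        then obtain D where D: "(f has_real_derivative D) (at x)" "\<bar>D\<bar> \<le> m"
          using E(2) local by force
        from D(1) have "(f has_derivative (\<lambda>h. D * h)) (at x)"
          by (simp add: has_field_derivative_def)
        from has_derivative_at_alt[THEN iffD1, OF this] e obtain r where r: "r > 0"
          "\<And>y. norm (y - x) < r \<Longrightarrow> norm (f y - f x - D * (y - x)) \<le> e * norm (y - x)"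
          by blast
        have "P c d" if "c \<le> x" "x \<le> d" "d - c < r" for c d
          unfolding P_def
        proof (intro exI[of _ "[]"] conjI)
          have "\<bar>f c - f x - D * (c - x)\<bar> \<le> e * (x - c)" "\<bar>f d - f x - D * (d - x)\<bar> \<le> e * (d - x)"
            using r(2)[of c] r(2)[of d] that by auto
          moreover have "\<bar>D * (d - c)\<bar> \<le> m * (d - c)" using D(2) that by (auto simp: abs_mult intro: mult_right_mono)
          ultimately show "\<bar>f d - f c\<bar> \<le> (m + e) * (d - c) + (\<Sum>p\<leftarrow>[]. \<bar>f (snd p) - f (fst p)\<bar>)"
            by (simp add: algebra_simps)
        qed auto
        then show ?thesis using r(1) by blast
      qed
    qed
    then obtain xs where xs: "sorted_wrt (\<lambda>p q. snd p \<le> fst q) xs"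
      "\<forall>p\<in>set xs. a \<le> fst p \<and> fst p \<le> snd p \<and> snd p \<le> b"
      "(\<Sum>p\<leftarrow>xs. snd p - fst p) \<le> measure lebesgue (U \<inter> {a<..b})"
      "\<bar>f b - f a\<bar> \<le> (m + e) * (b - a) + (\<Sum>p\<leftarrow>xs. \<bar>f (snd p) - f (fst p)\<bar>)"
      unfolding P_def by blast
    have "measure lebesgue (U \<inter> {a<..b}) \<le> measure lebesgue U"
      by (rule measure_mono_fmeasurable) (use U(1) Um in auto)
    then have "(\<Sum>i<length xs. snd (xs!i) - fst (xs!i)) < d"
      using xs(3) mU by (simp add: sum_list_sum_nth atLeast0LessThan)
    moreover have "\<forall>i<length xs. a \<le> fst (xs!i) \<and> fst (xs!i) \<le> snd (xs!i) \<and> snd (xs!i) \<le> b"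
      "\<forall>i. Suc i < length xs \<longrightarrow> snd (xs!i) \<le> fst (xs!Suc i)"
      using xs(1,2) by (auto simp: sorted_wrt_iff_nth_less)
    ultimately have "(\<Sum>i<length xs. \<bar>f (snd (xs!i)) - f (fst (xs!i))\<bar>) < e"
      using dac[rule_format, of "length xs" "\<lambda>i. fst (xs!i)" "\<lambda>i. snd (xs!i)"] by blast
    then show ?thesis using xs(4) by (simp add: sum_list_sum_nth atLeast0LessThan)
  qed
  have "\<bar>f b - f a\<bar> \<le> m * (b - a) + e" if e: "e > 0" for e
  proof -
    \<comment> \<open>The two errors of \<open>key\<close> add up to e (b - a + 1), hence the
      rescaling.\<close>
    have "\<bar>f b - f a\<bar> \<le> m * (b - a) + (e / (b - a + 1)) * (b - a + 1)"
      using key[of "e / (b - a + 1)"] e ab by (auto simp: distrib_left distrib_right)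
    then show ?thesis using ab by simp
  qed
  then show ?thesis by (rule field_le_epsilon)
qed

text \<open>The increment lemma is applied to f itself and not to ln f. Near z the values of f stay
  within a factor q of f z; there the increments of f are at most A q (f z) per unit length, and ln
  has slope at most q / f z. The product is A q^2 = A e, which Bolzano's principle makes global, and
  finally e tends to 1.\<close>

lemma log_lipschitz_of_abs_cont:
  fixes f :: "real \<Rightarrow> real"
  assumes ac: "locally_abs_cont f" and cont: "continuous_on UNIV f" and pos: "\<And>x. 0 < f x"
    and A: "0 < A"
    and der: "AE x in lborel. \<exists>D. (f has_real_derivative D) (at x) \<and> \<bar>D\<bar> \<le> A * \<bar>f x\<bar>"
  shows "f x \<le> exp (A * \<bar>x - y\<bar>) * f y"
proof -
  have loc: "\<bar>ln (f b) - ln (f a)\<bar> \<le> A * e * (b - a)" if ab: "a \<le> b" and e: "e > 1" for a b e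
    using ab
  proof (induction rule: Bolzano)
    case (trans a b c)
    then show ?case by (simp add: algebra_simps)
  next
    case (local z)
    define q where "q = sqrt e"
    have q: "q > 1" "q * q = e" using e by (auto simp: q_def)
    have "f \<midarrow>z\<rightarrow> f z" using cont by (simp add: continuous_on_eq_continuous_at isCont_def)
    then have lim: "(f \<longlongrightarrow> f z) (nhds z)" by (simp add: tendsto_at_iff_tendsto_nhds)
    have "f z / q < f z" "f z < f z * q" using pos[of z] q by (auto simp: field_simps)
    then have "\<forall>\<^sub>F y in nhds z. f z / q < f y \<and> f y < f z * q"
      using order_tendstoD[OF lim] by (intro eventually_conj) auto
    then obtain r where r: "r > 0" "\<And>y. dist y z < r \<Longrightarrow> f z / q < f y \<and> f y < f z * q"
      by (auto simp: eventually_nhds_metric)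
    have "\<bar>ln (f d) - ln (f c)\<bar> \<le> A * e * (d - c)" if cd: "c \<le> z \<and> z \<le> d \<and> d - c < r" for c d
    proof -
      have near: "f z / q < f y" "f y < f z * q" if "y \<in> {c..d}" for y
        using r(2)[of y] that cd by (auto simp: dist_real_def)
      have inc: "\<bar>f d - f c\<bar> \<le> (A * (f z * q)) * (d - c)"
      proof (rule abs_cont_increment_le[OF ac])
        show "0 \<le> A * (f z * q)" using A pos[of z] q by simp
        show "AE x in lborel. x \<in> {c..d} \<longrightarrow> (\<exists>D. (f has_real_derivative D) (at x) \<and> \<bar>D\<bar> \<le> A * (f z * q))"
          using der
        proof eventually_elim
          case (elim x)
          show ?case
          proof
            assume x: "x \<in> {c..d}"
            then have "A * \<bar>f x\<bar> \<le> A * (f z * q)"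
              using near(2)[OF x] pos[of x] A by (intro mult_left_mono) auto
            then show "\<exists>D. (f has_real_derivative D) (at x) \<and> \<bar>D\<bar> \<le> A * (f z * q)"
              using elim by fastforce
          qed
        qed
      qed (use cd in auto)
      have lnle: "ln s - ln t \<le> \<bar>s - t\<bar> * (q / f z)" if "f z / q < t" "s > 0" for s t
      proof -
        have t: "t > 0" using that(1) divide_pos_pos[OF pos[of z], of q] q by linarith
        have "ln s - ln t = ln (s / t)" using that t by (simp add: ln_div)
        also have "\<dots> \<le> s / t - 1" using that t by (intro ln_le_minus_one) auto
        also have "\<dots> = (s - t) * (1 / t)" using t by (simp add: field_simps)
        also have "\<dots> \<le> \<bar>s - t\<bar> * (q / f z)"
          using that(1) t q pos[of z] by (intro mult_mono) (auto simp: field_simps)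
        finally show ?thesis .
      qed
      have "\<bar>ln (f d) - ln (f c)\<bar> \<le> \<bar>f d - f c\<bar> * (q / f z)"
        using lnle[of "f c" "f d"] lnle[of "f d" "f c"] near[of c] near[of d] pos cd
        by (auto simp: abs_le_iff abs_minus_commute)
      also have "\<dots> \<le> (A * (f z * q)) * (d - c) * (q / f z)"
        using inc q pos[of z] by (intro mult_right_mono) auto
      also have "\<dots> = A * e * (d - c)" using pos[of z] q(2)[symmetric] by (simp add: field_simps)
      finally show ?thesis .
    qed
    then show ?case using r(1) by blast
  qed
  have lim: "\<bar>ln (f b) - ln (f a)\<bar> \<le> A * (b - a)" if ab: "a \<le> b" for a b
  proof (rule tendsto_lowerbound)
    show "((\<lambda>e. A * e * (b - a)) \<longlongrightarrow> A * (b - a)) (at_right 1)"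
      by (auto intro!: tendsto_eq_intros)
    show "\<forall>\<^sub>F e in at_right 1. \<bar>ln (f b) - ln (f a)\<bar> \<le> A * e * (b - a)"
      using loc[OF ab] by (auto simp: eventually_at_right_less intro: eventually_mono[OF eventually_at_right_less])
  qed auto
  have "ln (f x) \<le> A * \<bar>x - y\<bar> + ln (f y)"
    using lim[of x y] lim[of y x] by (cases "x \<le> y") auto
  then have "exp (ln (f x)) \<le> exp (A * \<bar>x - y\<bar> + ln (f y))" by simp
  then show ?thesis using pos by (simp add: exp_add)
qed

section \<open>Truncation of the weight\<close>

text \<open>Multiplied by a bounded function, the truncated weight lies in every \<open>L\<^sup>p\<close>. This makes all
  norms finite a priori, and the truncation preserves moderateness with a constant independent of
  \<open>N\<close>, because \<open>exp (- \<bar>x\<bar> / 2)\<close> is itself moderate.\<close>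

definition trunc_weight :: "(real \<Rightarrow> real) \<Rightarrow> real \<Rightarrow> real \<Rightarrow> real" where
  "trunc_weight \<phi> N x = min (\<phi> x) (N * exp (- (\<bar>x\<bar> / 2)))"

lemma trunc_weight_nonneg: "0 \<le> \<phi> x \<Longrightarrow> 0 \<le> N \<Longrightarrow> 0 \<le> trunc_weight \<phi> N x"
  by (simp add: trunc_weight_def)

lemma trunc_weight_le:
  "trunc_weight \<phi> N x \<le> \<phi> x" "trunc_weight \<phi> N x \<le> N * exp (- (\<bar>x\<bar> / 2))"
  by (auto simp: trunc_weight_def)

lemma continuous_trunc_weight:
  "continuous_on UNIV \<phi> \<Longrightarrow> continuous_on UNIV (trunc_weight \<phi> N)"
  unfolding trunc_weight_def by (intro continuous_intros) auto

lemma exp_half_shift: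
  fixes x y :: real
  shows "exp (- (\<bar>x + y\<bar> / 2)) \<le> exp (\<bar>x\<bar> / 2) * exp (- (\<bar>y\<bar> / 2))"
proof -
  have "- (\<bar>x + y\<bar> / 2) \<le> \<bar>x\<bar> / 2 + - (\<bar>y\<bar> / 2)"
    using abs_triangle_ineq[of "x + y" "- x"] by simp
  then show ?thesis by (simp only: exp_le_cancel_iff flip: exp_add)
qed

text \<open>A minimum of two functions inherits any comparison factor that they share. The rate A +
  1 dominates both the rate A of \<open>\<phi>\<close> and the rate 1/2 of the cut-off.\<close>

lemma trunc_weight_log_lipschitz:
  assumes lip: "\<And>x y. \<phi> x \<le> exp (A * \<bar>x - y\<bar>) * \<phi> y" and pos: "\<And>x. 0 < \<phi> x" and "0 < A" "0 < N"
  shows "trunc_weight \<phi> N x \<le> exp ((A + 1) * \<bar>x - y\<bar>) * trunc_weight \<phi> N y"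
proof -
  have "\<phi> x \<le> exp ((A + 1) * \<bar>x - y\<bar>) * \<phi> y"
    using pos[of y] by (intro order_trans[OF lip[of x y]]) (simp add: algebra_simps)
  moreover have "N * exp (- (\<bar>x\<bar> / 2)) \<le> exp ((A + 1) * \<bar>x - y\<bar>) * (N * exp (- (\<bar>y\<bar> / 2)))"
  proof -
    have "exp (- (\<bar>x\<bar> / 2)) \<le> exp (\<bar>x - y\<bar> / 2) * exp (- (\<bar>y\<bar> / 2))"
      using exp_half_shift[where x = "x - y" and y = y] by simp
    also have "\<dots> \<le> exp ((A + 1) * \<bar>x - y\<bar>) * exp (- (\<bar>y\<bar> / 2))"
      using \<open>0 < A\<close> by (intro mult_right_mono) (auto simp: algebra_simps)
    finally show ?thesis using \<open>0 < N\<close> by simp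
  qed
  ultimately show ?thesis unfolding trunc_weight_def by (auto simp: min_def)
qed

text \<open>The sum of the moderation factors of \<open>\<phi>\<close> and of the cut-off serves for
  both, hence for their minimum; it is free of N, and \<open>CH_G\<close> times it stays integrable
  when v exp (- |x|) is.\<close>

lemma trunc_weight_moderate:
  assumes mod: "\<And>x y. \<phi> (x + y) \<le> K * v x * \<phi> y" and pos: "\<And>x. 0 < \<phi> x" and "0 \<le> K" "\<And>x. 0 \<le> v x" "0 < N"
  shows "trunc_weight \<phi> N (x + y) \<le> (K * v x + exp (\<bar>x\<bar> / 2)) * trunc_weight \<phi> N y"
proof -
  have "\<phi> (x + y) \<le> (K * v x + exp (\<bar>x\<bar> / 2)) * \<phi> y"
    using mod[of x y] pos[of y] by (simp add: distrib_right add_increasing2)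
  moreover have "N * exp (- (\<bar>x + y\<bar> / 2)) \<le> (K * v x + exp (\<bar>x\<bar> / 2)) * (N * exp (- (\<bar>y\<bar> / 2)))"
  proof -
    have "exp (- (\<bar>x + y\<bar> / 2)) \<le> (K * v x + exp (\<bar>x\<bar> / 2)) * exp (- (\<bar>y\<bar> / 2))"
    proof -
      have "exp (\<bar>x\<bar> / 2) * exp (- (\<bar>y\<bar> / 2)) \<le> (K * v x + exp (\<bar>x\<bar> / 2)) * exp (- (\<bar>y\<bar> / 2))"
        using assms(3) assms(4)[of x] by (intro mult_right_mono) auto
      then show ?thesis using exp_half_shift[where x = x and y = y] by linarith
    qed
    then show ?thesis using \<open>0 < N\<close> by simp
  qed
  ultimately show ?thesis unfolding trunc_weight_def by (auto simp: min_def)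
qed

section \<open>Regularity of Sobolev functions\<close>

lemma integrable_even_extension:
  fixes h :: "real \<Rightarrow> real"
  assumes half: "integrable lborel (\<lambda>x. h x * indicator {0..} x)" and [measurable]: "h \<in> borel_measurable borel"
  shows "integrable lborel (\<lambda>x. h \<bar>x\<bar>)"
proof -
  have "integrable lborel (\<lambda>x. h (0 + -1 * x) * indicator {0..} (0 + -1 * x))"
    by (rule lborel_integrable_real_affine[OF half]) simp
  with half have *: "integrable lborel (\<lambda>x. h x * indicator {0..} x + h (- x) * indicator {0..} (- x))"
    by (intro Bochner_Integration.integrable_add) auto
  show ?thesis
  proof (rule integrable_cong_AE_imp[OF *])
    show "AE x in lborel. h x * indicator {0..} x + h (- x) * indicator {0..} (- x) = h \<bar>x\<bar>"
      using AE_lborel_singleton[of 0] by eventually_elim (auto simp: indicator_def)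
  qed auto
qed

text \<open>Since (1 + |x|)^2 is at most 2 (1 + x^2), the function is dominated by a multiple of (1
  + |x|) powr (- 2 r), which has an elementary antiderivative on the half-line.\<close>

lemma integrable_bracket_powr:
  fixes r :: real
  assumes r: "1 / 2 < r"
  shows "integrable lborel (\<lambda>\<xi>. (1 + \<xi>\<^sup>2) powr (- r))"
proof -
  have half: "integrable lborel (\<lambda>x. (1 + x) powr (- (2 * r)) * indicator {0..} x)"
  proof (rule integrableI_nonneg)
    have "filterlim (\<lambda>x::real. 1 + x) at_top at_top"
      by (rule filterlim_tendsto_add_at_top[OF tendsto_const filterlim_ident])
    then have "((\<lambda>x. (1 + x) powr (1 - 2 * r)) \<longlongrightarrow> 0) at_top"
      using r by (intro tendsto_neg_powr) auto
    from tendsto_divide[OF this tendsto_const[of "1 - 2 * r"]]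
    have lim: "((\<lambda>x. (1 + x) powr (1 - 2 * r) / (1 - 2 * r)) \<longlongrightarrow> 0) at_top" using r by simp
    have "(\<integral>\<^sup>+x. ennreal ((1 + x) powr (- (2 * r))) * indicator {0..} x \<partial>lborel) = ennreal (0 - (1 + 0) powr (1 - 2 * r) / (1 - 2 * r))"
      using r by (intro nn_integral_FTC_atLeast[OF _ _ _ lim]) (auto intro!: derivative_eq_intros)
    then show "(\<integral>\<^sup>+x. ennreal ((1 + x) powr (- (2 * r)) * indicator {0..} x) \<partial>lborel) < \<infinity>"
      by (simp add: ennreal_mult' ennreal_indicator less_top)
  qed auto
  have "integrable lborel (\<lambda>x. (1 + \<bar>x\<bar>) powr (- (2 * r)))"
    using integrable_even_extension[OF half] by simp
  then have I: "integrable lborel (\<lambda>x. 2 powr r * (1 + \<bar>x\<bar>) powr (- (2 * r)))" by simp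
  show ?thesis
  proof (rule Bochner_Integration.integrable_bound[OF I])
    show "AE x in lborel. norm ((1 + x\<^sup>2) powr - r) \<le> norm (2 powr r * (1 + \<bar>x\<bar>) powr (- (2 * r)))"
    proof (rule AE_I2)
      fix x :: real
      have "(1 + \<bar>x\<bar>)\<^sup>2 / 2 \<le> 1 + x\<^sup>2"
        using sum_squares_bound[of 1 "\<bar>x\<bar>"] by (simp add: power2_sum)
      then have "(1 + x\<^sup>2) powr - r \<le> ((1 + \<bar>x\<bar>)\<^sup>2 / 2) powr - r"
        using r by (intro powr_mono2') (auto simp: power2_eq_square intro!: mult_pos_pos)
      also have "\<dots> = ((1 + \<bar>x\<bar>) powr 2) powr - r / 2 powr - r"
        by (simp add: powr_divide)
      also have "\<dots> = 2 powr r * (1 + \<bar>x\<bar>) powr (- (2 * r))"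
        by (simp only: powr_powr) (simp add: powr_minus_divide)
      finally show "norm ((1 + x\<^sup>2) powr - r) \<le> norm (2 powr r * (1 + \<bar>x\<bar>) powr (- (2 * r)))" by simp
    qed
  qed auto
qed

section \<open>The embedding of H^s into C^1 for s > 3/2\<close>

lemma has_real_derivative_integral_dominated:
  fixes k k' :: "real \<Rightarrow> 'a \<Rightarrow> real"
  assumes int: "\<And>x. integrable M (k x)"
    and der: "\<And>x \<xi>. ((\<lambda>x. k x \<xi>) has_real_derivative k' x \<xi>) (at x)"
    and dom: "\<And>x \<xi>. \<bar>k' x \<xi>\<bar> \<le> w \<xi>" and w: "integrable M w"
    and meas: "\<And>x. k' x \<in> borel_measurable M"
  shows "((\<lambda>x. LINT \<xi>|M. k x \<xi>) has_real_derivative (LINT \<xi>|M. k' x \<xi>)) (at x)"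
  unfolding DERIV_def tendsto_at_iff_sequentially
proof (intro allI impI)
  fix h :: "nat \<Rightarrow> real" assume h: "\<forall>i. h i \<in> UNIV - {0}" and h0: "h \<longlonglongrightarrow> 0"
  have "(\<lambda>n. LINT \<xi>|M. (k (x + h n) \<xi> - k x \<xi>) / h n) \<longlonglongrightarrow> (LINT \<xi>|M. k' x \<xi>)"
  proof (rule integral_dominated_convergence[where w = w])
    show "AE \<xi> in M. (\<lambda>n. (k (x + h n) \<xi> - k x \<xi>) / h n) \<longlonglongrightarrow> k' x \<xi>"
    proof (rule AE_I2)
      fix \<xi>
      have "((\<lambda>h. (k (x + h) \<xi> - k x \<xi>) / h) \<longlongrightarrow> k' x \<xi>) (at 0)" using der[of \<xi> x] by (simp add: DERIV_def)
      then show "(\<lambda>n. (k (x + h n) \<xi> - k x \<xi>) / h n) \<longlonglongrightarrow> k' x \<xi>"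
        using h h0 by (auto simp: tendsto_at_iff_sequentially comp_def)
    qed
    show "AE \<xi> in M. norm ((k (x + h n) \<xi> - k x \<xi>) / h n) \<le> w \<xi>" for n
    proof (rule AE_I2)
      fix \<xi>
      have "norm (k (x + h n) \<xi> - k x \<xi>) \<le> w \<xi> * norm (x + h n - x)"
        by (rule field_differentiable_bound[OF convex_UNIV, where f' = "\<lambda>x. k' x \<xi>"]) (auto simp: der dom)
      then show "norm ((k (x + h n) \<xi> - k x \<xi>) / h n) \<le> w \<xi>"
        using h by (simp add: abs_divide divide_le_eq)
    qed
  qed (use w meas int in auto)
  moreover have "(LINT \<xi>|M. (k (x + h n) \<xi> - k x \<xi>) / h n) = ((LINT \<xi>|M. k (x + h n) \<xi>) - (LINT \<xi>|M. k x \<xi>)) / h n" for n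
    using int by (simp only: integral_divide_zero Bochner_Integration.integral_diff)
  ultimately show "((\<lambda>h. ((LINT \<xi>|M. k (x + h) \<xi>) - (LINT \<xi>|M. k x \<xi>)) / h) \<circ> h) \<longlonglongrightarrow> (LINT \<xi>|M. k' x \<xi>)"
    unfolding comp_def by (simp only:)
qed

text \<open>A weighted L^1 norm of the transform. By Fourier inversion it dominates both |f| and
  |f'| uniformly, since sqrt (1 + \<xi>^2) is at least 1 and at least |\<xi>|.\<close>

definition bracket_norm :: "(real \<Rightarrow> complex) \<Rightarrow> real" where
  "bracket_norm g = (LINT \<xi>|lborel. sqrt (1 + \<xi>\<^sup>2) * cmod (g \<xi>))"

text \<open>Pointwise Young inequality in place of Cauchy-Schwarz, for the factorisation 1/2 = - (s
  - 1) / 2 + s / 2 of the exponent. The first summand is integrable exactly because s - 1 > 1/2. The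
  free parameter l lets the second summand, the H^s part, be small while the first one is small as
  well.\<close>

lemma bracket_young:
  fixes \<xi> s c l :: real
  assumes "0 < l"
  shows "sqrt (1 + \<xi>\<^sup>2) * c \<le> (l * (1 + \<xi>\<^sup>2) powr (- (s - 1)) + (1 + \<xi>\<^sup>2) powr s * c\<^sup>2 / l) / 2"
proof -
  define b where "b = 1 + \<xi>\<^sup>2"
  have b: "0 < b" by (simp add: b_def add_pos_nonneg)
  have "(sqrt l * b powr (- (s - 1) / 2)) * (b powr (s / 2) * c / sqrt l) = b powr (- (s - 1) / 2 + s / 2) * c"
    using assms by (simp add: powr_add)
  also have "\<dots> = sqrt b * c" using b by (simp add: powr_half_sqrt diff_divide_distrib)
  finally have "2 * (sqrt b * c) \<le> (sqrt l * b powr (- (s - 1) / 2))\<^sup>2 + (b powr (s / 2) * c / sqrt l)\<^sup>2"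
    using sum_squares_bound[of "sqrt l * b powr (- (s - 1) / 2)" "b powr (s / 2) * c / sqrt l"]
    by (simp only: mult.assoc)
  also have "\<dots> = l * b powr (- (s - 1)) + b powr s * c\<^sup>2 / l"
    using assms b by (simp add: power_mult_distrib power_divide powr_power add_divide_distrib diff_divide_distrib)
  finally show ?thesis by (simp add: b_def)
qed

context
  fixes s :: real
  assumes s: "3 / 2 < s"
begin

lemma
  assumes g[measurable]: "g \<in> borel_measurable lborel"
    and int: "integrable lborel (\<lambda>\<xi>. (1 + \<xi>\<^sup>2) powr s * (cmod (g \<xi>))\<^sup>2)"
  shows integrable_bracket: "integrable lborel (\<lambda>\<xi>. sqrt (1 + \<xi>\<^sup>2) * cmod (g \<xi>))"
    and bracket_norm_le: "0 < l \<Longrightarrow> bracket_norm g \<le> (l * (LINT \<xi>|lborel. (1 + \<xi>\<^sup>2) powr (- (s - 1)))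
          + (LINT \<xi>|lborel. (1 + \<xi>\<^sup>2) powr s * (cmod (g \<xi>))\<^sup>2) / l) / 2"
proof -
  have w: "integrable lborel (\<lambda>\<xi>. (1 + \<xi>\<^sup>2) powr (- (s - 1)))"
    using integrable_bracket_powr[of "s - 1"] s by simp
  have R: "integrable lborel (\<lambda>\<xi>. (l * (1 + \<xi>\<^sup>2) powr (- (s - 1)) + (1 + \<xi>\<^sup>2) powr s * (cmod (g \<xi>))\<^sup>2 / l) / 2)" for l
    using w int by (intro integrable_divide Bochner_Integration.integrable_add) auto
  show *: "integrable lborel (\<lambda>\<xi>. sqrt (1 + \<xi>\<^sup>2) * cmod (g \<xi>))"
  proof (rule Bochner_Integration.integrable_bound[OF R[of 1]])
    show "AE \<xi> in lborel. norm (sqrt (1 + \<xi>\<^sup>2) * cmod (g \<xi>)) \<le>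
        norm ((1 * (1 + \<xi>\<^sup>2) powr (- (s - 1)) + (1 + \<xi>\<^sup>2) powr s * (cmod (g \<xi>))\<^sup>2 / 1) / 2)"
      using bracket_young[of 1 _ "cmod (g _)" s] by (intro AE_I2) (simp add: abs_mult)
  qed auto
  show "bracket_norm g \<le> (l * (LINT \<xi>|lborel. (1 + \<xi>\<^sup>2) powr (- (s - 1)))
          + (LINT \<xi>|lborel. (1 + \<xi>\<^sup>2) powr s * (cmod (g \<xi>))\<^sup>2) / l) / 2" if "0 < l"
  proof -
    have "bracket_norm g \<le> (LINT \<xi>|lborel. (l * (1 + \<xi>\<^sup>2) powr (- (s - 1)) + (1 + \<xi>\<^sup>2) powr s * (cmod (g \<xi>))\<^sup>2 / l) / 2)"
      unfolding bracket_norm_def by (intro integral_mono * R bracket_young that)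
    also have "\<dots> = (l * (LINT \<xi>|lborel. (1 + \<xi>\<^sup>2) powr (- (s - 1)))
          + (LINT \<xi>|lborel. (1 + \<xi>\<^sup>2) powr s * (cmod (g \<xi>))\<^sup>2) / l) / 2"
      using w int by (simp add: Bochner_Integration.integral_add)
    finally show ?thesis .
  qed
qed

lemma integrable_Hs_transform:
  assumes "Hs_transform s f g"
  shows "integrable lborel (\<lambda>\<xi>. g \<xi> * cis (x * \<xi>))"
proof -
  have [measurable]: "g \<in> borel_measurable lborel" using assms by (simp add: Hs_transform_def)
  have "integrable lborel (\<lambda>\<xi>. sqrt (1 + \<xi>\<^sup>2) * cmod (g \<xi>))"
    using assms by (intro integrable_bracket) (auto simp: Hs_transform_def)
  then show ?thesis
  proof (rule Bochner_Integration.integrable_bound)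
    show "(\<lambda>\<xi>. g \<xi> * cis (x * \<xi>)) \<in> borel_measurable lborel"
      unfolding cis_conv_exp by measurable
    have "1 * c \<le> sqrt (1 + \<xi>\<^sup>2) * c" if "0 \<le> c" for \<xi> c :: real
      using that by (intro mult_right_mono) auto
    then show "AE \<xi> in lborel. norm (g \<xi> * cis (x * \<xi>)) \<le> norm (sqrt (1 + \<xi>\<^sup>2) * cmod (g \<xi>))"
      by (intro AE_I2) (simp add: norm_mult abs_mult)
  qed
qed

text \<open>Makes the sup bounds below available for differences of the solution at two
  times.\<close>

lemma Hs_transform_diff:
  assumes f: "Hs_transform s f g" and f': "Hs_transform s f' g'"
  shows "Hs_transform s (\<lambda>x. f x - f' x) (\<lambda>\<xi>. g \<xi> - g' \<xi>)"
  unfolding Hs_transform_def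
proof (intro conjI allI)
  have [measurable]: "g \<in> borel_measurable lborel" "g' \<in> borel_measurable lborel"
    using f f' by (auto simp: Hs_transform_def)
  show "(\<lambda>\<xi>. g \<xi> - g' \<xi>) \<in> borel_measurable lborel" by measurable
  have "integrable lborel (\<lambda>\<xi>. 2 * ((1 + \<xi>\<^sup>2) powr s * (cmod (g \<xi>))\<^sup>2) + 2 * ((1 + \<xi>\<^sup>2) powr s * (cmod (g' \<xi>))\<^sup>2))"
    using f f' by (auto simp: Hs_transform_def)
  then show "integrable lborel (\<lambda>\<xi>. (1 + \<xi>\<^sup>2) powr s * (cmod (g \<xi> - g' \<xi>))\<^sup>2)"
  proof (rule Bochner_Integration.integrable_bound)
    show "AE \<xi> in lborel. norm ((1 + \<xi>\<^sup>2) powr s * (cmod (g \<xi> - g' \<xi>))\<^sup>2)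
        \<le> norm (2 * ((1 + \<xi>\<^sup>2) powr s * (cmod (g \<xi>))\<^sup>2) + 2 * ((1 + \<xi>\<^sup>2) powr s * (cmod (g' \<xi>))\<^sup>2))"
    proof (rule AE_I2)
      fix \<xi>
      have "(cmod (g \<xi> - g' \<xi>))\<^sup>2 \<le> (cmod (g \<xi>) + cmod (g' \<xi>))\<^sup>2"
        by (intro power_mono norm_triangle_ineq4) auto
      also have "\<dots> \<le> 2 * (cmod (g \<xi>))\<^sup>2 + 2 * (cmod (g' \<xi>))\<^sup>2"
        using sum_squares_bound[of "cmod (g \<xi>)" "cmod (g' \<xi>)"] by (simp add: power2_sum)
      finally have "(1 + \<xi>\<^sup>2) powr s * (cmod (g \<xi> - g' \<xi>))\<^sup>2 \<le> (1 + \<xi>\<^sup>2) powr s * (2 * (cmod (g \<xi>))\<^sup>2 + 2 * (cmod (g' \<xi>))\<^sup>2)"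
        by (intro mult_left_mono) auto
      then show "norm ((1 + \<xi>\<^sup>2) powr s * (cmod (g \<xi> - g' \<xi>))\<^sup>2)
        \<le> norm (2 * ((1 + \<xi>\<^sup>2) powr s * (cmod (g \<xi>))\<^sup>2) + 2 * ((1 + \<xi>\<^sup>2) powr s * (cmod (g' \<xi>))\<^sup>2))"
        by (simp add: abs_mult distrib_left mult.left_commute)
    qed
  qed auto
  fix x
  show "complex_of_real (f x - f' x) = fourier_inv (\<lambda>\<xi>. g \<xi> - g' \<xi>) x"
    using f f' integrable_Hs_transform[OF f, of x] integrable_Hs_transform[OF f', of x]
    by (simp add: Hs_transform_def fourier_inv_def left_diff_distrib right_diff_distrib)
qed

text \<open>The factor \<xi> produced by differentiating the inversion formula is absorbed by the
  bracket, so one integrable majorant serves the function, its derivative and the continuity of the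
  derivative.\<close>

lemma
  assumes H: "Hs_transform s f g"
  shows Hs_has_deriv: "(f has_real_derivative deriv f x) (at x)"
    and Hs_deriv_continuous: "continuous_on UNIV (deriv f)"
    and Hs_bound: "\<bar>f x\<bar> \<le> bracket_norm g"
    and Hs_deriv_bound: "\<bar>deriv f x\<bar> \<le> bracket_norm g"
proof -
  have g[measurable]: "g \<in> borel_measurable lborel"
    and gint: "integrable lborel (\<lambda>\<xi>. (1 + \<xi>\<^sup>2) powr s * (cmod (g \<xi>))\<^sup>2)"
    and feq: "\<And>x. complex_of_real (f x) = fourier_inv g x"
    using H by (auto simp: Hs_transform_def)
  let ?w = "\<lambda>\<xi>. sqrt (1 + \<xi>\<^sup>2) * cmod (g \<xi>)"
  have w: "integrable lborel ?w" using g gint by (rule integrable_bracket)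
  have w1: "1 \<le> sqrt (1 + \<xi>\<^sup>2)" "\<bar>\<xi>\<bar> \<le> sqrt (1 + \<xi>\<^sup>2)" for \<xi> :: real
    by (auto intro: real_le_rsqrt)
  \<comment> \<open>As f is real, the real part of the integrand suffices, and differentiation under
    the integral can be done for real kernels.\<close>
  define k where "k x \<xi> = Re (g \<xi> * cis (x * \<xi>))" for x \<xi>
  define k' where "k' x \<xi> = Re (g \<xi> * (\<i> * \<xi>) * cis (x * \<xi>))" for x \<xi>
  have k: "k x \<xi> = Re (g \<xi>) * cos (x * \<xi>) - Im (g \<xi>) * sin (x * \<xi>)" for x \<xi> by (simp add: k_def)
  have k': "k' x \<xi> = - (\<xi> * (Re (g \<xi>) * sin (x * \<xi>) + Im (g \<xi>) * cos (x * \<xi>)))" for x \<xi>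
    by (simp add: k'_def algebra_simps)
  have kint: "integrable lborel (k x)" for x
    unfolding k_def[abs_def] using integrable_Re[OF integrable_Hs_transform[OF H, of x]] by simp
  have kb: "\<bar>k x \<xi>\<bar> \<le> ?w \<xi>" for x \<xi>
  proof -
    have "\<bar>k x \<xi>\<bar> \<le> cmod (g \<xi> * cis (x * \<xi>))" unfolding k_def by (rule abs_Re_le_cmod)
    also have "\<dots> = 1 * cmod (g \<xi>)" by (simp add: norm_mult)
    also have "\<dots> \<le> ?w \<xi>" by (intro mult_right_mono w1) auto
    finally show ?thesis .
  qed
  have k'b: "\<bar>k' x \<xi>\<bar> \<le> ?w \<xi>" for x \<xi>
  proof -
    have "\<bar>k' x \<xi>\<bar> \<le> cmod (g \<xi> * (\<i> * \<xi>) * cis (x * \<xi>))" unfolding k'_def by (rule abs_Re_le_cmod)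
    also have "\<dots> = \<bar>\<xi>\<bar> * cmod (g \<xi>)" by (simp add: norm_mult)
    also have "\<dots> \<le> ?w \<xi>" by (intro mult_right_mono w1) auto
    finally show ?thesis .
  qed
  have k'm[measurable]: "k' x \<in> borel_measurable lborel" for x unfolding k' by measurable
  have f: "f = (\<lambda>x. (1 / (2 * pi)) * (LINT \<xi>|lborel. k x \<xi>))"
  proof
    fix x
    have "f x = Re (fourier_inv g x)" by (simp flip: feq)
    also have "\<dots> = (1 / (2 * pi)) * Re (LINT \<xi>|lborel. g \<xi> * cis (x * \<xi>))"
      by (simp add: fourier_inv_def)
    also have "Re (LINT \<xi>|lborel. g \<xi> * cis (x * \<xi>)) = (LINT \<xi>|lborel. k x \<xi>)"
      unfolding k_def using integral_Re[OF integrable_Hs_transform[OF H, of x]] by simp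
    finally show "f x = (1 / (2 * pi)) * (LINT \<xi>|lborel. k x \<xi>)" .
  qed
  have "((\<lambda>x. LINT \<xi>|lborel. k x \<xi>) has_real_derivative (LINT \<xi>|lborel. k' x \<xi>)) (at x)" for x
    by (rule has_real_derivative_integral_dominated[OF kint _ k'b w k'm])
      (auto simp: k k' intro!: derivative_eq_intros, simp add: algebra_simps)
  then have fd: "(f has_real_derivative (1 / (2 * pi)) * (LINT \<xi>|lborel. k' x \<xi>)) (at x)" for x
    unfolding f by (rule DERIV_cmult)
  then have df: "deriv f = (\<lambda>x. (1 / (2 * pi)) * (LINT \<xi>|lborel. k' x \<xi>))" by (auto intro!: DERIV_imp_deriv)
  show "(f has_real_derivative deriv f x) (at x)" using fd df by simp
  have "isCont (\<lambda>x. LINT \<xi>|lborel. k' x \<xi>) x" for x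
    unfolding continuous_at_sequentially
  proof (intro allI impI)
    fix X assume X: "X \<longlonglongrightarrow> x"
    show "((\<lambda>x. LINT \<xi>|lborel. k' x \<xi>) \<circ> X) \<longlonglongrightarrow> (LINT \<xi>|lborel. k' x \<xi>)"
      unfolding comp_def
    proof (rule integral_dominated_convergence[where w = ?w])
      show "AE \<xi> in lborel. (\<lambda>n. k' (X n) \<xi>) \<longlonglongrightarrow> k' x \<xi>"
        unfolding k' using X by (intro AE_I2 tendsto_intros)
    qed (use w k'b in auto)
  qed
  then show "continuous_on UNIV (deriv f)"
    unfolding df by (intro continuous_on_mult_left continuous_at_imp_continuous_on) auto
  have pi1: "(1 / (2 * pi)) * c \<le> c" if "0 \<le> c" for c
  proof -
    have "1 / (2 * pi) \<le> 1" using pi_gt3 by (simp add: field_simps)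
    from mult_right_mono[OF this that] show ?thesis by simp
  qed
  have bn: "0 \<le> bracket_norm g" unfolding bracket_norm_def by (intro integral_nonneg_AE) auto
  have b: "\<bar>(1 / (2 * pi)) * (LINT \<xi>|lborel. h \<xi>)\<bar> \<le> bracket_norm g"
    if "integrable lborel h" "\<And>\<xi>. \<bar>h \<xi>\<bar> \<le> ?w \<xi>" for h :: "real \<Rightarrow> real"
  proof -
    have "\<bar>LINT \<xi>|lborel. h \<xi>\<bar> \<le> (LINT \<xi>|lborel. \<bar>h \<xi>\<bar>)" by (rule integral_abs_bound)
    also have "\<dots> \<le> bracket_norm g" unfolding bracket_norm_def
      using that w by (intro integral_mono) auto
    finally have "(1 / (2 * pi)) * \<bar>LINT \<xi>|lborel. h \<xi>\<bar> \<le> (1 / (2 * pi)) * bracket_norm g"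
      by (intro mult_left_mono) auto
    then show ?thesis using pi1[OF bn] by (simp add: abs_mult)
  qed
  show "\<bar>f x\<bar> \<le> bracket_norm g" unfolding f by (intro b kint kb)
  have "integrable lborel (k' x)"
    using w k'b by (intro Bochner_Integration.integrable_bound[OF w k'm]) (auto intro!: AE_I2 order_trans[OF k'b])
  then show "\<bar>deriv f x\<bar> \<le> bracket_norm g" unfolding df by (intro b k'b)
qed

text \<open>Continuity in H^s is used only through its consequence in \<open>bracket_norm\<close>:
  applied to differences it gives moduli of continuity in time that are uniform in x, and
  compactness of the time interval turns it into one bound K for u and its derivative.\<close>

lemma C_Hs_regular:
  assumes C: "C_Hs T s u"
  obtains K where "\<And>t x. t \<in> {0..T} \<Longrightarrow> \<bar>u t x\<bar> \<le> K" "\<And>t x. t \<in> {0..T} \<Longrightarrow> \<bar>deriv (u t) x\<bar> \<le> K"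
    "\<And>t x. t \<in> {0..T} \<Longrightarrow> (u t has_real_derivative deriv (u t) x) (at x)"
    "\<And>t. t \<in> {0..T} \<Longrightarrow> continuous_on UNIV (deriv (u t))"
    "\<And>t e. t \<in> {0..T} \<Longrightarrow> 0 < e \<Longrightarrow> \<exists>d>0. \<forall>\<tau>\<in>{0..T}. \<bar>\<tau> - t\<bar> < d \<longrightarrow>
        (\<forall>x. \<bar>u \<tau> x - u t x\<bar> \<le> e \<and> \<bar>deriv (u \<tau>) x - deriv (u t) x\<bar> \<le> e)"
proof -
  obtain U where U: "\<And>t. t \<in> {0..T} \<Longrightarrow> Hs_transform s (u t) (U t)"
    and lim: "\<And>t. t \<in> {0..T} \<Longrightarrow> ((\<lambda>\<tau>. LINT \<xi>|lborel. (1 + \<xi>\<^sup>2) powr s * (cmod (U \<tau> \<xi> - U t \<xi>))\<^sup>2)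
                      \<longlongrightarrow> 0) (at t within {0..T})"
    using C unfolding C_Hs_def by blast
  define d where "d \<tau> t = bracket_norm (\<lambda>\<xi>. U \<tau> \<xi> - U t \<xi>)" for \<tau> t
  define W where "W = (LINT \<xi>|lborel. (1 + \<xi>\<^sup>2) powr (- (s - 1)))"
  have W: "0 \<le> W" unfolding W_def by (intro integral_nonneg_AE) auto
  have HD: "Hs_transform s (\<lambda>x. u \<tau> x - u t x) (\<lambda>\<xi>. U \<tau> \<xi> - U t \<xi>)" if "\<tau> \<in> {0..T}" "t \<in> {0..T}" for \<tau> t
    by (intro Hs_transform_diff U that)
  have close: "\<exists>\<delta>>0. \<forall>\<tau>\<in>{0..T}. \<bar>\<tau> - t\<bar> < \<delta> \<longrightarrow> d \<tau> t \<le> e" if t: "t \<in> {0..T}" and e: "0 < e" for t e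
  proof -
    \<comment> \<open>Balances the two halves of \<open>bracket_norm_le\<close>: l W is at most e,
      and the squared H^s distance is made smaller than l e. The 1 covers W = 0.\<close>
    define l where "l = e / (W + 1)"
    have l: "0 < l" using e W by (simp add: l_def)
    have "l * e > 0" using l e by simp
    from tendstoD[OF lim[OF t] this] obtain \<delta> where \<delta>: "0 < \<delta>"
      "\<And>\<tau>. \<tau> \<in> {0..T} \<Longrightarrow> \<tau> \<noteq> t \<Longrightarrow> \<bar>\<tau> - t\<bar> < \<delta> \<Longrightarrow> (LINT \<xi>|lborel. (1 + \<xi>\<^sup>2) powr s * (cmod (U \<tau> \<xi> - U t \<xi>))\<^sup>2) < l * e"
      by (auto simp: eventually_at dist_real_def)
    have "d \<tau> t \<le> e" if \<tau>: "\<tau> \<in> {0..T}" "\<bar>\<tau> - t\<bar> < \<delta>" for \<tau>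
    proof (cases "\<tau> = t")
      case True
      then show ?thesis using e by (simp add: d_def bracket_norm_def)
    next
      case False
      have "d \<tau> t \<le> (l * W + (LINT \<xi>|lborel. (1 + \<xi>\<^sup>2) powr s * (cmod (U \<tau> \<xi> - U t \<xi>))\<^sup>2) / l) / 2"
        unfolding d_def W_def using HD[OF \<tau>(1) t] l by (intro bracket_norm_le) (auto simp: Hs_transform_def)
      also have "\<dots> \<le> (e + (l * e) / l) / 2"
      proof -
        have a: "l * W \<le> e" using e W by (simp add: l_def divide_le_eq)
        have b: "(LINT \<xi>|lborel. (1 + \<xi>\<^sup>2) powr s * (cmod (U \<tau> \<xi> - U t \<xi>))\<^sup>2) / l \<le> (l * e) / l"
          using \<delta>(2)[OF \<tau>(1) False \<tau>(2)] l by (intro divide_right_mono) auto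
        show ?thesis by (rule divide_right_mono[OF add_mono[OF a b]]) simp
      qed
      finally show ?thesis using l by simp
    qed
    then show ?thesis using \<delta>(1) by blast
  qed
  have int: "integrable lborel (\<lambda>\<xi>. sqrt (1 + \<xi>\<^sup>2) * cmod (g \<xi>))" if "Hs_transform s f g" for f g
    using that by (intro integrable_bracket) (auto simp: Hs_transform_def)
  have tri: "\<bar>bracket_norm (U \<tau>) - bracket_norm (U t)\<bar> \<le> d \<tau> t" if "\<tau> \<in> {0..T}" "t \<in> {0..T}" for \<tau> t
  proof -
    note I = int[OF U[OF that(1)]] int[OF U[OF that(2)]]
    have eq: "bracket_norm (U \<tau>) - bracket_norm (U t)
        = (LINT \<xi>|lborel. sqrt (1 + \<xi>\<^sup>2) * cmod (U \<tau> \<xi>) - sqrt (1 + \<xi>\<^sup>2) * cmod (U t \<xi>))"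
      using I by (simp add: bracket_norm_def)
    have "\<bar>bracket_norm (U \<tau>) - bracket_norm (U t)\<bar> \<le> (LINT \<xi>|lborel. \<bar>sqrt (1 + \<xi>\<^sup>2) * cmod (U \<tau> \<xi>) - sqrt (1 + \<xi>\<^sup>2) * cmod (U t \<xi>)\<bar>)"
      unfolding eq by (rule integral_abs_bound)
    also have "\<dots> \<le> d \<tau> t"
      unfolding d_def bracket_norm_def
    proof (rule integral_mono)
      show "integrable lborel (\<lambda>\<xi>. sqrt (1 + \<xi>\<^sup>2) * cmod (U \<tau> \<xi> - U t \<xi>))" by (rule int[OF HD[OF that]])
      show "\<bar>sqrt (1 + \<xi>\<^sup>2) * cmod (U \<tau> \<xi>) - sqrt (1 + \<xi>\<^sup>2) * cmod (U t \<xi>)\<bar> \<le> sqrt (1 + \<xi>\<^sup>2) * cmod (U \<tau> \<xi> - U t \<xi>)" for \<xi>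
        using norm_triangle_ineq3[of "U \<tau> \<xi>" "U t \<xi>"]
        by (simp add: abs_mult mult_left_mono flip: right_diff_distrib)
    qed (use I in auto)
    finally show ?thesis .
  qed
  have "continuous_on {0..T} (\<lambda>t. bracket_norm (U t))"
    unfolding continuous_on_iff
  proof (intro ballI allI impI)
    fix t e :: real assume t: "t \<in> {0..T}" and e: "0 < e"
    obtain \<delta> where "0 < \<delta>" "\<And>\<tau>. \<tau> \<in> {0..T} \<Longrightarrow> \<bar>\<tau> - t\<bar> < \<delta> \<Longrightarrow> d \<tau> t \<le> e / 2"
      using close[OF t, of "e / 2"] e by auto
    then show "\<exists>d>0. \<forall>x'\<in>{0..T}. dist x' t < d \<longrightarrow> dist (bracket_norm (U x')) (bracket_norm (U t)) < e"
      using tri[OF _ t] e by (intro exI[of _ \<delta>]) (fastforce simp: dist_real_def)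
  qed
  then have "bounded ((\<lambda>t. bracket_norm (U t)) ` {0..T})"
    by (intro compact_imp_bounded compact_continuous_image) auto
  then have "\<exists>K. \<forall>t\<in>{0..T}. \<bar>bracket_norm (U t)\<bar> \<le> K" by (auto simp: bounded_iff)
  then obtain K where K: "\<And>t. t \<in> {0..T} \<Longrightarrow> \<bar>bracket_norm (U t)\<bar> \<le> K" by blast
  show thesis
  proof
    fix t assume t: "t \<in> {0..T}"
    show "\<bar>u t x\<bar> \<le> K" "\<bar>deriv (u t) x\<bar> \<le> K" for x
      using Hs_bound[OF U[OF t], of x] Hs_deriv_bound[OF U[OF t], of x] K[OF t] by auto
    show "(u t has_real_derivative deriv (u t) x) (at x)" for x by (rule Hs_has_deriv[OF U[OF t]])
    show "continuous_on UNIV (deriv (u t))" by (rule Hs_deriv_continuous[OF U[OF t]])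
    fix e :: real assume e: "0 < e"
    obtain \<delta> where \<delta>: "0 < \<delta>" "\<And>\<tau>. \<tau> \<in> {0..T} \<Longrightarrow> \<bar>\<tau> - t\<bar> < \<delta> \<Longrightarrow> d \<tau> t \<le> e"
      using close[OF t e] by auto
    have "\<bar>u \<tau> x - u t x\<bar> \<le> d \<tau> t \<and> \<bar>deriv (u \<tau>) x - deriv (u t) x\<bar> \<le> d \<tau> t" if \<tau>: "\<tau> \<in> {0..T}" for \<tau> x
    proof -
      have "((\<lambda>x. u \<tau> x - u t x) has_real_derivative deriv (u \<tau>) x - deriv (u t) x) (at x)"
        by (intro DERIV_diff Hs_has_deriv[OF U] \<tau> t)
      then have "deriv (\<lambda>x. u \<tau> x - u t x) x = deriv (u \<tau>) x - deriv (u t) x" by (rule DERIV_imp_deriv)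
      then show ?thesis using Hs_bound[OF HD[OF \<tau> t], of x] Hs_deriv_bound[OF HD[OF \<tau> t], of x] by (simp add: d_def)
    qed
    then show "\<exists>d>0. \<forall>\<tau>\<in>{0..T}. \<bar>\<tau> - t\<bar> < d \<longrightarrow>
        (\<forall>x. \<bar>u \<tau> x - u t x\<bar> \<le> e \<and> \<bar>deriv (u \<tau>) x - deriv (u t) x\<bar> \<le> e)"
      using \<delta> by (intro exI[of _ \<delta>]) (meson order_trans)
  qed
qed

end

section \<open>Convolution with the Green function\<close>

lemma has_bochner_integral_exp_neg_abs:
  fixes a :: real
  assumes a: "0 < a"
  shows "has_bochner_integral lborel (\<lambda>x. exp (- (a * \<bar>x\<bar>))) (2 / a)"
proof -
  have half: "has_bochner_integral lborel (\<lambda>x. exp (- (a * x)) * indicator {0..} x) (1 / a)"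
  proof (rule has_bochner_integral_nn_integral)
    have "filterlim (\<lambda>x. a * x) at_top at_top"
      using a by (intro filterlim_tendsto_pos_mult_at_top[OF tendsto_const]) (auto simp: filterlim_ident)
    then have "((\<lambda>x. exp (- (a * x))) \<longlongrightarrow> 0) at_top"
      by (intro filterlim_compose[OF exp_at_bot]) (simp add: filterlim_uminus_at_bot)
    from tendsto_divide[OF tendsto_minus[OF this] tendsto_const[of a]]
    have "((\<lambda>x. - exp (- (a * x)) / a) \<longlongrightarrow> 0) at_top"
      using a by simp
    then have "(\<integral>\<^sup>+x. ennreal (exp (- (a * x))) * indicator {0..} x \<partial>lborel) = ennreal (0 - (- exp (- (a * 0)) / a))"
      using a by (intro nn_integral_FTC_atLeast) (auto intro!: derivative_eq_intros)
    then show "(\<integral>\<^sup>+x. ennreal (exp (- (a * x)) * indicator {0..} x) \<partial>lborel) = ennreal (1 / a)"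
      by (simp add: ennreal_mult' ennreal_indicator)
  qed (use a in auto)
  have "has_bochner_integral lborel (\<lambda>x. exp (- (a * (0 + -1 * x))) * indicator {0..} (0 + -1 * x)) ((1 / a) /\<^sub>R \<bar>-1\<bar>)"
    using half by (intro lborel_has_bochner_integral_real_affine_iff[THEN iffD1]) auto
  then have "has_bochner_integral lborel (\<lambda>x. exp (a * x) * indicator {..0} x) (1 / a)"
    by (simp add: indicator_def)
  from has_bochner_integral_add[OF half this]
  have *: "has_bochner_integral lborel (\<lambda>x. exp (- (a * x)) * indicator {0..} x + exp (a * x) * indicator {..0} x) (2 / a)"
    by simp
  show ?thesis
  proof (rule has_bochner_integral_cong_AE[THEN iffD1, OF _ _ _ *])
    show "AE x in lborel. exp (- (a * x)) * indicator {0..} x + exp (a * x) * indicator {..0} x = exp (- (a * \<bar>x\<bar>))"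
      using AE_lborel_singleton[of 0] by eventually_elim (auto simp: indicator_def)
  qed auto
qed

lemmas integrable_exp_neg_abs = has_bochner_integral_exp_neg_abs[THEN integrable.intros]
lemmas integral_exp_neg_abs = has_bochner_integral_exp_neg_abs[THEN has_bochner_integral_integral_eq]

lemma integrable_CH_G_shift: "integrable lborel (\<lambda>y. CH_G (x - y))"
proof -
  have "integrable lborel CH_G" unfolding CH_G_def using integrable_exp_neg_abs[of 1] by simp
  from lborel_integrable_real_affine[OF this, of "-1" x] show ?thesis by simp
qed

lemma integral_CH_G_shift: "(LINT y|lborel. CH_G (x - y)) = 1"
proof -
  have "(LINT y|lborel. CH_G y) = 1" unfolding CH_G_def using integral_exp_neg_abs[of 1] by simp
  then show ?thesis using lborel_integral_real_affine[of "-1" CH_G x] by simp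
qed

lemma CH_G_nonneg: "0 \<le> CH_G x" by (simp add: CH_G_def)

definition G_conv :: "(real \<Rightarrow> real) \<Rightarrow> real \<Rightarrow> real" where
  "G_conv F x = (LINT y|lborel. CH_G (x - y) * F y)"

lemma integrable_G_conv:
  fixes F :: "real \<Rightarrow> real"
  assumes [measurable]: "F \<in> borel_measurable borel" and "\<And>y. \<bar>F y\<bar> \<le> K"
  shows "integrable lborel (\<lambda>y. CH_G (x - y) * F y)"
proof (rule Bochner_Integration.integrable_bound[OF integrable_mult_left[OF integrable_CH_G_shift[of x], where c = K]])
  show "(\<lambda>y. CH_G (x - y) * F y) \<in> borel_measurable lborel" unfolding CH_G_def by measurable
  show "AE y in lborel. norm (CH_G (x - y) * F y) \<le> norm (CH_G (x - y) * K)"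
    using assms(2) by (intro AE_I2) (auto simp: abs_mult CH_G_nonneg intro!: mult_left_mono order_trans[OF _ abs_ge_self])
qed

lemma G_conv_bound:
  fixes F :: "real \<Rightarrow> real"
  assumes [measurable]: "F \<in> borel_measurable borel" and "\<And>y. \<bar>F y\<bar> \<le> K"
  shows "\<bar>G_conv F x\<bar> \<le> K"
proof -
  have "\<bar>G_conv F x\<bar> \<le> (LINT y|lborel. \<bar>CH_G (x - y) * F y\<bar>)" unfolding G_conv_def by (rule integral_abs_bound)
  also have "\<dots> \<le> (LINT y|lborel. CH_G (x - y) * K)"
    using integrable_CH_G_shift[of x] assms
    by (intro integral_mono integrable_abs integrable_G_conv) (auto simp: abs_mult CH_G_nonneg intro!: mult_left_mono)
  also have "\<dots> = K" by (simp add: integral_CH_G_shift)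
  finally show ?thesis .
qed

lemma G_conv_diff_bound:
  fixes F :: "real \<Rightarrow> real"
  assumes [measurable]: "F \<in> borel_measurable borel" "H \<in> borel_measurable borel"
    and "\<And>y. \<bar>F y\<bar> \<le> K" "\<And>y. \<bar>H y\<bar> \<le> K" "\<And>y. \<bar>F y - H y\<bar> \<le> e"
  shows "\<bar>G_conv F x - G_conv H x\<bar> \<le> e"
proof -
  have "G_conv F x - G_conv H x = G_conv (\<lambda>y. F y - H y) x"
    unfolding G_conv_def using integrable_G_conv[of F K x] integrable_G_conv[of H K x] assms
    by (simp add: right_diff_distrib)
  then show ?thesis using G_conv_bound[of "\<lambda>y. F y - H y" e x] assms by simp
qed

section \<open>The two exponential halves of the convolution, and its derivatives\<close>

definition left_exp_int :: "(real \<Rightarrow> real) \<Rightarrow> real \<Rightarrow> real" where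
  "left_exp_int F x = (LINT y:{..x}|lborel. exp y * F y)"

lemma set_integrable_left_exp:
  fixes F :: "real \<Rightarrow> real"
  assumes [measurable]: "F \<in> borel_measurable borel" and bd: "\<And>y. \<bar>F y\<bar> \<le> K"
  shows "set_integrable lborel {..x} (\<lambda>y. exp y * F y)"
  unfolding set_integrable_def
proof (rule Bochner_Integration.integrable_bound)
  show "integrable lborel (\<lambda>y. exp (- (1 * \<bar>y\<bar>)) * (exp (2 * \<bar>x\<bar>) * K))"
    using integrable_exp_neg_abs[of 1] by (intro integrable_mult_left) simp
  have "exp y * \<bar>F y\<bar> \<le> exp (- \<bar>y\<bar>) * (exp (2 * \<bar>x\<bar>) * K)" if "y \<le> x" for y
  proof -
    have "exp y \<le> exp (- \<bar>y\<bar>) * exp (2 * \<bar>x\<bar>)" using that by (simp flip: exp_add)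
    then show ?thesis using bd[of y] mult_mono[of "exp y" "exp (- \<bar>y\<bar>) * exp (2 * \<bar>x\<bar>)" "\<bar>F y\<bar>" K]
      by (simp add: mult.assoc)
  qed
  then show "AE y in lborel. norm (indicat_real {..x} y *\<^sub>R (exp y * F y)) \<le> norm (exp (- (1 * \<bar>y\<bar>)) * (exp (2 * \<bar>x\<bar>) * K))"
    using order_trans[OF abs_ge_zero bd] by (intro AE_I2) (auto simp: indicator_def abs_mult)
qed auto

lemma left_exp_int_deriv:
  fixes F :: "real \<Rightarrow> real"
  assumes cont: "continuous_on UNIV F" and bd: "\<And>y. \<bar>F y\<bar> \<le> K"
  shows "(left_exp_int F has_real_derivative exp x * F x) (at x)"
proof -
  have [measurable]: "F \<in> borel_measurable borel" using cont by (rule borel_measurable_continuous_onI)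
  have h: "continuous_on S (\<lambda>y. exp y * F y)" for S
    using cont by (auto intro!: continuous_intros intro: continuous_on_subset)
  \<comment> \<open>The infinite lower limit is traded for x - 1: the remaining piece does not
    depend on z, and the fundamental theorem applies to the compact one.\<close>
  have eq: "left_exp_int F z = left_exp_int F (x - 1) + integral {x - 1..z} (\<lambda>y. exp y * F y)" if "x - 1 \<le> z" for z
  proof -
    have "{..z} = {..x - 1} \<union> {x - 1<..z}" using that by auto
    then have "left_exp_int F z = left_exp_int F (x - 1) + (LINT y:{x - 1<..z}|lborel. exp y * F y)"
      unfolding left_exp_int_def
      using set_integrable_left_exp[OF _ bd] that
      by (simp, subst set_integral_Un) (auto intro: set_integrable_subset[OF set_integrable_left_exp[OF _ bd, where x = z]])
    also have "(LINT y:{x - 1<..z}|lborel. exp y * F y) = (LINT y:{x - 1..z}|lborel. exp y * F y)"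
      unfolding set_lebesgue_integral_def
    proof (rule integral_cong_AE)
      show "AE y in lborel. indicat_real {x - 1<..z} y *\<^sub>R (exp y * F y) = indicat_real {x - 1..z} y *\<^sub>R (exp y * F y)"
        using AE_lborel_singleton[of "x - 1"] by eventually_elim (auto simp: indicator_def)
    qed auto
    also have "\<dots> = integral {x - 1..z} (\<lambda>y. exp y * F y)"
      by (rule set_borel_integral_eq_integral(2)) (rule borel_integrable_atLeastAtMost'[OF h])
    finally show ?thesis .
  qed
  have "((\<lambda>z. integral {x - 1..z} (\<lambda>y. exp y * F y)) has_real_derivative exp x * F x) (at x within {x - 1..x + 1})"
    by (intro integral_has_real_derivative h) auto
  then have "((\<lambda>z. integral {x - 1..z} (\<lambda>y. exp y * F y)) has_real_derivative exp x * F x) (at x)"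
    by (simp add: at_within_interior[of x "{x - 1..x + 1}"])
  then have "((\<lambda>z. left_exp_int F (x - 1) + integral {x - 1..z} (\<lambda>y. exp y * F y)) has_real_derivative exp x * F x) (at x)"
    by (auto intro!: derivative_eq_intros)
  then show ?thesis
    by (rule has_field_derivative_transform_within_open[where S = "{x - 1<..}"]) (auto intro!: eq[symmetric])
qed

text \<open>Writing G*F = (R + L) / 2 with R the part right of x and L the part left of x, one has
  R' = R - F and L' = F - L. The boundary terms cancel in the first derivative, which is therefore
  (R - L) / 2.\<close>

definition G_conv_deriv :: "(real \<Rightarrow> real) \<Rightarrow> real \<Rightarrow> real" where
  "G_conv_deriv F x = (exp x * left_exp_int (\<lambda>y. F (- y)) (- x) - exp (- x) * left_exp_int F x) / 2"

text \<open>Left of x the kernel factorises as exp (- x) exp y / 2, right of x as exp x exp (- y) /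
  2. The reflection y to - y turns the right half into a left half for the reflected source, so a
  single one-sided integral has to be differentiated.\<close>

lemma G_conv_split:
  fixes F :: "real \<Rightarrow> real"
  assumes cont: "continuous_on UNIV F" and bd: "\<And>y. \<bar>F y\<bar> \<le> K"
  shows "G_conv F x = (exp x * left_exp_int (\<lambda>y. F (- y)) (- x) + exp (- x) * left_exp_int F x) / 2"
proof -
  have [measurable]: "F \<in> borel_measurable borel" using cont by (rule borel_measurable_continuous_onI)
  let ?l = "\<lambda>y. indicat_real {..x} y *\<^sub>R (exp y * F y)"
  let ?r = "\<lambda>y. indicat_real {..-x} y *\<^sub>R (exp y * F (- y))"
  have l: "integrable lborel ?l" using set_integrable_left_exp[OF _ bd, where x = x] by (simp add: set_integrable_def)
  have r: "integrable lborel ?r" using set_integrable_left_exp[where F = "\<lambda>y. F (- y)" and K = K and x = "- x"] bd by (simp add: set_integrable_def)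
  have r': "integrable lborel (\<lambda>y. ?r (- y))" using lborel_integrable_real_affine[OF r, of "-1" 0] by simp
  have "G_conv F x = (LINT y|lborel. (exp x / 2) * ?r (- y) + (exp (- x) / 2) * ?l y)"
    unfolding G_conv_def
  proof (rule integral_cong_AE)
    show "AE y in lborel. CH_G (x - y) * F y = (exp x / 2) * ?r (- y) + (exp (- x) / 2) * ?l y"
      using AE_lborel_singleton[of x] by eventually_elim (auto simp: indicator_def CH_G_def abs_if exp_diff exp_minus field_simps)
  qed (unfold CH_G_def, measurable)
  also have "\<dots> = (exp x / 2) * (LINT y|lborel. ?r (- y)) + (exp (- x) / 2) * (LINT y|lborel. ?l y)"
    using l r' by (subst Bochner_Integration.integral_add) auto
  also have "(LINT y|lborel. ?r (- y)) = (LINT y|lborel. ?r y)"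
    using lborel_integral_real_affine[of "-1" ?r 0] by simp
  finally show ?thesis by (simp add: left_exp_int_def set_lebesgue_integral_def field_simps)
qed

lemma left_exp_int_nonneg: "(\<And>y. 0 \<le> F y) \<Longrightarrow> 0 \<le> left_exp_int F x"
  unfolding left_exp_int_def set_lebesgue_integral_def by (intro integral_nonneg_AE) auto

text \<open>For a nonnegative source both halves are nonnegative, and a difference of nonnegative
  numbers is bounded by their sum.\<close>

lemma G_conv_deriv_le:
  fixes F :: "real \<Rightarrow> real"
  assumes "continuous_on UNIV F" "\<And>y. \<bar>F y\<bar> \<le> K" "\<And>y. 0 \<le> F y"
  shows "\<bar>G_conv_deriv F x\<bar> \<le> G_conv F x"
proof -
  have "0 \<le> exp x * left_exp_int (\<lambda>y. F (- y)) (- x)" "0 \<le> exp (- x) * left_exp_int F x"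
    using assms(3) by (auto intro!: mult_nonneg_nonneg left_exp_int_nonneg)
  then show ?thesis unfolding G_conv_split[OF assms(1,2)] G_conv_deriv_def by (auto simp: abs_le_iff field_simps)
qed

text \<open>The second identity is (1 - d^2/dx^2) G = delta in pointwise form. It expresses the
  derivative of the nonlocal term without any derivative of F, so that no second derivative of u is
  needed.\<close>

lemma
  assumes cont: "continuous_on UNIV F" and bd: "\<And>y. \<bar>F y\<bar> \<le> K"
  shows G_conv_has_deriv: "(G_conv F has_real_derivative G_conv_deriv F x) (at x)"
    and G_conv_deriv_has_deriv: "(G_conv_deriv F has_real_derivative G_conv F x - F x) (at x)"
proof -
  have cont': "continuous_on UNIV (\<lambda>y. F (- y))"
    by (rule continuous_on_compose2[OF cont]) (auto intro!: continuous_intros)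
  have L: "(left_exp_int F has_real_derivative exp x * F x) (at x)" for x
    by (rule left_exp_int_deriv[OF cont bd])
  have R: "((\<lambda>x. left_exp_int (\<lambda>y. F (- y)) (- x)) has_real_derivative exp (- x) * F x * -1) (at x)" for x
  proof (rule DERIV_chain2[where g = uminus])
    show "(left_exp_int (\<lambda>y. F (- y)) has_real_derivative exp (- x) * F x) (at (- x))"
      using left_exp_int_deriv[OF cont', of K "- x"] bd by simp
  qed (auto intro!: derivative_eq_intros)
  have A: "((\<lambda>x. exp x * left_exp_int (\<lambda>y. F (- y)) (- x)) has_real_derivative exp x * left_exp_int (\<lambda>y. F (- y)) (- x) - F x) (at x)" for x
    by (rule derivative_eq_intros R refl)+ (simp add: exp_minus)
  have B: "((\<lambda>x. exp (- x) * left_exp_int F x) has_real_derivative F x - exp (- x) * left_exp_int F x) (at x)" for x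
    by (rule derivative_eq_intros L refl)+ (simp add: exp_minus)
  have eq: "G_conv F = (\<lambda>x. (exp x * left_exp_int (\<lambda>y. F (- y)) (- x) + exp (- x) * left_exp_int F x) / 2)"
    by (rule ext) (rule G_conv_split[OF cont bd])
  show "(G_conv F has_real_derivative G_conv_deriv F x) (at x)"
    unfolding eq using DERIV_cdivide[OF DERIV_add[OF A B], of 2 x] by (simp add: G_conv_deriv_def)
  show "(G_conv_deriv F has_real_derivative G_conv F x - F x) (at x)"
    unfolding eq G_conv_deriv_def[abs_def] using DERIV_cdivide[OF DERIV_diff[OF A B], of 2 x] by (simp add: field_simps)
qed

section \<open>Global solutions of Lipschitz differential equations\<close>

text \<open>Measured against the weight exp (2 L t), each Picard step halves the increment on the
  whole of \<open>{0..T}\<close>. So the iterates converge at once on the full interval, and no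
  continuation from short intervals is needed.\<close>

lemma picard_global:
  fixes w :: "real \<Rightarrow> real \<Rightarrow> real"
  assumes T: "0 \<le> T" and L: "0 < L"
    and cont: "continuous_on ({0..T} \<times> UNIV) (\<lambda>(t, x). w t x)"
    and lip: "\<And>t x y. t \<in> {0..T} \<Longrightarrow> \<bar>w t x - w t y\<bar> \<le> L * \<bar>x - y\<bar>"
  obtains Y where "Y 0 = x0" "\<And>t. t \<in> {0..T} \<Longrightarrow> (Y has_real_derivative w t (Y t)) (at t within {0..T})"
proof -
  define Y where "Y = rec_nat (\<lambda>t::real. x0) (\<lambda>_ y t. x0 + integral {0..t} (\<lambda>s. w s (y s)))"
  have Y0: "Y 0 = (\<lambda>t. x0)" and YS: "\<And>n t. Y (Suc n) t = x0 + integral {0..t} (\<lambda>s. w s (Y n s))"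
    by (auto simp: Y_def)
  have wcont: "continuous_on {0..T} (\<lambda>s. w s (y s))" if "continuous_on {0..T} y" for y
  proof -
    have "continuous_on {0..T} (\<lambda>s. case (s, y s) of (t, x) \<Rightarrow> w t x)"
      using that by (intro continuous_on_compose2[OF cont]) (auto intro!: continuous_intros)
    then show ?thesis by simp
  qed
  have Ycont: "continuous_on {0..T} (Y n)" for n
  proof (induction n)
    case (Suc n)
    have "(\<lambda>s. w s (Y n s)) integrable_on {0..T}"
      by (rule integrable_continuous_real[OF wcont[OF Suc]])
    from indefinite_integral_continuous_1[OF this] show ?case
      by (simp add: YS[abs_def] continuous_on_add)
  qed (simp add: Y0)
  have wint: "(\<lambda>s. w s (Y n s)) integrable_on {0..t}" if "t \<in> {0..T}" for n t
    using that by (intro integrable_continuous_real continuous_on_subset[OF wcont[OF Ycont]]) auto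
  have "compact ((\<lambda>s. w s x0) ` {0..T})"
    by (intro compact_continuous_image wcont) auto
  then have "\<exists>K. \<forall>s\<in>{0..T}. \<bar>w s x0\<bar> \<le> K"
    by (auto simp: bounded_iff dest!: compact_imp_bounded)
  then obtain K where K: "\<And>s. s \<in> {0..T} \<Longrightarrow> \<bar>w s x0\<bar> \<le> K" by blast
  have K0: "0 \<le> K" using K[of 0] T by auto
  \<comment> \<open>The first increment is at most K T; the 1 keeps D positive.\<close>
  define D where "D = K * T + 1"
  have D: "0 < D" using K0 T by (auto simp: D_def intro: add_nonneg_pos)
  have expint: "integral {0..t} (\<lambda>s. L * (c * exp (2 * L * s))) \<le> (c / 2) * exp (2 * L * t)" if "0 \<le> t" "0 \<le> c" for t c
  proof -
    have *: "((\<lambda>s. L * (c * exp (2 * L * s))) has_integral ((c / 2) * exp (2 * L * t) - (c / 2) * exp (2 * L * 0))) {0..t}"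
      using that L by (intro fundamental_theorem_of_calculus)
        (auto intro!: derivative_eq_intros simp flip: has_real_derivative_iff_has_vector_derivative)
    show ?thesis unfolding integral_unique[OF *] using that by simp
  qed
  have step: "\<bar>Y (Suc n) t - Y n t\<bar> \<le> D * (1/2) ^ n * exp (2 * L * t)" if "t \<in> {0..T}" for n t
    using that
  proof (induction n arbitrary: t)
    case 0
    have "norm (integral {0..t} (\<lambda>s. w s x0)) \<le> K * (t - 0)"
      using 0 K wint[of t 0] by (intro integral_bound) (auto simp: Y0 intro: continuous_on_subset[OF wcont])
    also have "\<dots> \<le> K * T" using 0 K0 by (auto intro: mult_left_mono)
    also have "\<dots> \<le> D * exp (2 * L * t)"
    proof -
      have "D * 1 \<le> D * exp (2 * L * t)" using D 0 L by (intro mult_left_mono) auto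
      then show ?thesis by (simp add: D_def)
    qed
    finally show ?case by (simp add: YS Y0)
  next
    case (Suc n)
    have sub: "s \<in> {0..T}" if "s \<in> {0..t}" for s using that Suc.prems by auto
    have "Y (Suc (Suc n)) t - Y (Suc n) t = integral {0..t} (\<lambda>s. w s (Y (Suc n) s) - w s (Y n s))"
      unfolding YS[of "Suc n"] YS[of n t] using wint Suc.prems by (subst integral_diff) auto
    also have "norm \<dots> \<le> integral {0..t} (\<lambda>s. L * (D * (1/2) ^ n * exp (2 * L * s)))"
    proof (rule integral_norm_bound_integral)
      show "(\<lambda>s. w s (Y (Suc n) s) - w s (Y n s)) integrable_on {0..t}"
        using wint Suc.prems by (intro integrable_diff) auto
      show "(\<lambda>s. L * (D * (1/2) ^ n * exp (2 * L * s))) integrable_on {0..t}"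
        by (intro integrable_continuous_real continuous_intros)
      fix s assume s: "s \<in> {0..t}"
      have "\<bar>w s (Y (Suc n) s) - w s (Y n s)\<bar> \<le> L * \<bar>Y (Suc n) s - Y n s\<bar>" using lip[OF sub[OF s]] .
      also have "\<dots> \<le> L * (D * (1/2) ^ n * exp (2 * L * s))"
        using Suc.IH[OF sub[OF s]] L by (intro mult_left_mono) auto
      finally show "norm (w s (Y (Suc n) s) - w s (Y n s)) \<le> L * (D * (1/2) ^ n * exp (2 * L * s))" by simp
    qed
    also have "\<dots> \<le> (D * (1/2) ^ n / 2) * exp (2 * L * t)" using expint[of t "D * (1/2) ^ n"] Suc.prems D by simp
    finally show ?case by simp
  qed
  define E where "E = D * exp (2 * L * T)"
  have stepE: "norm (Y (Suc n) t - Y n t) \<le> E * (1/2) ^ n" if "t \<in> {0..T}" for n t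
  proof -
    have "D * (1/2) ^ n * exp (2 * L * t) \<le> D * (1/2) ^ n * exp (2 * L * T)"
      using that D L by (intro mult_left_mono) auto
    then show ?thesis using step[OF that, of n] by (simp add: E_def algebra_simps)
  qed
  have telescope: "(\<Sum>i<n. Y (Suc i) t - Y i t) = Y n t - x0" for n t
    using sum_lessThan_telescope[of "\<lambda>i. Y i t" n] by (simp add: Y0)
  have "uniform_limit {0..T} (\<lambda>n t. \<Sum>i<n. Y (Suc i) t - Y i t) (\<lambda>t. suminf (\<lambda>i. Y (Suc i) t - Y i t)) sequentially"
    by (rule Weierstrass_m_test[OF stepE]) (auto intro!: summable_mult summable_geometric)
  then have ul0: "uniform_limit {0..T} (\<lambda>n t. Y n t - x0) (\<lambda>t. suminf (\<lambda>i. Y (Suc i) t - Y i t)) sequentially"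
    by (simp add: telescope)
  define Z where "Z t = suminf (\<lambda>i. Y (Suc i) t - Y i t) + x0" for t
  have ul: "uniform_limit {0..T} Y Z sequentially"
    using uniform_limit_add[OF ul0 uniform_limit_const[where c = "\<lambda>_. x0"]] by (simp add: Z_def[abs_def])
  have Zcont: "continuous_on {0..T} Z"
    by (rule uniform_limit_theorem[OF _ ul]) (auto simp: Ycont)
  have ulw: "uniform_limit {0..T} (\<lambda>n s. w s (Y n s)) (\<lambda>s. w s (Z s)) sequentially"
  proof (rule uniform_limitI)
    fix e :: real assume e: "0 < e"
    from uniform_limitD[OF ul, of "e / L"] e L
    have "\<forall>\<^sub>F n in sequentially. \<forall>s\<in>{0..T}. dist (Y n s) (Z s) < e / L" by simp
    then show "\<forall>\<^sub>F n in sequentially. \<forall>s\<in>{0..T}. dist (w s (Y n s)) (w s (Z s)) < e"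
    proof eventually_elim
      case (elim n)
      show ?case
      proof
        fix s assume s: "s \<in> {0..T}"
        have "L * \<bar>Y n s - Z s\<bar> < e" using elim s L by (simp add: dist_real_def field_simps)
        then show "dist (w s (Y n s)) (w s (Z s)) < e"
          using lip[OF s, of "Y n s" "Z s"] by (simp add: dist_real_def)
      qed
    qed
  qed
  have eq: "Z t = x0 + integral {0..t} (\<lambda>s. w s (Z s))" if t: "t \<in> {0..T}" for t
  proof (rule LIMSEQ_unique)
    show "(\<lambda>n. Y (Suc n) t) \<longlonglongrightarrow> Z t"
      using tendsto_uniform_limitI[OF ul t] by (rule LIMSEQ_Suc)
    have "uniform_limit {0..t} (\<lambda>n s. w s (Y n s)) (\<lambda>s. w s (Z s)) sequentially"
      by (rule uniform_limit_on_subset[OF ulw]) (use t in auto)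
    then obtain I J where I: "\<And>n. ((\<lambda>s. w s (Y n s)) has_integral I n) {0..t}"
        "((\<lambda>s. w s (Z s)) has_integral J) {0..t}" "I \<longlonglongrightarrow> J"
      by (rule uniform_limit_integral)
        (use t in \<open>auto intro!: continuous_on_subset[OF wcont[OF Ycont]]\<close>)
    have "integral {0..t} (\<lambda>s. w s (Y n s)) = I n" for n by (rule integral_unique[OF I(1)])
    moreover have "integral {0..t} (\<lambda>s. w s (Z s)) = J" by (rule integral_unique[OF I(2)])
    ultimately have "(\<lambda>n. integral {0..t} (\<lambda>s. w s (Y n s))) \<longlonglongrightarrow> integral {0..t} (\<lambda>s. w s (Z s))"
      using I(3) by simp
    then show "(\<lambda>n. Y (Suc n) t) \<longlonglongrightarrow> x0 + integral {0..t} (\<lambda>s. w s (Z s))"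
      by (simp add: YS tendsto_add)
  qed
  show thesis
  proof
    show "Z 0 = x0" using eq[of 0] T by simp
    fix t assume t: "t \<in> {0..T}"
    have "((\<lambda>t. x0 + integral {0..t} (\<lambda>s. w s (Z s))) has_real_derivative w t (Z t)) (at t within {0..T})"
      using integral_has_real_derivative[OF wcont[OF Zcont] t] by (auto intro!: derivative_eq_intros)
    then show "(Z has_real_derivative w t (Z t)) (at t within {0..T})"
      by (rule has_field_derivative_transform_within[where d = 1]) (use t eq in auto)
  qed
qed

section \<open>Expanding changes of variables and Minkowski's integral inequality\<close>

lemma emeasure_le_diam:
  fixes S :: "real set"
  assumes diam: "\<And>x y. x \<in> S \<Longrightarrow> y \<in> S \<Longrightarrow> \<bar>x - y\<bar> \<le> d"
  shows "emeasure lborel S \<le> ennreal d"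
proof (cases "S = {}")
  case False
  then obtain z where z: "z \<in> S" by auto
  have bdd: "bdd_below S" "bdd_above S"
    using diam[OF z] by (force simp: abs_le_iff intro: bdd_belowI[of _ "z - d"] bdd_aboveI[of _ "z + d"])+
  have d: "Sup S - Inf S \<le> d"
  proof -
    have "Sup S \<le> d + Inf S"
    proof (rule cSup_least[OF False])
      fix x assume x: "x \<in> S"
      have "x - d \<le> Inf S" using diam[OF x] by (intro cInf_greatest[OF False]) (force simp: abs_le_iff)
      then show "x \<le> d + Inf S" by simp
    qed
    then show ?thesis by simp
  qed
  have "S \<subseteq> {Inf S .. Sup S}" using bdd by (auto intro: cInf_lower cSup_upper)
  then have "emeasure lborel S \<le> emeasure lborel {Inf S .. Sup S}" by (intro emeasure_mono) auto
  also have "\<dots> \<le> ennreal d"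
    using d z bdd by (subst emeasure_lborel_Icc) (auto intro: ennreal_leI cInf_lower cSup_upper order_trans[of "Inf S" z])
  finally show ?thesis .
qed auto

text \<open>A substitute for the change of variables formula. The components of U are countably many
  disjoint intervals, and the preimage of an interval of length l has diameter at most c l, hence
  measure at most c l.\<close>

lemma emeasure_expanding_vimage_open:
  fixes X :: "real \<Rightarrow> real"
  assumes X: "X \<in> borel_measurable borel" and c: "0 < c"
    and expanding: "\<And>x y. \<bar>x - y\<bar> \<le> c * \<bar>X x - X y\<bar>" and U: "open U"
  shows "emeasure lborel (X -` U) \<le> ennreal c * emeasure lborel U"
proof -
  have disjnt_components: "disjoint (components U)"
    using pairwise_disjoint_components[of U] by (simp add: pairwise_def disjnt_def)
  have cnt: "countable (components U)"
    using open_components[OF U] disjnt_components by (intro countable_disjoint_open_subsets) auto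
  have opn: "open C" if "C \<in> components U" for C using that U by (rule open_components[rotated])
  have dj: "disjoint_family_on (\<lambda>C. C) (components U)"
    using pairwise_disjoint_components[of U] by (auto simp: disjoint_family_on_def pairwise_def disjnt_def)
  have comp: "emeasure lborel (X -` C) \<le> ennreal c * emeasure lborel C" if C: "C \<in> components U" for C
  proof (cases "emeasure lborel C = \<infinity>")
    case True
    then show ?thesis using c by (simp add: ennreal_mult_eq_top_iff)
  next
    case False
    have mC: "emeasure lborel C = ennreal (measure lborel C)"
      using False by (simp add: emeasure_eq_ennreal_measure)
    have conv: "is_interval C" using in_components_connected[OF C] by (simp add: is_interval_connected_1)
    have len: "\<bar>s - t\<bar> \<le> measure lborel C" if "s \<in> C" "t \<in> C" for s t
    proof -
      have "{min s t .. max s t} \<subseteq> C"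
        using interval_subset_is_interval[OF conv, of "min s t" "max s t"] that by (auto simp: min_def max_def)
      then have "emeasure lborel {min s t .. max s t} \<le> emeasure lborel C"
        using opn[OF C] by (intro emeasure_mono) auto
      then show ?thesis by (simp add: mC min_def max_def split: if_splits)
    qed
    have "emeasure lborel (X -` C) \<le> ennreal (c * measure lborel C)"
    proof (rule emeasure_le_diam)
      fix x y assume "x \<in> X -` C" "y \<in> X -` C"
      then have "\<bar>X x - X y\<bar> \<le> measure lborel C" using len by auto
      then show "\<bar>x - y\<bar> \<le> c * measure lborel C"
        by (intro order_trans[OF expanding[of x y]] mult_left_mono) (use c in auto)
    qed
    then show ?thesis using c by (simp add: mC ennreal_mult)
  qed
  have "emeasure lborel (X -` U) = emeasure lborel (\<Union>C\<in>components U. X -` C)"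
    using Union_components[of U] by (intro arg_cong[where f = "emeasure lborel"]) blast
  also have "\<dots> = (\<integral>\<^sup>+C. emeasure lborel (X -` C) \<partial>count_space (components U))"
  proof (rule emeasure_UN_countable[OF _ cnt])
    show "X -` C \<in> sets lborel" if "C \<in> components U" for C
      using measurable_sets[OF X, of C] opn[OF that] by simp
    show "disjoint_family_on (\<lambda>C. X -` C) (components U)"
      using dj by (auto simp: disjoint_family_on_def)
  qed
  also have "\<dots> \<le> (\<integral>\<^sup>+C. ennreal c * emeasure lborel C \<partial>count_space (components U))"
    by (rule nn_integral_mono) (simp add: comp)
  also have "\<dots> = ennreal c * emeasure lborel (\<Union>C\<in>components U. C)"
    using opn by (subst emeasure_UN_countable[OF _ cnt dj]) (auto simp: nn_integral_cmult)
  also have "\<dots> = ennreal c * emeasure lborel U" by (simp add: Union_components)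
  finally show ?thesis .
qed

text \<open>Outer regularity reduces a Borel set to an open one; the excess e / c becomes e after
  multiplication by c.\<close>

lemma emeasure_expanding_vimage:
  fixes X :: "real \<Rightarrow> real"
  assumes X: "X \<in> borel_measurable borel" and c: "0 < c"
    and expanding: "\<And>x y. \<bar>x - y\<bar> \<le> c * \<bar>X x - X y\<bar>" and B: "B \<in> sets borel"
  shows "emeasure lborel (X -` B) \<le> ennreal c * emeasure lborel B"
proof (rule ennreal_le_epsilon)
  fix e :: real assume e: "0 < e"
  obtain U where U: "open U" "B \<subseteq> U" "emeasure lborel (U - B) < ennreal (e / c)"
    using outer_regular_lborel[OF B, of "e / c"] e c by auto
  have "emeasure lborel (X -` B) \<le> emeasure lborel (X -` U)"
    using U measurable_sets[OF X, of U] by (intro emeasure_mono) auto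
  also have "\<dots> \<le> ennreal c * emeasure lborel U"
    using emeasure_expanding_vimage_open[OF X c expanding U(1)] .
  also have "emeasure lborel U \<le> emeasure lborel B + emeasure lborel (U - B)"
    using U B emeasure_subadditive[of B lborel "U - B"] by (metis Diff_partition borel_open sets.Diff sets_lborel)
  also have "\<dots> \<le> emeasure lborel B + ennreal (e / c)" using U(3) by (intro add_left_mono) auto
  finally show "emeasure lborel (X -` B) \<le> ennreal c * emeasure lborel B + ennreal e"
    using c e by (simp add: distrib_left mult_left_mono flip: ennreal_mult)
qed

text \<open>The estimate on sets says that the image of Lebesgue measure under X is at most c times
  Lebesgue measure; integrals then compare by monotonicity in the measure.\<close>

lemma nn_integral_expanding_comp_le:
  fixes X :: "real \<Rightarrow> real"
  assumes X: "X \<in> borel_measurable borel" and c: "0 < c"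
    and expanding: "\<And>x y. \<bar>x - y\<bar> \<le> c * \<bar>X x - X y\<bar>" and f: "f \<in> borel_measurable borel"
  shows "(\<integral>\<^sup>+x. f (X x) \<partial>lborel) \<le> ennreal c * (\<integral>\<^sup>+x. f x \<partial>lborel)"
proof -
  have "distr lborel borel X \<le> scale_measure (ennreal c) lborel"
    using emeasure_expanding_vimage[OF X c expanding] X
    by (subst le_measure) (auto simp: emeasure_distr)
  then have "(\<integral>\<^sup>+x. f x \<partial>distr lborel borel X) \<le> (\<integral>\<^sup>+x. f x \<partial>scale_measure (ennreal c) lborel)"
    by (intro nn_integral_mono_measure) auto
  then show ?thesis using X f by (simp add: nn_integral_distr nn_integral_scale_measure)
qed

text \<open>A bound for the norm, stated before the root is taken, so that infinite norms need no
  separate treatment. For infinite p the bound is required everywhere and not almost everywhere: for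
  continuous functions this is the same, and it suits estimates that hold at each point along its
  own characteristic.\<close>

definition Lp_bounded :: "ennreal \<Rightarrow> (real \<Rightarrow> real) \<Rightarrow> real \<Rightarrow> bool" where
  "Lp_bounded p f c \<longleftrightarrow> (if p = \<infinity> then \<forall>x. \<bar>f x\<bar> \<le> c
     else (\<integral>\<^sup>+x. ennreal (\<bar>f x\<bar> powr enn2real p) \<partial>lborel) \<le> ennreal (c powr enn2real p))"

lemma Lp_bounded_mono:
  assumes "Lp_bounded p g c" "\<And>x. \<bar>f x\<bar> \<le> \<bar>g x\<bar>" "c \<le> d" "0 \<le> c"
  shows "Lp_bounded p f d"
proof (cases "p = \<infinity>")
  case True
  then show ?thesis using assms unfolding Lp_bounded_def by (simp, intro allI order_trans[OF assms(2)] order_trans[OF _ assms(3)]) simp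
next
  case False
  have "(\<integral>\<^sup>+x. ennreal (\<bar>f x\<bar> powr enn2real p) \<partial>lborel) \<le> (\<integral>\<^sup>+x. ennreal (\<bar>g x\<bar> powr enn2real p) \<partial>lborel)"
    using assms(2) by (intro nn_integral_mono ennreal_leI powr_mono2) auto
  also have "\<dots> \<le> ennreal (c powr enn2real p)" using assms(1) False by (simp add: Lp_bounded_def)
  also have "\<dots> \<le> ennreal (d powr enn2real p)" using assms by (intro ennreal_leI powr_mono2) auto
  finally show ?thesis using False by (simp add: Lp_bounded_def)
qed

lemma Lp_bounded_tendsto:
  assumes "\<And>n::nat. Lp_bounded p f (c n)" "c \<longlonglongrightarrow> l" "0 < l"
  shows "Lp_bounded p f l"
proof (cases "p = \<infinity>")
  case True
  then show ?thesis using assms(1) LIMSEQ_le_const[OF assms(2)] by (simp add: Lp_bounded_def)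
next
  case False
  have "(\<lambda>n. ennreal (c n powr enn2real p)) \<longlonglongrightarrow> ennreal (l powr enn2real p)"
    using assms(2,3) by (intro tendsto_ennrealI tendsto_intros) auto
  from LIMSEQ_le_const[OF this] show ?thesis using assms(1) False by (simp add: Lp_bounded_def)
qed

lemma Lp_bounded_cmult:
  assumes "Lp_bounded p f c" "0 \<le> k" and [measurable]: "f \<in> borel_measurable borel"
  shows "Lp_bounded p (\<lambda>x. k * f x) (k * c)"
proof (cases "p = \<infinity>")
  case True
  then show ?thesis using assms by (auto simp: Lp_bounded_def abs_mult mult_left_mono)
next
  case False
  have "(\<integral>\<^sup>+x. ennreal (\<bar>k * f x\<bar> powr enn2real p) \<partial>lborel)
      = ennreal (k powr enn2real p) * (\<integral>\<^sup>+x. ennreal (\<bar>f x\<bar> powr enn2real p) \<partial>lborel)"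
    using assms by (subst nn_integral_cmult[symmetric]) (auto simp: abs_mult powr_mult ennreal_mult')
  also have "\<dots> \<le> ennreal (k powr enn2real p) * ennreal (c powr enn2real p)"
    using assms(1) False by (intro mult_left_mono) (auto simp: Lp_bounded_def)
  finally show ?thesis using assms False by (simp add: Lp_bounded_def powr_mult ennreal_mult')
qed

text \<open>The true cost is K to the power 1/p. It is weakened to K, which is at least 1, so that
  the final constant is the same for all p.\<close>

lemma Lp_bounded_expanding_comp:
  fixes X :: "real \<Rightarrow> real"
  assumes "Lp_bounded p f c" "0 \<le> c" "1 \<le> p" and X: "X \<in> borel_measurable borel" and K: "1 \<le> K"
    and expanding: "\<And>x y. \<bar>x - y\<bar> \<le> K * \<bar>X x - X y\<bar>" and f: "f \<in> borel_measurable borel"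
  shows "Lp_bounded p (\<lambda>x. f (X x)) (K * c)"
proof (cases "p = \<infinity>")
  case True
  have "c \<le> K * c" using assms mult_right_mono[of 1 K c] by simp
  then show ?thesis using assms True by (auto simp: Lp_bounded_def intro: order_trans)
next
  case False
  have r: "1 \<le> enn2real p" using enn2real_mono[OF \<open>1 \<le> p\<close>] False by (simp add: less_top)
  have "(\<integral>\<^sup>+x. ennreal (\<bar>f (X x)\<bar> powr enn2real p) \<partial>lborel)
      \<le> ennreal K * (\<integral>\<^sup>+x. ennreal (\<bar>f x\<bar> powr enn2real p) \<partial>lborel)"
    using K f by (intro nn_integral_expanding_comp_le[OF X _ expanding]) auto
  also have "\<dots> \<le> ennreal K * ennreal (c powr enn2real p)"
    using assms(1) False by (intro mult_left_mono) (auto simp: Lp_bounded_def)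
  also have "\<dots> \<le> ennreal ((K * c) powr enn2real p)"
  proof -
    have "K powr 1 \<le> K powr enn2real p" using K r by (intro powr_mono) auto
    then have "K * c powr enn2real p \<le> (K * c) powr enn2real p"
      using K \<open>0 \<le> c\<close> by (simp add: powr_mult mult_right_mono)
    then show ?thesis using K by (simp flip: ennreal_mult)
  qed
  finally show ?thesis using False by (simp add: Lp_bounded_def)
qed

text \<open>The graph of t powr r lies above its tangent at m; this is evaluated at t = f / B and
  multiplied by B. Terms are moved so that nothing is subtracted, which lets the inequality pass to
  \<open>ennreal\<close>. Young's inequality for the exponents r and r / (r - 1) gives the tangent
  bound.\<close>

lemma powr_tangent_le:
  fixes f B m r :: real
  assumes "0 \<le> f" "0 < B" "0 \<le> m" "1 < r"
  shows "B * m powr r + r * m powr (r - 1) * f \<le> f powr r * B powr (1 - r) + r * B * m powr r"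
proof -
  define q where "q = r / (r - 1)"
  have q: "1 < q" "1 / r + 1 / q = 1" using assms by (auto simp: q_def field_simps)
  have "(f / B) * m powr (r - 1) \<le> (f / B) powr r / r + (m powr (r - 1)) powr q / q"
    using Youngs_inequality[of r q "f / B" "m powr (r - 1)"] assms q by auto
  also have "(m powr (r - 1)) powr q = m powr r" using assms by (simp add: powr_powr q_def)
  finally have "B * r * ((f / B) * m powr (r - 1)) \<le> B * r * ((f / B) powr r / r + m powr r / q)"
    using assms by (intro mult_left_mono) auto
  moreover have "B * (f / B) powr r = f powr r * B powr (1 - r)"
    using assms by (simp add: powr_divide powr_diff)
  moreover have "B * r * ((f / B) powr r / r + m powr r / q) = B * (f / B) powr r + B * (r - 1) * m powr r"
    using assms by (simp add: q_def field_simps)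
  ultimately show ?thesis using assms by (simp add: algebra_simps)
qed

text \<open>With respect to the probability measure
  \<open>B s / (\<integral>B)\<close> the left-hand side is the mean of \<open>f s / B s\<close>, so Jensen's inequality applies.\<close>

lemma Lp_bounded_integral:
  fixes f :: "'s \<Rightarrow> real \<Rightarrow> real"
  assumes M: "sigma_finite_measure M" and p: "2 \<le> p"
    and meas[measurable]: "case_prod f \<in> borel_measurable (M \<Otimes>\<^sub>M lborel)"
    and nonneg: "\<And>s x. s \<in> space M \<Longrightarrow> 0 \<le> f s x"
    and int: "\<And>x. integrable M (\<lambda>s. f s x)"
    and Bpos: "\<And>s. s \<in> space M \<Longrightarrow> 0 < B s" and Bint: "integrable M B"
    and bd: "\<And>s. s \<in> space M \<Longrightarrow> Lp_bounded p (f s) (B s)"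
    and pos: "0 < (LINT s|M. B s)"
  shows "Lp_bounded p (\<lambda>x. LINT s|M. f s x) (LINT s|M. B s)"
proof (cases "p = \<infinity>")
  case True
  have "\<bar>LINT s|M. f s x\<bar> \<le> (LINT s|M. B s)" for x
    using nonneg bd True
    by (subst abs_of_nonneg) (auto intro!: integral_mono[OF int Bint] integral_nonneg_AE simp: Lp_bounded_def abs_le_iff)
  then show ?thesis using True by (simp add: Lp_bounded_def)
next
  case False
  define r where "r = enn2real p"
  have r: "1 < r" using enn2real_mono[OF p] False by (simp add: less_top r_def)
  interpret M: sigma_finite_measure M by fact
  interpret pair_sigma_finite M lborel ..
  define L where "L = (LINT s|M. B s)"
  have L: "0 < L" using pos by (simp add: L_def)
  have [measurable]: "B \<in> borel_measurable M" using Bint by auto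
  have pt: "ennreal (\<bar>LINT s|M. f s x\<bar> powr r) \<le> ennreal (L powr (r - 1)) * (\<integral>\<^sup>+s. ennreal (f s x powr r * B s powr (1 - r)) \<partial>M)"
    for x
  proof -
    define I where "I = (LINT s|M. f s x)"
    \<comment> \<open>The mean of f s / B s for the probability measure above. With the tangent
      taken at the mean, \<open>mI\<close> turns the integral of the term linear in f into r L (m
      powr r), which then cancels.\<close>
    define m where "m = I / L"
    have I: "0 \<le> I" unfolding I_def using nonneg by (intro integral_nonneg_AE) auto
    have m: "0 \<le> m" using I L by (simp add: m_def)
    have mI: "m powr (r - 1) * I = L * m powr r"
      using I L m by (cases "I = 0") (auto simp: powr_diff m_def)
    have "ennreal (L * m powr r + r * m powr (r - 1) * I)
        = (\<integral>\<^sup>+s. ennreal (B s * m powr r + r * m powr (r - 1) * f s x) \<partial>M)"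
      using Bint int[of x] Bpos nonneg r
      by (subst nn_integral_eq_integral) (auto simp: L_def I_def less_imp_le)
    also have "\<dots> \<le> (\<integral>\<^sup>+s. ennreal (f s x powr r * B s powr (1 - r)) + ennreal (r * B s * m powr r) \<partial>M)"
    proof (rule nn_integral_mono)
      fix s assume s: "s \<in> space M"
      show "ennreal (B s * m powr r + r * m powr (r - 1) * f s x)
          \<le> ennreal (f s x powr r * B s powr (1 - r)) + ennreal (r * B s * m powr r)"
        using powr_tangent_le[OF nonneg[OF s] Bpos[OF s] m r] Bpos[OF s] r
        by (simp add: ennreal_leI flip: ennreal_plus)
    qed
    also have "\<dots> = (\<integral>\<^sup>+s. ennreal (f s x powr r * B s powr (1 - r)) \<partial>M) + (\<integral>\<^sup>+s. ennreal (r * B s * m powr r) \<partial>M)"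
      by (subst nn_integral_add) auto
    also have "(\<integral>\<^sup>+s. ennreal (r * B s * m powr r) \<partial>M) = ennreal (r * L * m powr r)"
      using Bint Bpos r by (subst nn_integral_eq_integral) (auto simp: L_def less_imp_le)
    finally have "ennreal (L * m powr r) + ennreal (r * L * m powr r)
        \<le> (\<integral>\<^sup>+s. ennreal (f s x powr r * B s powr (1 - r)) \<partial>M) + ennreal (r * L * m powr r)"
      using mI L r by (simp add: mult.assoc flip: ennreal_plus)
    then have "ennreal (L * m powr r) \<le> (\<integral>\<^sup>+s. ennreal (f s x powr r * B s powr (1 - r)) \<partial>M)"
      by (simp add: ennreal_add_left_cancel_le add.commute)
    then have "ennreal (L powr (r - 1)) * ennreal (L * m powr r)
        \<le> ennreal (L powr (r - 1)) * (\<integral>\<^sup>+s. ennreal (f s x powr r * B s powr (1 - r)) \<partial>M)"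
      by (rule mult_left_mono) auto
    moreover have "L powr (r - 1) * (L * m powr r) = I powr r"
      using L I by (simp add: m_def powr_divide powr_diff)
    ultimately show ?thesis using I L by (simp add: I_def flip: ennreal_mult)
  qed
  have "(\<integral>\<^sup>+x. ennreal (\<bar>LINT s|M. f s x\<bar> powr r) \<partial>lborel)
      \<le> (\<integral>\<^sup>+x. ennreal (L powr (r - 1)) * (\<integral>\<^sup>+s. ennreal (f s x powr r * B s powr (1 - r)) \<partial>M) \<partial>lborel)"
    by (intro nn_integral_mono pt)
  also have "\<dots> = ennreal (L powr (r - 1)) * (\<integral>\<^sup>+x. \<integral>\<^sup>+s. ennreal (f s x powr r * B s powr (1 - r)) \<partial>M \<partial>lborel)"
    by (intro nn_integral_cmult) measurable
  also have "(\<integral>\<^sup>+x. \<integral>\<^sup>+s. ennreal (f s x powr r * B s powr (1 - r)) \<partial>M \<partial>lborel)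
      = (\<integral>\<^sup>+s. \<integral>\<^sup>+x. ennreal (f s x powr r * B s powr (1 - r)) \<partial>lborel \<partial>M)"
    by (intro Fubini') measurable
  also have "\<dots> \<le> (\<integral>\<^sup>+s. ennreal (B s) \<partial>M)"
  proof (rule nn_integral_mono)
    fix s assume s: "s \<in> space M"
    have [measurable]: "f s \<in> borel_measurable borel" using measurable_Pair2[OF meas s] by simp
    have "(\<integral>\<^sup>+x. ennreal (f s x powr r * B s powr (1 - r)) \<partial>lborel)
        = (\<integral>\<^sup>+x. ennreal (B s powr (1 - r)) * ennreal (\<bar>f s x\<bar> powr r) \<partial>lborel)"
      using nonneg[OF s] by (intro nn_integral_cong) (simp add: mult.commute flip: ennreal_mult)
    also have "\<dots> = ennreal (B s powr (1 - r)) * (\<integral>\<^sup>+x. ennreal (\<bar>f s x\<bar> powr r) \<partial>lborel)"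
      by (intro nn_integral_cmult) measurable
    also have "\<dots> \<le> ennreal (B s powr (1 - r)) * ennreal (B s powr r)"
      using bd[OF s] False by (intro mult_left_mono) (auto simp: Lp_bounded_def r_def)
    also have "\<dots> = ennreal (B s)" using Bpos[OF s] by (simp flip: ennreal_mult powr_add)
    finally show "(\<integral>\<^sup>+x. ennreal (f s x powr r * B s powr (1 - r)) \<partial>lborel) \<le> ennreal (B s)" .
  qed
  also have "\<dots> = ennreal L"
    using Bint Bpos by (subst nn_integral_eq_integral) (auto simp: L_def less_imp_le)
  also have "ennreal (L powr (r - 1)) * ennreal L = ennreal (L powr r)"
    using L by (simp add: powr_diff flip: ennreal_mult)
  finally show ?thesis using False by (simp add: Lp_bounded_def r_def L_def mult_left_mono)
qed

text \<open>The ordinary Minkowski inequality is the integral version over a two-point space with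
  counting measure.\<close>

lemma Lp_bounded_add:
  assumes "Lp_bounded p f c" "Lp_bounded p g d" "2 \<le> p" "0 < c" "0 < d"
    and [measurable]: "f \<in> borel_measurable borel" "g \<in> borel_measurable borel"
    and nonneg: "\<And>x. 0 \<le> f x" "\<And>x. 0 \<le> g x"
  shows "Lp_bounded p (\<lambda>x. f x + g x) (c + d)"
proof -
  let ?M = "count_space (UNIV :: bool set)"
  let ?f = "\<lambda>b x. if b then f x else g x" and ?B = "\<lambda>b. if b then c else d"
  have "Lp_bounded p (\<lambda>x. LINT b|?M. ?f b x) (LINT b|?M. ?B b)"
  proof (rule Lp_bounded_integral)
    show "sigma_finite_measure ?M" by (rule sigma_finite_measure_count_space)
    have "(\<lambda>x. ?f b x) \<in> borel_measurable lborel" for b by (cases b) auto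
    then show "case_prod ?f \<in> borel_measurable (?M \<Otimes>\<^sub>M lborel)"
      by (intro measurable_pair_measure_countable1) auto
  qed (use assms in \<open>auto simp: lebesgue_integral_count_space_finite UNIV_bool integrable_count_space\<close>)
  then show ?thesis by (simp add: lebesgue_integral_count_space_finite UNIV_bool add.commute)
qed

section \<open>Characteristics\<close>

lemma mean_value_two_sided:
  fixes f :: "real \<Rightarrow> real"
  assumes "\<And>z. (f has_real_derivative f' z) (at z)"
  obtains \<xi> where "\<bar>\<xi> - a\<bar> \<le> \<bar>b - a\<bar>" "f b - f a = (b - a) * f' \<xi>"
proof -
  consider "a < b" | "b < a" | "a = b" by linarith
  then show thesis
  proof cases
    case 1
    from MVT2[OF 1 assms] obtain z where "a < z" "z < b" "f b - f a = (b - a) * f' z" by auto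
    then show thesis by (intro that[of z]) auto
  next
    case 2
    from MVT2[OF 2 assms] obtain z where "b < z" "z < a" "f a - f b = (a - b) * f' z" by auto
    then show thesis by (intro that[of z]) (auto simp: algebra_simps)
  qed (auto intro: that[of a])
qed

lemma nondecreasing_of_deriv_within:
  fixes f :: "real \<Rightarrow> real"
  assumes der: "\<And>r. r \<in> {a..b} \<Longrightarrow> (f has_real_derivative f' r) (at r within {a..b})"
    and nonneg: "\<And>r. r \<in> {a..b} \<Longrightarrow> 0 \<le> f' r" and st: "a \<le> s" "s \<le> t" "t \<le> b"
  shows "f s \<le> f t"
proof (cases "s = t")
  case False
  show ?thesis
  proof (rule DERIV_nonneg_imp_increasing_open[where f = f and a = s and b = t])
    show "\<exists>y. (f has_real_derivative y) (at x) \<and> 0 \<le> y" if "s < x" "x < t" for x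
    proof -
      have "at x within {a..b} = at x" using that st by (intro at_within_Icc_at) auto
      then show ?thesis using der[of x] nonneg[of x] that st by fastforce
    qed
    have "continuous_on {a..b} f"
      using der by (rule DERIV_continuous_on)
    then show "continuous_on {s..t} f" by (rule continuous_on_subset) (use st in auto)
  qed (use st in auto)
qed simp

lemma increment_le_integral:
  fixes f :: "real \<Rightarrow> real"
  assumes der: "\<And>r. r \<in> {a..b} \<Longrightarrow> (f has_real_derivative f' r) (at r within {a..b})" and ab: "a \<le> b"
    and le: "\<And>r. r \<in> {a..b} \<Longrightarrow> \<bar>f' r\<bar> \<le> q r" and q: "continuous_on {a..b} q"
  shows "\<bar>f b - f a\<bar> \<le> integral {a..b} q"
proof -
  have I: "(f' has_integral (f b - f a)) {a..b}"
    using der ab by (intro fundamental_theorem_of_calculus) (auto simp flip: has_real_derivative_iff_has_vector_derivative)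
  have "norm (integral {a..b} f') \<le> integral {a..b} q"
    using le by (intro integral_norm_bound_integral[OF has_integral_integrable[OF I] integrable_continuous_real[OF q]]) auto
  then show ?thesis using integral_unique[OF I] by simp
qed

text \<open>\<open>Gs\<close> stands for G*F and \<open>P\<close> for its x-derivative; the
  characteristic argument uses only the sign-type bound \<open>P_le\<close>, the formula
  \<open>P_x\<close> and joint continuity. In \<open>bound\<close> the two points are independent,
  as in a sum of two sup norms.\<close>

locale ch_flow =
  fixes T M :: real and u ux P Gs :: "real \<Rightarrow> real \<Rightarrow> real"
  assumes M: "0 < M"
    and u_x: "\<And>t x. t \<in> {0..T} \<Longrightarrow> (u t has_real_derivative ux t x) (at x)"
    and u_t: "\<And>t x. t \<in> {0..T} \<Longrightarrow>
        ((\<lambda>\<tau>. u \<tau> x) has_real_derivative - (u t x * ux t x + P t x)) (at t within {0..T})"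
    and u_cont: "continuous_on ({0..T} \<times> UNIV) (\<lambda>(t, x). u t x)"
    and ux_cont: "continuous_on ({0..T} \<times> UNIV) (\<lambda>(t, x). ux t x)"
    and Gs_cont: "continuous_on ({0..T} \<times> UNIV) (\<lambda>(t, x). Gs t x)"
    and bound: "\<And>t x y. t \<in> {0..T} \<Longrightarrow> \<bar>u t x\<bar> + \<bar>ux t y\<bar> \<le> M"
    and P_x: "\<And>t x. t \<in> {0..T} \<Longrightarrow>
        (P t has_real_derivative Gs t x - ((u t x)\<^sup>2 + (ux t x)\<^sup>2 / 2)) (at x)"
    and P_le: "\<And>t x. t \<in> {0..T} \<Longrightarrow> \<bar>P t x\<bar> \<le> Gs t x"
begin

text \<open>A common majorant for both sources along a characteristic: |P|, which drives u, and |u^2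
  - u_x^2 / 2 - G*F|, which drives u_x.\<close>

definition Q :: "real \<Rightarrow> real \<Rightarrow> real" where
  "Q t x = (u t x)\<^sup>2 + (ux t x)\<^sup>2 / 2 + Gs t x"

definition char_curve :: "real \<Rightarrow> (real \<Rightarrow> real) \<Rightarrow> bool" where
  "char_curve t0 X \<longleftrightarrow> (\<forall>s\<in>{0..t0}. (X has_real_derivative u s (X s)) (at s within {0..t0}))"

lemma u_lipschitz:
  assumes t: "t \<in> {0..T}"
  shows "\<bar>u t x - u t y\<bar> \<le> M * \<bar>x - y\<bar>"
proof -
  have "norm (u t x - u t y) \<le> M * norm (x - y)"
  proof (rule field_differentiable_bound[OF convex_UNIV])
    show "(u t has_field_derivative ux t z) (at z within UNIV)" for z using u_x[OF t] by simp
    show "norm (ux t z) \<le> M" for z using bound[OF t, of 0 z] by simp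
  qed auto
  then show ?thesis by simp
qed

lemma Q_nonneg: "t \<in> {0..T} \<Longrightarrow> 0 \<le> Q t x"
  unfolding Q_def using P_le[of t x] by (intro add_nonneg_nonneg) auto

lemma Q_cont: "continuous_on ({0..T} \<times> UNIV) (\<lambda>(t, x). Q t x)"
  using u_cont ux_cont Gs_cont unfolding Q_def case_prod_beta by (intro continuous_intros) auto

lemma cont_along:
  assumes "continuous_on ({0..T} \<times> UNIV) (\<lambda>(t, x). h t x)" "continuous_on S X" "S \<subseteq> {0..T}"
  shows "continuous_on S (\<lambda>s. h s (X s))"
proof -
  have "continuous_on S (\<lambda>s. case (s, X s) of (t, x) \<Rightarrow> h t x)"
    using assms(2,3) by (intro continuous_on_compose2[OF assms(1)]) (auto intro!: continuous_intros)
  then show ?thesis by simp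
qed

lemma char_curve_exists:
  assumes t0: "t0 \<in> {0..T}"
  shows "\<exists>X. X t0 = x \<and> char_curve t0 X"
proof -
  \<comment> \<open>The value at the final time is prescribed, so the equation is solved in reversed
    time r = t0 - s, where the velocity is - u.\<close>
  obtain Y where Y0: "Y 0 = x"
    and Y: "\<And>r. r \<in> {0..t0} \<Longrightarrow> (Y has_real_derivative - u (t0 - r) (Y r)) (at r within {0..t0})"
  proof (rule picard_global[of t0 M "\<lambda>r y. - u (t0 - r) y" x])
    have "continuous_on ({0..t0} \<times> UNIV) (\<lambda>z. case (t0 - fst z, snd z) of (t, x) \<Rightarrow> u t x)"
      using t0 by (intro continuous_on_compose2[OF u_cont]) (auto intro!: continuous_intros)
    then show "continuous_on ({0..t0} \<times> UNIV) (\<lambda>(r, y). - u (t0 - r) y)"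
      by (auto simp: case_prod_beta intro: continuous_on_minus)
    show "\<bar>- u (t0 - t) x - - u (t0 - t) y\<bar> \<le> M * \<bar>x - y\<bar>" if "t \<in> {0..t0}" for t x y
      using u_lipschitz[of "t0 - t" y x] that t0 by (auto simp: abs_minus_commute)
  qed (use t0 M in auto)
  have "char_curve t0 (\<lambda>s. Y (t0 - s))"
    unfolding char_curve_def
  proof
    fix s assume s: "s \<in> {0..t0}"
    have im: "(\<lambda>s. t0 - s) ` {0..t0} = {0..t0}" by simp
    have "(Y has_real_derivative - u s (Y (t0 - s))) (at (t0 - s) within (\<lambda>s. t0 - s) ` {0..t0})"
      unfolding im using Y[of "t0 - s"] s by auto
    moreover have "((\<lambda>s. t0 - s) has_real_derivative -1) (at s within {0..t0})"
      by (auto intro!: derivative_eq_intros)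
    ultimately have "(Y \<circ> (\<lambda>s. t0 - s) has_real_derivative - u s (Y (t0 - s)) * -1) (at s within {0..t0})"
      by (rule DERIV_image_chain)
    then show "((\<lambda>s. Y (t0 - s)) has_real_derivative u s (Y (t0 - s))) (at s within {0..t0})"
      by (simp add: comp_def)
  qed
  then show ?thesis using Y0 by (intro exI[of _ "\<lambda>s. Y (t0 - s)"]) auto
qed

text \<open>Indexed by the end point: the estimate at time t0 is evaluated at x, and the earlier
  data are read at the positions \<open>flow t0 x s\<close>. By the distance bounds below, the
  chosen curve is unique on \<open>{0..t0}\<close>.\<close>

definition flow :: "real \<Rightarrow> real \<Rightarrow> real \<Rightarrow> real" where
  "flow t0 x = (SOME X. X t0 = x \<and> char_curve t0 X)"

lemma
  assumes "t0 \<in> {0..T}"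
  shows flow_end: "flow t0 x t0 = x" and char_curve_flow: "char_curve t0 (flow t0 x)"
  using someI_ex[OF char_curve_exists[OF assms, of x]] by (auto simp: flow_def)

lemma char_curve_continuous: "char_curve t0 X \<Longrightarrow> continuous_on {0..t0} X"
  by (auto simp: char_curve_def intro: DERIV_continuous_on)

text \<open>Gronwall in both directions, on the squared distance in order to avoid the corner of the
  absolute value: d^2 exp (2 M s) is nondecreasing and d^2 exp (- 2 M s) is nonincreasing. The first
  bound gives continuity of the flow; the second keeps curves apart and is the expansion property
  used in the change of variables.\<close>

lemma
  assumes t0: "t0 \<in> {0..T}" and X: "char_curve t0 X" and Y: "char_curve t0 Y" and s: "s \<in> {0..t0}"
  shows char_curve_dist_le: "\<bar>X s - Y s\<bar> \<le> exp (M * (t0 - s)) * \<bar>X t0 - Y t0\<bar>"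
    and char_curve_dist_ge: "\<bar>X t0 - Y t0\<bar> \<le> exp (M * (t0 - s)) * \<bar>X s - Y s\<bar>"
proof -
  define d where "d s = X s - Y s" for s
  have dd: "(d has_real_derivative (u r (X r) - u r (Y r))) (at r within {0..t0})" if "r \<in> {0..t0}" for r
    unfolding d_def using X Y that by (intro DERIV_diff) (auto simp: char_curve_def)
  have lip: "\<bar>d r * (u r (X r) - u r (Y r))\<bar> \<le> M * (d r)\<^sup>2" if r: "r \<in> {0..t0}" for r
  proof -
    have "\<bar>d r\<bar> * \<bar>u r (X r) - u r (Y r)\<bar> \<le> \<bar>d r\<bar> * (M * \<bar>d r\<bar>)"
      unfolding d_def using u_lipschitz[of r] r t0 by (intro mult_left_mono) auto
    then show ?thesis by (simp only: abs_mult power2_eq_square) (simp add: algebra_simps)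
  qed
  \<comment> \<open>The two times are left free so that the same extraction of roots serves the
    forward pair s, t0 and the reflected pair - t0, - s.\<close>
  have sq: "\<bar>a\<bar> \<le> exp (M * (t0 - s)) * \<bar>b\<bar>" if "a\<^sup>2 * exp (2 * M * c) \<le> b\<^sup>2 * exp (2 * M * c')" "c' - c = t0 - s" for a b c c'
  proof (rule power2_le_imp_le)
    have "a\<^sup>2 * exp (2 * M * c) * exp (- (2 * M * c)) \<le> b\<^sup>2 * exp (2 * M * c') * exp (- (2 * M * c))"
      using that(1) by (rule mult_right_mono) simp
    then have "a\<^sup>2 \<le> b\<^sup>2 * exp (2 * (M * (c' - c)))"
      by (simp add: mult.assoc algebra_simps flip: exp_add)
    then show "\<bar>a\<bar>\<^sup>2 \<le> (exp (M * (t0 - s)) * \<bar>b\<bar>)\<^sup>2"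
      using that(2) by (simp add: power_mult_distrib exp_double mult.commute)
  qed auto
  have "(d s)\<^sup>2 * exp (2 * M * s) \<le> (d t0)\<^sup>2 * exp (2 * M * t0)"
  proof (rule nondecreasing_of_deriv_within[where a = 0 and b = t0 and f = "\<lambda>r. (d r)\<^sup>2 * exp (2 * M * r)"])
    show "((\<lambda>r. (d r)\<^sup>2 * exp (2 * M * r)) has_real_derivative
        2 * exp (2 * M * r) * (d r * (u r (X r) - u r (Y r)) + M * (d r)\<^sup>2)) (at r within {0..t0})"
      if "r \<in> {0..t0}" for r
      by (rule derivative_eq_intros dd[OF that] refl)+ (simp add: algebra_simps power2_eq_square)
    show "0 \<le> 2 * exp (2 * M * r) * (d r * (u r (X r) - u r (Y r)) + M * (d r)\<^sup>2)" if "r \<in> {0..t0}" for r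
      using lip[OF that] by (intro mult_nonneg_nonneg) (auto simp: abs_le_iff)
  qed (use s in auto)
  then show "\<bar>X s - Y s\<bar> \<le> exp (M * (t0 - s)) * \<bar>X t0 - Y t0\<bar>"
    using sq[of "d s" s "d t0" t0] by (simp add: d_def)
  have "- ((d s)\<^sup>2 * exp (2 * M * (- s))) \<le> - ((d t0)\<^sup>2 * exp (2 * M * (- t0)))"
  proof (rule nondecreasing_of_deriv_within[where a = 0 and b = t0 and f = "\<lambda>r. - ((d r)\<^sup>2 * exp (2 * M * (- r)))"])
    show "((\<lambda>r. - ((d r)\<^sup>2 * exp (2 * M * (- r)))) has_real_derivative
        2 * exp (2 * M * (- r)) * (M * (d r)\<^sup>2 - d r * (u r (X r) - u r (Y r)))) (at r within {0..t0})"
      if "r \<in> {0..t0}" for r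
      by (rule derivative_eq_intros dd[OF that] refl)+ (simp add: algebra_simps power2_eq_square)
    show "0 \<le> 2 * exp (2 * M * (- r)) * (M * (d r)\<^sup>2 - d r * (u r (X r) - u r (Y r)))" if "r \<in> {0..t0}" for r
      using lip[OF that] by (intro mult_nonneg_nonneg) (auto simp: abs_le_iff)
  qed (use s in auto)
  then show "\<bar>X t0 - Y t0\<bar> \<le> exp (M * (t0 - s)) * \<bar>X s - Y s\<bar>"
    using sq[of "d t0" "- t0" "d s" "- s"] by (simp add: d_def)
qed

text \<open>Joint continuity of u_x upgrades the two partial derivatives to a total derivative on
  the strip. Along a curve with velocity u the transport term u u_x cancels, and only - P
  remains.\<close>

lemma u_along_deriv:
  assumes t0: "t0 \<in> {0..T}" and X: "char_curve t0 X" and s: "s \<in> {0..t0}"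
  shows "((\<lambda>s. u s (X s)) has_real_derivative - P s (X s)) (at s within {0..t0})"
proof -
  have sT: "s \<in> {0..T}" using s t0 by auto
  have "((\<lambda>(r, y). u r y) has_derivative
      (\<lambda>(tx, ty). (- (u s (X s) * ux s (X s) + P s (X s))) * tx + blinfun_apply (blinfun_mult_right (ux s (X s))) ty))
      (at (s, X s) within {0..T} \<times> UNIV)"
  proof (rule has_derivative_partialsI[where fy = "\<lambda>r y. blinfun_mult_right (ux r y)"])
    show "((\<lambda>r. u r (X s)) has_derivative (\<lambda>h. - (u s (X s) * ux s (X s) + P s (X s)) * h)) (at s within {0..T})"
      using u_t[OF sT] by (simp add: has_field_derivative_def)
    show "(u r has_derivative blinfun_apply (blinfun_mult_right (ux r y))) (at y within UNIV)" if "r \<in> {0..T}" for r y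
      using u_x[OF that] by (simp add: has_field_derivative_def)
    have "continuous (at (s, X s) within {0..T} \<times> UNIV) (\<lambda>(r, y). ux r y)"
      using ux_cont sT by (auto simp: continuous_on_eq_continuous_within)
    from bounded_linear.continuous[OF bounded_linear_blinfun_mult_right this]
    show "continuous (at (s, X s) within {0..T} \<times> UNIV) (\<lambda>(r, y). blinfun_mult_right (ux r y))"
      by (simp add: case_prod_unfold)
  qed auto
  then have "((\<lambda>(r, y). u r y) has_derivative
      (\<lambda>(tx, ty). (- (u s (X s) * ux s (X s) + P s (X s))) * tx + ux s (X s) * ty))
      (at (s, X s) within (\<lambda>s. (s, X s)) ` {0..t0})"
    using t0 by (auto elim!: has_derivative_subset)
  moreover have "((\<lambda>s. (s, X s)) has_derivative (\<lambda>h. (h, u s (X s) * h))) (at s within {0..t0})"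
    using X s by (auto intro!: has_derivative_Pair simp: char_curve_def has_field_derivative_def)
  ultimately have "((\<lambda>s. case (s, X s) of (r, y) \<Rightarrow> u r y) has_derivative
      (\<lambda>h. case (h, u s (X s) * h) of (tx, ty) \<Rightarrow> (- (u s (X s) * ux s (X s) + P s (X s))) * tx + ux s (X s) * ty)) (at s within {0..t0})"
    by (rule has_derivative_in_compose[rotated])
  from this[unfolded prod.case] show ?thesis
    unfolding has_field_derivative_def
    by (rule has_derivative_eq_rhs) (auto simp: algebra_simps)
qed

lemma u_le_along:
  assumes t0: "t0 \<in> {0..T}" and X: "char_curve t0 X"
  shows "\<bar>u t0 (X t0)\<bar> \<le> \<bar>u 0 (X 0)\<bar> + integral {0..t0} (\<lambda>s. Q s (X s))"
proof -
  have "\<bar>u t0 (X t0) - u 0 (X 0)\<bar> \<le> integral {0..t0} (\<lambda>s. Q s (X s))"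
  proof (rule increment_le_integral[OF u_along_deriv[OF t0 X]])
    show "\<bar>- P r (X r)\<bar> \<le> Q r (X r)" if "r \<in> {0..t0}" for r
      using P_le[of r "X r"] that t0 unfolding Q_def by (simp add: add_increasing)
    show "continuous_on {0..t0} (\<lambda>s. Q s (X s))"
      using t0 by (intro cont_along[OF Q_cont char_curve_continuous[OF X]]) auto
  qed (use t0 in auto)
  then show ?thesis by linarith
qed

text \<open>A continuous function is uniformly continuous on a compact rectangle that contains the
  curve with margin 1, so one \<open>\<eta>\<close> works for all times.\<close>

lemma uniform_along:
  fixes h :: "real \<Rightarrow> real \<Rightarrow> real"
  assumes h: "continuous_on ({0..T} \<times> UNIV) (\<lambda>(t, x). h t x)" and t0: "t0 \<in> {0..T}"
    and X: "continuous_on {0..t0} X" and e: "0 < e"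
  obtains \<eta> where "0 < \<eta>" "\<And>s y. s \<in> {0..t0} \<Longrightarrow> \<bar>y - X s\<bar> < \<eta> \<Longrightarrow> \<bar>h s y - h s (X s)\<bar> < e"
proof -
  have "bounded (X ` {0..t0})" using X by (intro compact_imp_bounded compact_continuous_image) auto
  then have "\<exists>R. \<forall>s\<in>{0..t0}. \<bar>X s\<bar> \<le> R" by (auto simp: bounded_iff)
  then obtain R where R: "\<And>s. s \<in> {0..t0} \<Longrightarrow> \<bar>X s\<bar> \<le> R" by blast
  have "uniformly_continuous_on ({0..t0} \<times> {-(R+1)..R+1}) (\<lambda>(t, x). h t x)"
    using t0 by (intro compact_uniformly_continuous continuous_on_subset[OF h] compact_Times) auto
  from uniformly_continuous_onE[OF this e] obtain \<eta> where \<eta>: "0 < \<eta>"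
    "\<And>z z'. z \<in> {0..t0} \<times> {-(R+1)..R+1} \<Longrightarrow> z' \<in> {0..t0} \<times> {-(R+1)..R+1} \<Longrightarrow> dist z' z < \<eta>
        \<Longrightarrow> dist (case z' of (t, x) \<Rightarrow> h t x) (case z of (t, x) \<Rightarrow> h t x) < e" by metis
  show thesis
  proof (rule that[of "min \<eta> 1"])
    fix s y assume s: "s \<in> {0..t0}" and y: "\<bar>y - X s\<bar> < min \<eta> 1"
    have "\<bar>y\<bar> \<le> R + 1" "\<bar>X s\<bar> \<le> R + 1" using R[OF s] y by auto
    then show "\<bar>h s y - h s (X s)\<bar> < e"
      using \<eta>(2)[of "(s, X s)" "(s, y)"] s y by (auto simp: dist_Pair_Pair dist_real_def abs_le_iff)
  qed (use \<eta>(1) in auto)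
qed

text \<open>Since \<open>u\<close> is only \<open>C\<^sup>1\<close>, \<open>\<partial>\<^sub>x\<^sub>x u\<close> is not available; instead the difference quotient of \<open>u\<close>
  between two neighbouring characteristics is differentiated, which loses no derivative.\<close>

lemma ux_le_along:
  assumes t0: "t0 \<in> {0..T}" and X: "char_curve t0 X"
  shows "\<bar>ux t0 (X t0)\<bar> \<le> \<bar>ux 0 (X 0)\<bar> + integral {0..t0} (\<lambda>s. Q s (X s))"
proof -
  define h where "h s y = Gs s y - ((u s y)\<^sup>2 + (ux s y)\<^sup>2 / 2)" for s y
  have hcont: "continuous_on ({0..T} \<times> UNIV) (\<lambda>(t, x). h t x)"
    using u_cont ux_cont Gs_cont unfolding h_def case_prod_beta by (intro continuous_intros) auto
  have Xc: "continuous_on {0..t0} X" by (rule char_curve_continuous[OF X])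
  have Qc: "continuous_on {0..t0} (\<lambda>s. Q s (X s))"
    using t0 by (intro cont_along[OF Q_cont Xc]) auto
  \<comment> \<open>Collects the errors in units of e: 2 for exchanging the difference quotient and
    u_x at the two end times, and 1 + 2 M per unit of time in the integrand.\<close>
  define B where "B = 2 + t0 * (1 + 2 * M)"
  have B: "0 < B" using t0 M by (auto simp: B_def intro!: add_pos_nonneg)
  have main: "\<bar>ux t0 (X t0)\<bar> \<le> \<bar>ux 0 (X 0)\<bar> + integral {0..t0} (\<lambda>s. Q s (X s)) + B * e" if e: "0 < e" for e
  proof -
    obtain \<eta>1 where \<eta>1: "0 < \<eta>1" "\<And>s y. s \<in> {0..t0} \<Longrightarrow> \<bar>y - X s\<bar> < \<eta>1 \<Longrightarrow> \<bar>ux s y - ux s (X s)\<bar> < e"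
      using uniform_along[OF ux_cont t0 Xc e] by blast
    obtain \<eta>2 where \<eta>2: "0 < \<eta>2" "\<And>s y. s \<in> {0..t0} \<Longrightarrow> \<bar>y - X s\<bar> < \<eta>2 \<Longrightarrow> \<bar>h s y - h s (X s)\<bar> < e"
      using uniform_along[OF hcont t0 Xc e] by blast
    \<comment> \<open>Going back in time, the distance k can grow by the factor exp (M t0) at most,
      so the neighbouring characteristic stays within half of min \<open>\<eta>1\<close>
      \<open>\<eta>2\<close>.\<close>
    define k where "k = min \<eta>1 \<eta>2 / 2 / exp (M * t0)"
    have k: "0 < k" using \<eta>1 \<eta>2 by (simp add: k_def)
    define Y where "Y = flow t0 (X t0 + k)"
    have Y: "char_curve t0 Y" "Y t0 = X t0 + k"
      unfolding Y_def by (auto simp: flow_end[OF t0] char_curve_flow[OF t0])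
    define d where "d s = Y s - X s" for s
    have dsmall: "\<bar>d s\<bar> < \<eta>1" "\<bar>d s\<bar> < \<eta>2" and dne: "d s \<noteq> 0" if s: "s \<in> {0..t0}" for s
    proof -
      have "\<bar>d s\<bar> \<le> exp (M * (t0 - s)) * k"
        using char_curve_dist_le[OF t0 Y(1) X s] Y(2) k by (simp add: d_def)
      also have "\<dots> \<le> exp (M * t0) * k" using s M k by (intro mult_right_mono) auto
      also have "\<dots> < min \<eta>1 \<eta>2" using \<eta>1(1) \<eta>2(1) by (simp add: k_def min_def)
      finally show "\<bar>d s\<bar> < \<eta>1" "\<bar>d s\<bar> < \<eta>2" by auto
      have "k \<le> exp (M * (t0 - s)) * \<bar>d s\<bar>"
        using char_curve_dist_ge[OF t0 Y(1) X s] Y(2) k by (simp add: d_def)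
      then show "d s \<noteq> 0" using k by auto
    qed
    define r where "r s = (u s (Y s) - u s (X s)) / d s" for s
    have r_near: "\<bar>r s - ux s (X s)\<bar> < e" and r_le: "\<bar>r s\<bar> \<le> M" if s: "s \<in> {0..t0}" for s
    proof -
      have sT: "s \<in> {0..T}" using s t0 by auto
      obtain \<xi> where \<xi>: "\<bar>\<xi> - X s\<bar> \<le> \<bar>Y s - X s\<bar>" "u s (Y s) - u s (X s) = (Y s - X s) * ux s \<xi>"
        using mean_value_two_sided[of "u s" "ux s" "X s" "Y s"] u_x[OF sT] by blast
      have "r s = ux s \<xi>" using \<xi>(2) dne[OF s] by (simp add: r_def d_def)
      then show "\<bar>r s - ux s (X s)\<bar> < e" "\<bar>r s\<bar> \<le> M"
        using \<eta>1(2)[OF s, of \<xi>] \<xi>(1) dsmall[OF s] bound[OF sT, of 0 \<xi>] by (auto simp: d_def)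
    qed
    \<comment> \<open>The distance satisfies d' = u s (Y s) - u s (X s) = r d, so the quotient rule
      yields the Riccati term - r^2 next to the difference quotient of P.\<close>
    have rd: "(r has_real_derivative - ((P s (Y s) - P s (X s)) / d s) - (r s)\<^sup>2) (at s within {0..t0})" if s: "s \<in> {0..t0}" for s
    proof -
      have dd: "(d has_real_derivative (u s (Y s) - u s (X s))) (at s within {0..t0})"
        unfolding d_def using X Y(1) s by (intro DERIV_diff) (auto simp: char_curve_def)
      have "(r has_real_derivative ((- P s (Y s) - - P s (X s)) * d s - (u s (Y s) - u s (X s)) * (u s (Y s) - u s (X s))) / (d s * d s))
          (at s within {0..t0})"
        unfolding r_def by (intro DERIV_divide DERIV_diff u_along_deriv t0 X Y(1) s dd dne)
      then show ?thesis
        by (rule DERIV_cong) (use dne[OF s] in \<open>simp add: r_def field_simps power2_eq_square\<close>)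
    qed
    have rd_le: "\<bar>- ((P s (Y s) - P s (X s)) / d s) - (r s)\<^sup>2\<bar> \<le> Q s (X s) + (1 + 2 * M) * e" if s: "s \<in> {0..t0}" for s
    proof -
      have sT: "s \<in> {0..T}" using s t0 by auto
      obtain \<xi> where \<xi>: "\<bar>\<xi> - X s\<bar> \<le> \<bar>Y s - X s\<bar>" "P s (Y s) - P s (X s) = (Y s - X s) * h s \<xi>"
        using mean_value_two_sided[of "P s" "h s" "X s" "Y s"] P_x[OF sT] unfolding h_def by blast
      have "(P s (Y s) - P s (X s)) / d s = h s \<xi>" using \<xi>(2) dne[OF s] by (simp add: d_def)
      moreover have "\<bar>h s \<xi> - h s (X s)\<bar> < e" using \<eta>2(2)[OF s, of \<xi>] \<xi>(1) dsmall[OF s] by (auto simp: d_def)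
      moreover have "\<bar>(r s)\<^sup>2 - (ux s (X s))\<^sup>2\<bar> \<le> 2 * M * e"
      proof -
        have "\<bar>(r s)\<^sup>2 - (ux s (X s))\<^sup>2\<bar> = \<bar>r s + ux s (X s)\<bar> * \<bar>r s - ux s (X s)\<bar>"
          by (simp add: power2_eq_square algebra_simps flip: abs_mult)
        also have "\<dots> \<le> (2 * M) * e"
          using r_le[OF s] r_near[OF s] bound[OF sT, of 0 "X s"] e M by (intro mult_mono) auto
        finally show ?thesis .
      qed
      \<comment> \<open>In the limit the integrand is - (h + u_x^2), and h + u_x^2 = G*F - u^2 +
        u_x^2 / 2.\<close>
      moreover have "\<bar>h s (X s) + (ux s (X s))\<^sup>2\<bar> \<le> Q s (X s)"
        using P_le[OF sT, of "X s"] zero_le_power2[of "u s (X s)"] zero_le_power2[of "ux s (X s)"]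
        unfolding h_def Q_def by linarith
      ultimately show ?thesis by (auto simp: algebra_simps abs_le_iff abs_less_iff)
    qed
    have "\<bar>r t0 - r 0\<bar> \<le> integral {0..t0} (\<lambda>s. Q s (X s) + (1 + 2 * M) * e)"
      using t0 by (intro increment_le_integral[OF rd] rd_le continuous_intros Qc) auto
    also have "\<dots> = integral {0..t0} (\<lambda>s. Q s (X s)) + t0 * ((1 + 2 * M) * e)"
      using t0 by (subst integral_add) (auto intro!: integrable_continuous_real Qc)
    finally show ?thesis
      using r_near[of t0] r_near[of 0] t0 by (auto simp: B_def algebra_simps)
  qed
  show ?thesis
  proof (rule field_le_epsilon)
    fix e :: real assume "0 < e"
    then show "\<bar>ux t0 (X t0)\<bar> \<le> \<bar>ux 0 (X 0)\<bar> + integral {0..t0} (\<lambda>s. Q s (X s)) + e"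
      using main[of "e / B"] B by simp
  qed
qed

end

section \<open>The weighted estimate\<close>

lemma Lp_bounded_abs: "Lp_bounded p (\<lambda>x. \<bar>f x\<bar>) c \<longleftrightarrow> Lp_bounded p f c"
  by (simp add: Lp_bounded_def)

text \<open>The integral of exp (- r |x| / 2) is 4 / r, and for r at least 2 this is below 4 powr r;
  so the constant 4 serves every p.\<close>

lemma Lp_bounded_exp_decay:
  assumes p: "2 \<le> p" and K: "0 < K" and f: "\<And>x. \<bar>f x\<bar> \<le> K * exp (- (\<bar>x\<bar> / 2))"
  shows "Lp_bounded p f (4 * K)"
proof (cases "p = \<infinity>")
  case True
  have "K * exp (- (\<bar>x\<bar> / 2)) \<le> 4 * K" for x :: real
  proof -
    have "exp (- (\<bar>x\<bar> / 2)) \<le> 1" by simp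
    then have "exp (- (\<bar>x\<bar> / 2)) \<le> 4" by linarith
    then show ?thesis using K by simp
  qed
  then show ?thesis using True by (auto simp: Lp_bounded_def intro: order_trans[OF f])
next
  case False
  define r where "r = enn2real p"
  have r: "2 \<le> r" using enn2real_mono[OF p] False by (simp add: less_top r_def)
  have I: "has_bochner_integral lborel (\<lambda>x. exp (- (r / 2 * \<bar>x\<bar>))) (4 / r)"
    using has_bochner_integral_exp_neg_abs[of "r / 2"] r by simp
  have "(\<integral>\<^sup>+x. ennreal (\<bar>f x\<bar> powr r) \<partial>lborel) \<le> (\<integral>\<^sup>+x. ennreal (K powr r) * ennreal (exp (- (r / 2 * \<bar>x\<bar>))) \<partial>lborel)"
  proof (rule nn_integral_mono)
    fix x :: real
    have "\<bar>f x\<bar> powr r \<le> (K * exp (- (\<bar>x\<bar> / 2))) powr r"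
      using f r by (intro powr_mono2) auto
    also have "\<dots> = K powr r * exp (- (r / 2 * \<bar>x\<bar>))"
      using K by (simp add: powr_mult exp_powr_real algebra_simps)
    finally show "ennreal (\<bar>f x\<bar> powr r) \<le> ennreal (K powr r) * ennreal (exp (- (r / 2 * \<bar>x\<bar>)))"
      by (simp add: ennreal_leI flip: ennreal_mult)
  qed
  also have "\<dots> = ennreal (K powr r) * ennreal (4 / r)"
    using I by (subst nn_integral_cmult) (auto simp: nn_integral_eq_integral integrable.intros has_bochner_integral_integral_eq)
  also have "\<dots> \<le> ennreal ((4 * K) powr r)"
  proof -
    have "4 / r \<le> 4 powr 1" using r by (simp add: field_simps)
    also have "\<dots> \<le> 4 powr r" using r by (intro powr_mono) auto
    finally have "K powr r * (4 / r) \<le> K powr r * 4 powr r" by (rule mult_left_mono) simp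
    then have "K powr r * (4 / r) \<le> (4 * K) powr r"
      using K by (simp add: powr_mult mult.commute)
    then show ?thesis using r by (simp add: ennreal_leI flip: ennreal_mult)
  qed
  finally show ?thesis using False by (simp add: Lp_bounded_def r_def)
qed

text \<open>\<open>\<psi>\<close> will be a truncated weight, \<open>A\<close> its own log-Lipschitz
  constant and \<open>\<kappa>\<close> its moderation factor. The decay \<open>\<psi>_le\<close>
  supplies the a priori bound from which the iteration starts.\<close>

locale ch_weighted = ch_flow T M u ux P Gs
  for T M :: real and u ux P Gs :: "real \<Rightarrow> real \<Rightarrow> real" +
  fixes p :: ennreal and \<psi> \<kappa> :: "real \<Rightarrow> real" and A N :: real
  assumes p: "2 \<le> p" and N: "0 < N" and A: "0 \<le> A"
    and \<psi>_cont: "continuous_on UNIV \<psi>" and \<psi>_nonneg: "\<And>x. 0 \<le> \<psi> x"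
    and \<psi>_le: "\<And>x. \<psi> x \<le> N * exp (- (\<bar>x\<bar> / 2))"
    and \<psi>_lip: "\<And>x y. \<psi> x \<le> exp (A * \<bar>x - y\<bar>) * \<psi> y"
    and \<psi>_mod: "\<And>x y. \<psi> (x + y) \<le> \<kappa> x * \<psi> y"
    and \<kappa>_pos: "\<And>x. 0 < \<kappa> x" and \<kappa>_meas: "\<kappa> \<in> borel_measurable borel"
    and kernel_int: "integrable lborel (\<lambda>z. CH_G z * \<kappa> z)"
    and Gs_eq: "\<And>t x. t \<in> {0..T} \<Longrightarrow> Gs t x = G_conv (\<lambda>y. (u t y)\<^sup>2 + (ux t y)\<^sup>2 / 2) x"
begin

text \<open>An upper bound for the norm of convolution with G on L^p weighted by
  \<open>\<psi>\<close>.\<close>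

definition K where "K = (LINT z|lborel. CH_G z * \<kappa> z)"

lemma slice_cont:
  assumes "continuous_on ({0..T} \<times> UNIV) (\<lambda>(t, x). h t x)" "t \<in> {0..T}"
  shows "continuous_on UNIV (h t)"
proof -
  have "continuous_on UNIV (\<lambda>x. case (t, x) of (t, x) \<Rightarrow> h t x)"
    using assms(2) by (intro continuous_on_compose2[OF assms(1)]) (auto intro!: continuous_intros)
  then show ?thesis by simp
qed

lemma kernel_pos: "0 < CH_G z * \<kappa> z"
  using \<kappa>_pos[of z] by (simp add: CH_G_def)

lemma K_pos: "0 < K"
proof -
  have "K \<noteq> 0"
  proof
    assume "K = 0"
    then have "AE z in lborel. CH_G z * \<kappa> z = 0"
      unfolding K_def using kernel_pos by (subst (asm) integral_nonneg_eq_0_iff_AE[OF kernel_int]) (auto intro: less_imp_le)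
    then have "AE z in lborel :: real measure. False"
      by eventually_elim (metis kernel_pos less_irrefl)
    then have "emeasure lborel (UNIV :: real set) = 0" by (simp add: AE_iff_measurable[OF _ refl])
    then show False by simp
  qed
  moreover have "0 \<le> K" unfolding K_def using kernel_pos by (intro integral_nonneg_AE) (auto intro: less_imp_le)
  ultimately show ?thesis by simp
qed

text \<open>Here the quadratic source becomes linear: as |u| and |u_x| are at most M, F is at most M
  (|u| + |u_x|). For G*F, \<open>\<psi>_mod\<close> with x = z + (x - z) moves the weight inside,
  and Minkowski over z adds up the translates. The 1 in 1 + K comes from F, the K from G*F.\<close>

lemma Q_weighted_bound:
  assumes t: "t \<in> {0..T}" and a: "0 < a" and b: "0 < b"
    and ua: "Lp_bounded p (\<lambda>x. u t x * \<psi> x) a" and uxb: "Lp_bounded p (\<lambda>x. ux t x * \<psi> x) b"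
  shows "Lp_bounded p (\<lambda>x. Q t x * \<psi> x) ((1 + K) * M * (a + b))"
proof -
  define F where "F y = (u t y)\<^sup>2 + (ux t y)\<^sup>2 / 2" for y
  have uc: "continuous_on UNIV (u t)" "continuous_on UNIV (ux t)" "continuous_on UNIV (Gs t)"
    using slice_cont t u_cont ux_cont Gs_cont by blast+
  have [measurable]: "u t \<in> borel_measurable borel" "ux t \<in> borel_measurable borel" "\<psi> \<in> borel_measurable borel"
      "Gs t \<in> borel_measurable borel" "\<kappa> \<in> borel_measurable borel"
    using uc \<psi>_cont \<kappa>_meas by (auto intro: borel_measurable_continuous_onI)
  have [measurable]: "F \<in> borel_measurable borel" unfolding F_def by measurable
  have Fnn: "0 \<le> F y" for y by (simp add: F_def)
  have bd: "\<bar>u t x\<bar> \<le> M" "\<bar>ux t x\<bar> \<le> M" for x using bound[OF t, of x x] by auto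
  have FM: "F y \<le> M * \<bar>u t y\<bar> + M * \<bar>ux t y\<bar>" for y
  proof -
    have "z\<^sup>2 \<le> M * \<bar>z\<bar>" if "\<bar>z\<bar> \<le> M" for z
      using mult_right_mono[OF that, of "\<bar>z\<bar>"] by (simp add: power2_eq_square)
    from this[OF bd(1)[of y]] this[OF bd(2)[of y]]
    have "(u t y)\<^sup>2 \<le> M * \<bar>u t y\<bar>" "(ux t y)\<^sup>2 \<le> M * \<bar>ux t y\<bar>" .
    then show ?thesis using M zero_le_power2[of "ux t y"] unfolding F_def by linarith
  qed
  have FM': "F y \<le> M * M + M * M" for y
    using FM[of y] bd[of y] M by (meson add_mono mult_left_mono order_trans less_imp_le)
  define c where "c = M * (a + b)"
  have c: "0 < c" using M a b by (simp add: c_def)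
  have F\<psi>: "Lp_bounded p (\<lambda>x. F x * \<psi> x) c"
  proof (rule Lp_bounded_mono)
    show "Lp_bounded p (\<lambda>x. M * \<bar>u t x * \<psi> x\<bar> + M * \<bar>ux t x * \<psi> x\<bar>) c"
      unfolding c_def distrib_left using ua uxb p M a b
      by (intro Lp_bounded_add Lp_bounded_cmult) (auto simp: Lp_bounded_abs)
    show "\<bar>F x * \<psi> x\<bar> \<le> \<bar>M * \<bar>u t x * \<psi> x\<bar> + M * \<bar>ux t x * \<psi> x\<bar>\<bar>" for x
      using mult_right_mono[OF FM[of x] \<psi>_nonneg[of x]] Fnn[of x] \<psi>_nonneg[of x] M
      by (simp add: abs_mult algebra_simps)
  qed (use c in auto)
  have F\<psi>_le: "\<bar>F y * \<psi> y\<bar> \<le> (M * M + M * M) * N" for y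
  proof -
    have "N * exp (- (\<bar>y\<bar> / 2)) \<le> N * 1" using N by (intro mult_left_mono) auto
    then have "\<psi> y \<le> N" using \<psi>_le[of y] by linarith
    then show ?thesis using FM'[of y] Fnn[of y] \<psi>_nonneg[of y] M by (simp add: abs_mult mult_mono)
  qed
  have int: "integrable lborel (\<lambda>z. CH_G z * \<kappa> z * (F (x - z) * \<psi> (x - z)))" for x
  proof (rule Bochner_Integration.integrable_bound)
    show "integrable lborel (\<lambda>z. CH_G z * \<kappa> z * ((M * M + M * M) * N))"
      using kernel_int by (rule integrable_mult_left)
    show "(\<lambda>z. CH_G z * \<kappa> z * (F (x - z) * \<psi> (x - z))) \<in> borel_measurable lborel"
      unfolding CH_G_def by measurable
    show "AE z in lborel. norm (CH_G z * \<kappa> z * (F (x - z) * \<psi> (x - z))) \<le> norm (CH_G z * \<kappa> z * ((M * M + M * M) * N))"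
    proof (rule AE_I2)
      fix z
      have "\<bar>CH_G z * \<kappa> z\<bar> * \<bar>F (x - z) * \<psi> (x - z)\<bar> \<le> \<bar>CH_G z * \<kappa> z\<bar> * \<bar>(M * M + M * M) * N\<bar>"
        by (rule mult_left_mono[OF order_trans[OF F\<psi>_le abs_ge_self]]) simp
      then show "norm (CH_G z * \<kappa> z * (F (x - z) * \<psi> (x - z))) \<le> norm (CH_G z * \<kappa> z * ((M * M + M * M) * N))"
        by (simp add: abs_mult)
    qed
  qed
  have G\<psi>: "Lp_bounded p (\<lambda>x. Gs t x * \<psi> x) (K * c)"
  proof (rule Lp_bounded_mono)
    have "Lp_bounded p (\<lambda>x. LINT z|lborel. CH_G z * \<kappa> z * (F (x - z) * \<psi> (x - z))) (LINT z|lborel. CH_G z * \<kappa> z * c)"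
    proof (rule Lp_bounded_integral[OF _ p])
      show "sigma_finite_measure (lborel :: real measure)" by (rule lborel.sigma_finite_measure_axioms)
      show "case_prod (\<lambda>z x. CH_G z * \<kappa> z * (F (x - z) * \<psi> (x - z))) \<in> borel_measurable (lborel \<Otimes>\<^sub>M lborel)"
        unfolding CH_G_def by measurable
      show "0 \<le> CH_G z * \<kappa> z * (F (x - z) * \<psi> (x - z))" for z x
        by (rule mult_nonneg_nonneg[OF less_imp_le[OF kernel_pos] mult_nonneg_nonneg[OF Fnn \<psi>_nonneg]])
      show "integrable lborel (\<lambda>z. CH_G z * \<kappa> z * (F (x - z) * \<psi> (x - z)))" for x by (rule int)
      show "0 < CH_G z * \<kappa> z * c" for z using kernel_pos c by simp
      show "integrable lborel (\<lambda>z. CH_G z * \<kappa> z * c)" using kernel_int by (rule integrable_mult_left)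
      show "Lp_bounded p (\<lambda>x. CH_G z * \<kappa> z * (F (x - z) * \<psi> (x - z))) (CH_G z * \<kappa> z * c)" for z
      proof (rule Lp_bounded_cmult)
        \<comment> \<open>A translation is an expanding map with constant 1.\<close>
        have "Lp_bounded p (\<lambda>x. F (x - z) * \<psi> (x - z)) (1 * c)"
          using p c by (intro Lp_bounded_expanding_comp[OF F\<psi>, where X = "\<lambda>x. x - z"]) (auto intro: order_trans[of 1 2])
        then show "Lp_bounded p (\<lambda>x. F (x - z) * \<psi> (x - z)) c" by simp
      qed (use kernel_pos[of z] in auto)
      show "0 < (LINT z|lborel. CH_G z * \<kappa> z * c)" using K_pos c kernel_int by (simp add: K_def)
    qed
    then show "Lp_bounded p (\<lambda>x. LINT z|lborel. CH_G z * \<kappa> z * (F (x - z) * \<psi> (x - z))) (K * c)"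
      using kernel_int by (simp add: K_def)
    show "\<bar>Gs t x * \<psi> x\<bar> \<le> \<bar>LINT z|lborel. CH_G z * \<kappa> z * (F (x - z) * \<psi> (x - z))\<bar>" for x
    proof -
      have "Gs t x = (LINT y|lborel. CH_G (x - y) * F y)" using Gs_eq[OF t] by (simp add: G_conv_def F_def)
      also have "\<dots> = (LINT z|lborel. CH_G z * F (x - z))"
        using lborel_integral_real_affine[of "-1" "\<lambda>y. CH_G (x - y) * F y" x] by simp
      finally have eq: "Gs t x = (LINT z|lborel. CH_G z * F (x - z))" .
      have i1: "integrable lborel (\<lambda>z. CH_G z * F (x - z))"
      proof -
        have "integrable lborel (\<lambda>y. CH_G (x - y) * F y)"
          using FM' Fnn by (intro integrable_G_conv[where K = "M * M + M * M"]) auto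
        from lborel_integrable_real_affine[OF this, of "-1" x] show ?thesis by simp
      qed
      have "Gs t x * \<psi> x = (LINT z|lborel. CH_G z * F (x - z) * \<psi> x)" using i1 by (simp add: eq)
      also have "\<dots> \<le> (LINT z|lborel. CH_G z * \<kappa> z * (F (x - z) * \<psi> (x - z)))"
      proof (rule integral_mono[OF _ int])
        show "integrable lborel (\<lambda>z. CH_G z * F (x - z) * \<psi> x)" using i1 by (rule integrable_mult_left)
        show "CH_G z * F (x - z) * \<psi> x \<le> CH_G z * \<kappa> z * (F (x - z) * \<psi> (x - z))" for z
        proof -
          have "CH_G z * F (x - z) * \<psi> x \<le> CH_G z * F (x - z) * (\<kappa> z * \<psi> (x - z))"
            using \<psi>_mod[of z "x - z"] Fnn CH_G_nonneg by (intro mult_left_mono) auto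
          then show ?thesis by (simp add: mult_ac)
        qed
      qed
      finally have "Gs t x * \<psi> x \<le> (LINT z|lborel. CH_G z * \<kappa> z * (F (x - z) * \<psi> (x - z)))" .
      moreover have "0 \<le> Gs t x * \<psi> x" using P_le[OF t, of x] \<psi>_nonneg[of x] by (intro mult_nonneg_nonneg) auto
      ultimately show ?thesis by simp
    qed
  qed (use K_pos c in auto)
  have "Lp_bounded p (\<lambda>x. F x * \<psi> x + Gs t x * \<psi> x) (c + K * c)"
    using F\<psi> G\<psi> p c K_pos Fnn \<psi>_nonneg P_le[OF t] by (intro Lp_bounded_add) (auto intro!: mult_nonneg_nonneg intro: order_trans[OF abs_ge_zero])
  moreover have "(\<lambda>x. F x * \<psi> x + Gs t x * \<psi> x) = (\<lambda>x. Q t x * \<psi> x)" by (simp add: Q_def F_def distrib_right)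
  ultimately show ?thesis by (simp add: c_def algebra_simps)
qed

section \<open>The backward flow and the weighted Duhamel bound\<close>

lemma char_curve_speed:
  assumes t0: "t0 \<in> {0..T}" and X: "char_curve t0 X" and "r \<in> {0..t0}" "s \<in> {0..t0}"
  shows "\<bar>X r - X s\<bar> \<le> M * \<bar>r - s\<bar>"
proof -
  have "norm (X r - X s) \<le> M * norm (r - s)"
  proof (rule field_differentiable_bound[of "{0..t0}"])
    show "(X has_field_derivative u z (X z)) (at z within {0..t0})" if "z \<in> {0..t0}" for z
      using X that by (simp add: char_curve_def)
    show "norm (u z (X z)) \<le> M" if "z \<in> {0..t0}" for z
      using bound[of z "X z" 0] that t0 by auto
  qed (use assms in auto)
  then show ?thesis by simp
qed

lemma flow_dist:
  assumes t0: "t0 \<in> {0..T}" and r: "r \<in> {0..t0}" and s: "s \<in> {0..t0}"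
  shows "\<bar>flow t0 x r - flow t0 y s\<bar> \<le> M * \<bar>r - s\<bar> + exp (M * t0) * \<bar>x - y\<bar>"
proof -
  have "\<bar>flow t0 x s - flow t0 y s\<bar> \<le> exp (M * (t0 - s)) * \<bar>x - y\<bar>"
    using char_curve_dist_le[OF t0 char_curve_flow[OF t0] char_curve_flow[OF t0] s] by (simp add: flow_end[OF t0])
  also have "\<dots> \<le> exp (M * t0) * \<bar>x - y\<bar>" using s M by (intro mult_right_mono) auto
  finally show ?thesis using char_curve_speed[OF t0 char_curve_flow[OF t0] r s, of x] by linarith
qed

text \<open>Clamping the time to \<open>{0..t0}\<close> gives a Lipschitz map on the whole plane, so
  that measurability of the integrands follows from plain continuity.\<close>

lemma flow_joint_cont:
  assumes t0: "t0 \<in> {0..T}"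
  shows "continuous_on UNIV (\<lambda>(s, x). flow t0 x (max 0 (min t0 s)))"
proof -
  define E where "E = exp (M * t0)"
  have "(M + E)-lipschitz_on UNIV (\<lambda>(s, x). flow t0 x (max 0 (min t0 s)))"
  proof (rule lipschitz_onI)
    fix z z' :: "real \<times> real"
    obtain s x s' x' where z: "z = (s, x)" "z' = (s', x')" by (metis surj_pair)
    have c: "\<bar>max 0 (min t0 s) - max 0 (min t0 s')\<bar> \<le> \<bar>s - s'\<bar>" by (auto simp: max_def min_def)
    have "\<bar>flow t0 x (max 0 (min t0 s)) - flow t0 x' (max 0 (min t0 s'))\<bar>
        \<le> M * \<bar>max 0 (min t0 s) - max 0 (min t0 s')\<bar> + E * \<bar>x - x'\<bar>"
      unfolding E_def by (intro flow_dist) (use t0 in auto)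
    also have "\<dots> \<le> M * dist z z' + E * dist z z'"
      using c dist_fst_le[of z z'] dist_snd_le[of z z'] M
      by (intro add_mono mult_left_mono) (auto simp: z dist_real_def E_def)
    finally show "dist (case z of (s, x) \<Rightarrow> flow t0 x (max 0 (min t0 s))) (case z' of (s, x) \<Rightarrow> flow t0 x (max 0 (min t0 s)))
        \<le> (M + E) * dist z z'"
      by (simp add: z dist_real_def distrib_right)
  qed (use M in \<open>auto simp: E_def add_nonneg_nonneg\<close>)
  then show ?thesis by (rule lipschitz_on_continuous_on)
qed

text \<open>Stated for a general w because u and u_x satisfy the same pointwise inequality. In the
  exponent (A + 1) M, the part A M pays for moving the weight along a curve of speed at most M, and
  the part M pays for the change of variables.\<close>

lemma duhamel_bound:
  assumes t0: "t0 \<in> {0..T}" and pos: "0 < t0" and a: "0 < a"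
    and w0c: "continuous_on UNIV w0" and w0: "Lp_bounded p (\<lambda>x. w0 x * \<psi> x) a"
    and w: "\<And>x. \<bar>w x\<bar> \<le> \<bar>w0 (flow t0 x 0)\<bar> + integral {0..t0} (\<lambda>s. Q s (flow t0 x s))"
    and S: "continuous_on {0..t0} S" "\<And>s. s \<in> {0..t0} \<Longrightarrow> 0 < S s"
      "\<And>s. s \<in> {0..t0} \<Longrightarrow> Lp_bounded p (\<lambda>x. Q s x * \<psi> x) (S s)"
  shows "Lp_bounded p (\<lambda>x. w x * \<psi> x)
    (exp ((A + 1) * M * t0) * a + integral {0..t0} (\<lambda>s. exp ((A + 1) * M * (t0 - s)) * S s))"
proof -
  define c where "c s = max 0 (min t0 s)" for s
  have c: "c s \<in> {0..t0}" "c s \<in> {0..T}" for s using t0 pos by (auto simp: c_def)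
  have c_eq: "c s = s" if "s \<in> {0..t0}" for s using that by (auto simp: c_def)
  have c_cont: "continuous_on UNIV c" unfolding c_def by (intro continuous_intros)
  \<comment> \<open>The weighted source as seen from the end point x; \<open>B s\<close> bounds its
    norm, the first exponential being the price of the weight and the second that of the change of
    variables.\<close>
  define f where "f s x = exp (A * M * (t0 - c s)) * (Q (c s) (flow t0 x (c s)) * \<psi> (flow t0 x (c s)))" for s x
  define B where "B s = exp (A * M * (t0 - s)) * (exp (M * (t0 - s)) * S s)" for s
  let ?R = "restrict_space lborel {0..t0}"
  have flow_c: "continuous_on UNIV (\<lambda>z. flow t0 (snd z) (c (fst z)))"
    using flow_joint_cont[OF t0] by (simp add: c_def case_prod_beta)
  have fcont: "continuous_on UNIV (\<lambda>z. f (fst z) (snd z))"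
  proof -
    have "continuous_on UNIV (\<lambda>z. case (c (fst z), flow t0 (snd z) (c (fst z))) of (t, x) \<Rightarrow> Q t x)"
      by (rule continuous_on_compose2[OF Q_cont])
        (use c in \<open>auto intro!: continuous_intros flow_c continuous_on_compose2[OF c_cont]\<close>)
    then show ?thesis unfolding f_def
      by (auto intro!: continuous_intros flow_c continuous_on_compose2[OF c_cont] continuous_on_compose2[OF \<psi>_cont])
  qed
  have slice1: "continuous_on X (\<lambda>s. f s x)" for x X
    by (rule continuous_on_compose2[OF fcont, of _ "\<lambda>s. (s, x)", simplified]) (auto intro!: continuous_intros)
  have fnn: "0 \<le> f s x" for s x unfolding f_def using c Q_nonneg \<psi>_nonneg by auto
  have Bc: "continuous_on {0..t0} B" unfolding B_def by (intro continuous_intros S(1))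
  have Bpos: "0 < B s" if "s \<in> {0..t0}" for s using S(2)[OF that] by (simp add: B_def)
  have R: "integrable ?R h" "(LINT s|?R. h s) = integral {0..t0} h" if "continuous_on {0..t0} h" for h :: "real \<Rightarrow> real"
  proof -
    have i: "set_integrable lborel {0..t0} h" by (rule borel_integrable_atLeastAtMost'[OF that])
    then show "integrable ?R h" by (simp add: integrable_restrict_space set_integrable_def)
    show "(LINT s|?R. h s) = integral {0..t0} h"
      using set_borel_integral_eq_integral(2)[OF i] by (simp add: integral_restrict_space set_lebesgue_integral_def)
  qed
  have fm0: "(\<lambda>z. f (fst z) (snd z)) \<in> borel_measurable (lborel \<Otimes>\<^sub>M lborel)"
    using borel_measurable_continuous_onI[OF fcont] by (simp add: borel_prod[symmetric] cong: measurable_cong_sets)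
  have fm1: "(\<lambda>z. f (fst z) (snd z)) \<in> borel_measurable (?R \<Otimes>\<^sub>M lborel)"
  proof -
    have "(\<lambda>z. (fst z, snd z)) \<in> measurable (?R \<Otimes>\<^sub>M lborel) (lborel \<Otimes>\<^sub>M lborel)"
      by (intro measurable_Pair measurable_compose[OF measurable_fst measurable_restrict_space1] measurable_snd) auto
    from measurable_compose[OF this fm0] show ?thesis by simp
  qed
  have fm2: "(\<lambda>z. f (snd z) (fst z)) \<in> borel_measurable (lborel \<Otimes>\<^sub>M ?R)"
    using measurable_compose[OF measurable_pair_swap' fm1] by (simp add: case_prod_beta)
  have sf: "sigma_finite_measure ?R"
    by (rule sigma_finite_measure_restrict_space[OF lborel.sigma_finite_measure_axioms]) auto
  then interpret R: sigma_finite_measure ?R .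
  have X_meas: "(\<lambda>x. flow t0 x s) \<in> borel_measurable borel" if "s \<in> {0..t0}" for s
  proof -
    have "continuous_on UNIV (\<lambda>x. flow t0 (snd (s, x)) (c (fst (s, x))))"
      by (rule continuous_on_compose2[OF flow_c]) (auto intro!: continuous_intros)
    then show ?thesis using c_eq[OF that] by (intro borel_measurable_continuous_onI) simp
  qed
  have comp: "Lp_bounded p (\<lambda>x. h (flow t0 x s)) (exp (M * (t0 - s)) * d)"
    if "Lp_bounded p h d" "0 < d" "h \<in> borel_measurable borel" "s \<in> {0..t0}" for h d s
  proof (rule Lp_bounded_expanding_comp[OF that(1) _ _ X_meas[OF that(4)] _ _ that(3)])
    show "\<bar>x - y\<bar> \<le> exp (M * (t0 - s)) * \<bar>flow t0 x s - flow t0 y s\<bar>" for x y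
      using char_curve_dist_ge[OF t0 char_curve_flow[OF t0] char_curve_flow[OF t0] that(4)] by (simp add: flow_end[OF t0])
    show "1 \<le> exp (M * (t0 - s))" using M that(4) by simp
    show "1 \<le> p" using p by (rule order_trans[rotated]) simp
  qed (use that in auto)
  have \<psi>m[measurable]: "\<psi> \<in> borel_measurable borel" by (rule borel_measurable_continuous_onI[OF \<psi>_cont])
  have w0m[measurable]: "w0 \<in> borel_measurable borel" by (rule borel_measurable_continuous_onI[OF w0c])
  \<comment> \<open>\<open>B\<close> is continuous and positive on a compact interval of positive
    length; its minimum makes the integral strictly positive, as Minkowski's inequality is stated
    here.\<close>
  have IB: "0 < (LINT s|?R. B s)"
  proof -
    obtain m where m: "m \<in> {0..t0}" "\<And>s. s \<in> {0..t0} \<Longrightarrow> B m \<le> B s"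
      using continuous_attains_inf[OF _ _ Bc] pos by auto
    have "t0 * B m = integral {0..t0} (\<lambda>_. B m)" using pos by simp
    also have "\<dots> \<le> integral {0..t0} B"
      using m(2) by (intro integral_le integrable_continuous_real Bc) auto
    finally show ?thesis using R(2)[OF Bc] Bpos[OF m(1)] pos mult_pos_pos[OF pos Bpos[OF m(1)]] by linarith
  qed
  have integral_bd: "Lp_bounded p (\<lambda>x. LINT s|?R. f s x) (LINT s|?R. B s)"
  proof (rule Lp_bounded_integral[OF sf p])
    show "case_prod f \<in> borel_measurable (?R \<Otimes>\<^sub>M lborel)" using fm1 by (simp add: case_prod_beta')
    show "integrable ?R (\<lambda>s. f s x)" for x by (rule R(1)[OF slice1])
    show "integrable ?R B" by (rule R(1)[OF Bc])
    show "Lp_bounded p (f s) (B s)" if "s \<in> space ?R" for s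
    proof -
      have s: "s \<in> {0..t0}" using that by (simp add: space_restrict_space)
      then have sT: "s \<in> {0..T}" using t0 by auto
      have [measurable]: "Q s \<in> borel_measurable borel"
        by (rule borel_measurable_continuous_onI[OF slice_cont[OF Q_cont sT]])
      have "Lp_bounded p (\<lambda>x. exp (A * M * (t0 - s)) * (Q s (flow t0 x s) * \<psi> (flow t0 x s))) (B s)"
        unfolding B_def
      proof (rule Lp_bounded_cmult)
        show "Lp_bounded p (\<lambda>x. Q s (flow t0 x s) * \<psi> (flow t0 x s)) (exp (M * (t0 - s)) * S s)"
          by (rule comp[OF S(3)[OF s] S(2)[OF s] _ s]) measurable
        have [measurable]: "(\<lambda>x. flow t0 x s) \<in> borel_measurable borel" by (rule X_meas[OF s])
        show "(\<lambda>x. Q s (flow t0 x s) * \<psi> (flow t0 x s)) \<in> borel_measurable borel" by measurable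
      qed simp
      then show ?thesis using c_eq[OF s] by (simp add: f_def[abs_def])
    qed
    show "0 < (LINT s|?R. B s)" by (rule IB)
  qed (use fnn Bpos in \<open>auto simp: space_restrict_space\<close>)
  define g0 where "g0 x = exp (A * M * t0) * \<bar>w0 (flow t0 x 0) * \<psi> (flow t0 x 0)\<bar>" for x
  have X0[measurable]: "(\<lambda>x. flow t0 x 0) \<in> borel_measurable borel" by (rule X_meas) (use pos in auto)
  have g0m: "g0 \<in> borel_measurable borel" unfolding g0_def by measurable
  have g0_bd: "Lp_bounded p g0 (exp (A * M * t0) * (exp (M * t0) * a))"
    unfolding g0_def
  proof (rule Lp_bounded_cmult)
    have "Lp_bounded p (\<lambda>x. w0 (flow t0 x 0) * \<psi> (flow t0 x 0)) (exp (M * (t0 - 0)) * a)"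
      by (rule comp[OF w0 a]) (use pos in auto)
    then show "Lp_bounded p (\<lambda>x. \<bar>w0 (flow t0 x 0) * \<psi> (flow t0 x 0)\<bar>) (exp (M * t0) * a)"
      by (simp add: Lp_bounded_abs)
  qed (auto intro: borel_measurable_abs)
  have Hm: "(\<lambda>x. LINT s|?R. f s x) \<in> borel_measurable borel"
    using R.borel_measurable_lebesgue_integral[of "\<lambda>x s. f s x" lborel] fm2 by (simp add: case_prod_beta')
  have sum: "Lp_bounded p (\<lambda>x. g0 x + (LINT s|?R. f s x)) (exp (A * M * t0) * (exp (M * t0) * a) + (LINT s|?R. B s))"
    by (rule Lp_bounded_add[OF g0_bd integral_bd p _ IB g0m Hm])
      (use a fnn in \<open>auto simp: g0_def intro!: integral_nonneg_AE\<close>)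
  have pt: "\<bar>w x * \<psi> x\<bar> \<le> \<bar>g0 x + (LINT s|?R. f s x)\<bar>" for x
  proof -
    have move: "\<psi> x \<le> exp (A * M * (t0 - s)) * \<psi> (flow t0 x s)" if s: "s \<in> {0..t0}" for s
    proof -
      have "\<bar>flow t0 x t0 - flow t0 x s\<bar> \<le> M * \<bar>t0 - s\<bar>"
        using char_curve_speed[OF t0 char_curve_flow[OF t0] _ s] pos by auto
      then have "A * \<bar>x - flow t0 x s\<bar> \<le> A * (M * (t0 - s))"
        using s A by (intro mult_left_mono) (auto simp: flow_end[OF t0])
      then have "exp (A * \<bar>x - flow t0 x s\<bar>) * \<psi> (flow t0 x s) \<le> exp (A * M * (t0 - s)) * \<psi> (flow t0 x s)"
        using \<psi>_nonneg by (intro mult_right_mono) (auto simp: mult.assoc)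
      then show ?thesis using \<psi>_lip[of x "flow t0 x s"] by linarith
    qed
    have Xc: "continuous_on {0..t0} (flow t0 x)" by (rule char_curve_continuous[OF char_curve_flow[OF t0]])
    have Qc: "continuous_on {0..t0} (\<lambda>s. Q s (flow t0 x s))"
      using t0 by (intro cont_along[OF Q_cont Xc]) auto
    have "\<bar>w0 (flow t0 x 0)\<bar> * \<psi> x \<le> \<bar>w0 (flow t0 x 0)\<bar> * (exp (A * M * (t0 - 0)) * \<psi> (flow t0 x 0))"
      using move[of 0] pos by (intro mult_left_mono) auto
    also have "\<dots> = g0 x" using \<psi>_nonneg by (simp add: g0_def abs_mult)
    finally have i: "\<bar>w0 (flow t0 x 0)\<bar> * \<psi> x \<le> g0 x" .
    have "integral {0..t0} (\<lambda>s. Q s (flow t0 x s)) * \<psi> x = integral {0..t0} (\<lambda>s. Q s (flow t0 x s) * \<psi> x)"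
      by simp
    also have "\<dots> \<le> integral {0..t0} (\<lambda>s. f s x)"
    proof (rule integral_le)
      show "(\<lambda>s. Q s (flow t0 x s) * \<psi> x) integrable_on {0..t0}"
        by (intro integrable_continuous_real continuous_intros Qc)
      show "(\<lambda>s. f s x) integrable_on {0..t0}" by (rule integrable_continuous_real[OF slice1])
      show "Q s (flow t0 x s) * \<psi> x \<le> f s x" if s: "s \<in> {0..t0}" for s
      proof -
        have "Q s (flow t0 x s) * \<psi> x \<le> Q s (flow t0 x s) * (exp (A * M * (t0 - s)) * \<psi> (flow t0 x s))"
          using move[OF s] Q_nonneg[of s] s t0 by (intro mult_left_mono) auto
        then show ?thesis by (simp add: f_def c_eq[OF s] mult_ac)
      qed
    qed
    also have "\<dots> = (LINT s|?R. f s x)" by (simp add: R(2)[OF slice1])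
    finally have "\<bar>w x\<bar> * \<psi> x \<le> g0 x + (LINT s|?R. f s x)"
      using i mult_right_mono[OF w[of x] \<psi>_nonneg[of x]] by (simp add: distrib_right)
    then show ?thesis using \<psi>_nonneg[of x] by (simp add: abs_mult)
  qed
  have eq: "exp (A * M * t0) * (exp (M * t0) * a) + (LINT s|?R. B s)
      = exp ((A + 1) * M * t0) * a + integral {0..t0} (\<lambda>s. exp ((A + 1) * M * (t0 - s)) * S s)"
    unfolding R(2)[OF Bc] unfolding B_def by (simp add: algebra_simps flip: exp_add)
  show ?thesis using Lp_bounded_mono[OF sum pt order_refl] IB a unfolding eq[symmetric]
    by (simp add: add_nonneg_nonneg less_imp_le)
qed

text \<open>The n-th Picard iterate in closed form. Apart from the factor exp ((A + 1) M t), the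
  excess E over the initial bound obeys E_{n+1}' = C (a + b + 2 E_n). The exponential part is the
  fixed point of this recursion, and the power divided by \<open>fact n\<close> is the trace of the
  starting guess: for n = 0 its half is 4 M N, the a priori bound from the decay of
  \<open>\<psi>\<close>.\<close>

lemma gronwall_iteration:
  assumes a: "0 < a" "Lp_bounded p (\<lambda>x. u 0 x * \<psi> x) a"
    and b: "0 < b" "Lp_bounded p (\<lambda>x. ux 0 x * \<psi> x) b"
  defines "C \<equiv> (1 + K) * M"
  assumes t: "t \<in> {0..T}"
  shows "Lp_bounded p (\<lambda>x. u t x * \<psi> x) (exp ((A + 1) * M * t) * (a + ((a + b) * (exp (2 * C * t) - 1) + 8 * (M * N) * ((2 * C * t) ^ n / fact n)) / 2)) \<and>
    Lp_bounded p (\<lambda>x. ux t x * \<psi> x) (exp ((A + 1) * M * t) * (b + ((a + b) * (exp (2 * C * t) - 1) + 8 * (M * N) * ((2 * C * t) ^ n / fact n)) / 2))"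
  using t
proof (induction n arbitrary: t)
  case 0
  define k where "k = exp ((A + 1) * M * t)"
  have k: "1 \<le> k" using 0 A M by (simp add: k_def)
  have C: "0 < C" using K_pos M by (simp add: C_def)
  have e: "0 \<le> (a + b) * (exp (2 * C * t) - 1)" using 0 C a b by simp
  have MN: "0 < M * N" using M N by simp
  have *: "Lp_bounded p (\<lambda>x. w x * \<psi> x) (k * (d + ((a + b) * (exp (2 * C * t) - 1) + 8 * (M * N) * ((2 * C * t) ^ 0 / fact 0)) / 2))"
    if w: "\<And>x. \<bar>w x\<bar> \<le> M" and d: "0 < d" for w d
  proof (rule Lp_bounded_mono[OF Lp_bounded_exp_decay[OF p MN] order_refl])
    show "\<bar>w x * \<psi> x\<bar> \<le> M * N * exp (- (\<bar>x\<bar> / 2))" for x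
      using mult_mono[OF w[of x] \<psi>_le[of x]] M \<psi>_nonneg[of x] by (simp add: abs_mult mult.assoc)
    define Z where "Z = (a + b) * (exp (2 * C * t) - 1)"
    have "4 * (M * N) \<le> d + (Z + 8 * (M * N)) / 2"
      using d e by (simp add: Z_def[symmetric] add_divide_distrib)
    then have "1 * (4 * (M * N)) \<le> k * (d + (Z + 8 * (M * N)) / 2)"
      using k MN by (intro mult_mono) auto
    then show "4 * (M * N) \<le> k * (d + ((a + b) * (exp (2 * C * t) - 1) + 8 * (M * N) * ((2 * C * t) ^ 0 / fact 0)) / 2)"
      by (simp add: Z_def)
  qed (use MN in auto)
  show ?case
    unfolding k_def[symmetric]
  proof (intro conjI *)
    show "\<bar>u t x\<bar> \<le> M" "\<bar>ux t x\<bar> \<le> M" for x using bound[OF 0, of x x] by auto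
  qed (use a b in auto)
next
  case (Suc n)
  have C: "0 < C" using K_pos M by (simp add: C_def)
  define S0 where "S0 = a + b"
  have S0: "0 < S0" using a b by (simp add: S0_def)
  define E where "E n t = (S0 * (exp (2 * C * t) - 1) + 8 * (M * N) * ((2 * C * t) ^ n / fact n)) / 2" for n and t :: real
  define \<mu> where "\<mu> = (A + 1) * M"
  have E0: "0 \<le> E n s" if "0 \<le> s" for s n
    using that S0 C M N by (simp add: E_def)
  have IH: "Lp_bounded p (\<lambda>x. u s x * \<psi> x) (exp (\<mu> * s) * (a + E n s))"
    "Lp_bounded p (\<lambda>x. ux s x * \<psi> x) (exp (\<mu> * s) * (b + E n s))" if "s \<in> {0..T}" for s
    using Suc.IH[OF that] by (auto simp: E_def S0_def \<mu>_def)
  define S where "S s = C * (exp (\<mu> * s) * (S0 + 2 * E n s))" for s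
  have Sc: "continuous_on X S" for X unfolding S_def E_def by (intro continuous_intros) auto
  have Spos: "0 < S s" if "s \<in> {0..t}" for s
    using that E0[of s n] S0 C by (auto simp: S_def intro!: mult_pos_pos add_pos_nonneg)
  have QS: "Lp_bounded p (\<lambda>x. Q s x * \<psi> x) (S s)" if s: "s \<in> {0..t}" for s
  proof -
    have sT: "s \<in> {0..T}" using s Suc.prems by auto
    have "Lp_bounded p (\<lambda>x. Q s x * \<psi> x) ((1 + K) * M * (exp (\<mu> * s) * (a + E n s) + exp (\<mu> * s) * (b + E n s)))"
      using E0[of s n] s a(1) b(1) by (intro Q_weighted_bound sT IH) (auto intro!: mult_pos_pos add_pos_nonneg)
    then show ?thesis by (simp add: S_def C_def S0_def algebra_simps)
  qed
  \<comment> \<open>The factors exp (\<mu> (t - s)) and exp (\<mu> s) combine to a constant, and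
    \<open>E (Suc n)\<close> is an antiderivative of what remains.\<close>
  have int: "integral {0..t} (\<lambda>s. exp (\<mu> * (t - s)) * S s) = exp (\<mu> * t) * E (Suc n) t"
  proof -
    have e: "exp (\<mu> * (t - s)) * S s = exp (\<mu> * t) * (C * (S0 + 2 * E n s))" for s
      by (simp add: S_def algebra_simps flip: exp_add)
    have I: "((\<lambda>s. exp (\<mu> * t) * (C * (S0 + 2 * E n s))) has_integral (exp (\<mu> * t) * E (Suc n) t - exp (\<mu> * t) * E (Suc n) 0)) {0..t}"
    proof (rule fundamental_theorem_of_calculus)
      show "((\<lambda>s. exp (\<mu> * t) * E (Suc n) s) has_vector_derivative exp (\<mu> * t) * (C * (S0 + 2 * E n s))) (at s within {0..t})" for s
        unfolding has_real_derivative_iff_has_vector_derivative[symmetric] E_def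
        by (rule derivative_eq_intros refl | simp)+ (simp add: field_simps del: of_nat_Suc)
    qed (use Suc.prems in auto)
    have "E (Suc n) 0 = 0" by (simp add: E_def)
    then show ?thesis using integral_unique[OF I] by (simp only: e mult_zero_right diff_zero)
  qed
  show ?case
  \<comment> \<open>The Duhamel bound needs an interval of positive length; at t = 0 the excess
    vanishes since 0 is raised to the power \<open>Suc n\<close>.\<close>
  proof (cases "t = 0")
    case True
    then show ?thesis using a b by simp
  next
    case False
    then have t: "0 < t" using Suc.prems by auto
    have z: "0 \<in> {0..T}" using Suc.prems by auto
    have "Lp_bounded p (\<lambda>x. u t x * \<psi> x) (exp (\<mu> * t) * a + integral {0..t} (\<lambda>s. exp (\<mu> * (t - s)) * S s))"
      unfolding \<mu>_def
      using u_le_along[OF Suc.prems char_curve_flow[OF Suc.prems]] flow_end[OF Suc.prems]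
      by (intro duhamel_bound[OF Suc.prems t a(1) slice_cont[OF u_cont z] a(2)] Sc Spos QS) auto
    moreover have "Lp_bounded p (\<lambda>x. ux t x * \<psi> x) (exp (\<mu> * t) * b + integral {0..t} (\<lambda>s. exp (\<mu> * (t - s)) * S s))"
      unfolding \<mu>_def
      using ux_le_along[OF Suc.prems char_curve_flow[OF Suc.prems]] flow_end[OF Suc.prems]
      by (intro duhamel_bound[OF Suc.prems t b(1) slice_cont[OF ux_cont z] b(2)] Sc Spos QS) auto
    ultimately show ?thesis
      unfolding int by (simp add: E_def S0_def \<mu>_def distrib_left)
  qed
qed

text \<open>The only trace of N is multiplied by a term of the exponential series, which tends to 0.
  Hence the limit bound no longer sees the truncation level.\<close>

lemma weighted_estimate:
  assumes a: "0 < a" "Lp_bounded p (\<lambda>x. u 0 x * \<psi> x) a"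
    and b: "0 < b" "Lp_bounded p (\<lambda>x. ux 0 x * \<psi> x) b"
    and t: "t \<in> {0..T}"
  shows "Lp_bounded p (\<lambda>x. u t x * \<psi> x) (exp ((A + 1) * M * t) * (a + (a + b) * (exp (2 * ((1 + K) * M) * t) - 1) / 2))" (is ?u)
    and "Lp_bounded p (\<lambda>x. ux t x * \<psi> x) (exp ((A + 1) * M * t) * (b + (a + b) * (exp (2 * ((1 + K) * M) * t) - 1) / 2))" (is ?ux)
proof -
  define c where "c = 2 * ((1 + K) * M) * t"
  have c: "0 \<le> c" using K_pos M t by (simp add: c_def)
  have "(\<lambda>n. inverse (fact n) * c ^ n) \<longlonglongrightarrow> 0" by (rule summable_LIMSEQ_zero[OF summable_exp])
  then have lim0: "(\<lambda>n. c ^ n / fact n) \<longlonglongrightarrow> 0" by (simp add: divide_inverse mult.commute)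
  have lim: "(\<lambda>n. exp ((A + 1) * M * t) * (d + ((a + b) * (exp c - 1) + 8 * (M * N) * (c ^ n / fact n)) / 2))
      \<longlonglongrightarrow> exp ((A + 1) * M * t) * (d + (a + b) * (exp c - 1) / 2)" for d
    by (rule tendsto_eq_intros lim0 refl | simp)+
  have pos: "0 < exp ((A + 1) * M * t) * (d + (a + b) * (exp c - 1) / 2)" if "0 < d" for d
    using that a(1) b(1) c by (intro mult_pos_pos add_pos_nonneg) auto
  note it = gronwall_iteration[OF a b t]
  show ?u unfolding c_def[symmetric]
    by (rule Lp_bounded_tendsto[OF _ lim pos[OF a(1)]]) (use it in \<open>auto simp: c_def\<close>)
  show ?ux unfolding c_def[symmetric]
    by (rule Lp_bounded_tendsto[OF _ lim pos[OF b(1)]]) (use it in \<open>auto simp: c_def\<close>)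
qed

end

section \<open>The persistence theorem\<close>

lemma AE_le_imp_le_continuous:
  fixes f :: "real \<Rightarrow> real"
  assumes cont: "continuous_on UNIV f" and le: "AE x in lborel. f x \<le> c"
  shows "f x \<le> c"
proof -
  have op: "open {x. c < f x}" using cont by (intro open_Collect_less continuous_intros) auto
  have "emeasure lborel {x. c < f x} = 0"
    using le op by (simp add: AE_iff_measurable[OF _ refl] not_le)
  then have "{x. c < f x} \<in> null_sets lebesgue"
    using op by (intro null_sets_completionI) (auto simp: null_sets_def)
  then have "{x. c < f x} = {}" using open_not_negligible[OF op] by (auto simp: negligible_iff_null_sets)
  then show ?thesis by (auto simp: not_less[symmetric])
qed

lemma le_Linf_norm:
  assumes cont: "continuous_on UNIV f"
  shows "ennreal \<bar>f x\<bar> \<le> Linf_norm f"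
  unfolding Linf_norm_def
proof (rule Inf_greatest)
  fix c assume "c \<in> {c. AE x in lborel. ennreal \<bar>f x\<bar> \<le> c}"
  then have c: "AE x in lborel. ennreal \<bar>f x\<bar> \<le> c" by simp
  show "ennreal \<bar>f x\<bar> \<le> c"
  proof (cases c)
    case (real r)
    have "\<bar>f x\<bar> \<le> r"
    proof (rule AE_le_imp_le_continuous[where f = "\<lambda>x. \<bar>f x\<bar>"])
      show "continuous_on UNIV (\<lambda>x. \<bar>f x\<bar>)" using cont by (intro continuous_intros)
      show "AE x in lborel. \<bar>f x\<bar> \<le> r" using c real by simp
    qed
    then show ?thesis using real by (simp add: ennreal_leI)
  qed simp
qed

lemma Linf_norm_le: "(\<And>x. \<bar>f x\<bar> \<le> c) \<Longrightarrow> Linf_norm f \<le> ennreal c"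
  unfolding Linf_norm_def by (intro Inf_lower) (auto intro!: AE_I2 ennreal_leI)

text \<open>The surplus e keeps the bound strictly positive even for vanishing data, as the
  preceding estimates demand. For infinite p, continuity turns the essential bound into one at every
  point.\<close>

lemma Lp_bounded_of_in_Lp:
  assumes f: "in_Lp p f" and cont: "continuous_on UNIV f" and e: "0 < e" and p: "2 \<le> p"
  shows "Lp_bounded p f (enn2real (Lp_norm p f) + e)"
proof (cases "p = \<infinity>")
  case True
  have "\<bar>f x\<bar> \<le> enn2real (Lp_norm p f) + e" for x
  proof -
    have "ennreal \<bar>f x\<bar> \<le> Lp_norm p f" using le_Linf_norm[OF cont] True by (simp add: Lp_norm_def)
    also have "\<dots> = ennreal (enn2real (Lp_norm p f))" using f by (simp add: in_Lp_def less_top)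
    finally show ?thesis using e by simp
  qed
  then show ?thesis using True by (simp add: Lp_bounded_def)
next
  case False
  define r where "r = enn2real p"
  have r: "2 \<le> r" using enn2real_mono[OF p] False by (simp add: less_top r_def)
  define I where "I = (\<integral>\<^sup>+x. ennreal (\<bar>f x\<bar> powr r) \<partial>lborel)"
  have Lp: "Lp_norm p f = (if I = \<infinity> then \<infinity> else ennreal (enn2real I powr (1 / r)))"
    using False by (simp add: Lp_norm_def I_def r_def Let_def)
  then have I: "I \<noteq> \<infinity>" using f by (auto simp: in_Lp_def)
  have "I = ennreal (enn2real I)" using I by (simp add: less_top)
  also have "\<dots> = ennreal ((enn2real I powr (1 / r)) powr r)" using r by (simp add: powr_powr)
  also have "\<dots> \<le> ennreal ((enn2real (Lp_norm p f) + e) powr r)"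
    using I e r by (intro ennreal_leI powr_mono2) (auto simp: Lp)
  finally show ?thesis using False by (simp add: Lp_bounded_def I_def r_def)
qed

lemma Lp_norm_le_of_bounded:
  assumes "Lp_bounded p f c" "0 < c" "2 \<le> p"
  shows "Lp_norm p f \<le> ennreal c"
proof (cases "p = \<infinity>")
  case True
  then show ?thesis using assms by (auto simp: Lp_bounded_def Lp_norm_def intro: Linf_norm_le)
next
  case False
  define r where "r = enn2real p"
  have r: "2 \<le> r" using enn2real_mono[OF assms(3)] False by (simp add: less_top r_def)
  define I where "I = (\<integral>\<^sup>+x. ennreal (\<bar>f x\<bar> powr r) \<partial>lborel)"
  have Lp: "Lp_norm p f = (if I = \<infinity> then \<infinity> else ennreal (enn2real I powr (1 / r)))"
    using False by (simp add: Lp_norm_def I_def r_def Let_def)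
  have I: "I \<le> ennreal (c powr r)" using assms(1) False by (simp add: Lp_bounded_def I_def r_def)
  then have "I \<noteq> \<infinity>" by (auto simp: top_unique)
  have "enn2real I \<le> c powr r" using enn2real_mono[OF I] by simp
  then have "enn2real I powr (1 / r) \<le> (c powr r) powr (1 / r)" using r by (intro powr_mono2) auto
  also have "\<dots> = c" using r assms(2) by (simp add: powr_powr)
  finally show ?thesis using \<open>I \<noteq> \<infinity>\<close> by (simp add: Lp ennreal_leI)
qed

text \<open>At each fixed x the truncation is inactive from some n on, and c does not depend on
  n.\<close>

lemma Lp_bounded_trunc_limit:
  assumes bd: "\<And>n::nat. Lp_bounded p (\<lambda>x. w x * trunc_weight \<phi> (real n + 1) x) c"
    and pos: "\<And>x. 0 < \<phi> x" and [measurable]: "w \<in> borel_measurable borel" "\<phi> \<in> borel_measurable borel"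
  shows "Lp_bounded p (\<lambda>x. w x * \<phi> x) c"
proof -
  have mono: "trunc_weight \<phi> (real n + 1) x \<le> trunc_weight \<phi> (real m + 1) x" if "n \<le> m" for n m x
    unfolding trunc_weight_def using that by (intro min.mono mult_right_mono) auto
  have ex: "\<exists>n. trunc_weight \<phi> (real n + 1) x = \<phi> x" for x
  proof -
    obtain n :: nat where n: "\<phi> x * exp (\<bar>x\<bar> / 2) \<le> real n" using real_arch_simple by blast
    have "\<phi> x = \<phi> x * exp (\<bar>x\<bar> / 2) * exp (- (\<bar>x\<bar> / 2))" by (simp add: mult.assoc flip: exp_add)
    also have "\<dots> \<le> (real n + 1) * exp (- (\<bar>x\<bar> / 2))" using n by (intro mult_right_mono) auto
    finally show ?thesis by (intro exI[of _ n]) (simp add: trunc_weight_def)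
  qed
  have nn: "0 \<le> trunc_weight \<phi> (real n + 1) x" for n x using pos[of x] by (intro trunc_weight_nonneg) auto
  show ?thesis
  proof (cases "p = \<infinity>")
    case True
    have "\<bar>w x * \<phi> x\<bar> \<le> c" for x
    proof -
      obtain n where "trunc_weight \<phi> (real n + 1) x = \<phi> x" using ex by blast
      then show ?thesis using bd[of n] True unfolding Lp_bounded_def by (metis (full_types))
    qed
    then show ?thesis using True by (simp add: Lp_bounded_def)
  next
    case False
    define g where "g n x = ennreal (\<bar>w x * trunc_weight \<phi> (real n + 1) x\<bar> powr enn2real p)" for n :: nat and x
    have [measurable]: "trunc_weight \<phi> N \<in> borel_measurable borel" for N
      unfolding trunc_weight_def by measurable
    have le: "\<bar>w x * trunc_weight \<phi> (real n + 1) x\<bar> \<le> \<bar>w x * y\<bar>" if "trunc_weight \<phi> (real n + 1) x \<le> y" for n x y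
      using that nn[of n x] by (simp add: abs_mult mult_left_mono)
    have sup: "(SUP n. g n x) = ennreal (\<bar>w x * \<phi> x\<bar> powr enn2real p)" for x
    proof (rule antisym)
      show "(SUP n. g n x) \<le> ennreal (\<bar>w x * \<phi> x\<bar> powr enn2real p)"
        unfolding g_def by (intro SUP_least ennreal_leI powr_mono2 le trunc_weight_le) auto
      obtain n where "trunc_weight \<phi> (real n + 1) x = \<phi> x" using ex by blast
      then show "ennreal (\<bar>w x * \<phi> x\<bar> powr enn2real p) \<le> (SUP n. g n x)"
        by (intro SUP_upper2[of n]) (auto simp: g_def)
    qed
    have "incseq g" unfolding incseq_def le_fun_def g_def
      by (intro allI impI ennreal_leI powr_mono2 le mono) auto
    moreover have "g n \<in> borel_measurable lborel" for n unfolding g_def by measurable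
    ultimately have "(\<integral>\<^sup>+x. (SUP n. g n x) \<partial>lborel) = (SUP n. \<integral>\<^sup>+x. g n x \<partial>lborel)"
      by (rule nn_integral_monotone_convergence_SUP)
    also have "\<dots> \<le> ennreal (c powr enn2real p)"
      using bd False by (intro SUP_least) (simp add: Lp_bounded_def g_def)
    finally show ?thesis using False by (simp add: Lp_bounded_def sup)
  qed
qed

section \<open>From strong solutions to the abstract flow\<close>

lemma joint_continuity:
  fixes h :: "real \<Rightarrow> real \<Rightarrow> real"
  assumes x: "\<And>t. t \<in> I \<Longrightarrow> continuous_on UNIV (h t)"
    and t: "\<And>t e. t \<in> I \<Longrightarrow> 0 < e \<Longrightarrow> \<exists>d>0. \<forall>\<tau>\<in>I. \<bar>\<tau> - t\<bar> < d \<longrightarrow> (\<forall>x. \<bar>h \<tau> x - h t x\<bar> \<le> e)"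
  shows "continuous_on (I \<times> UNIV) (\<lambda>(t, x). h t x)"
  unfolding continuous_on_iff
proof (intro ballI allI impI)
  fix z e assume z: "z \<in> I \<times> (UNIV :: real set)" and e: "0 < (e :: real)"
  obtain t0 x0 where z0: "z = (t0, x0)" "t0 \<in> I" using z by auto
  obtain d1 where d1: "0 < d1" "\<And>\<tau> x. \<tau> \<in> I \<Longrightarrow> \<bar>\<tau> - t0\<bar> < d1 \<Longrightarrow> \<bar>h \<tau> x - h t0 x\<bar> \<le> e / 3"
    using t[OF z0(2), of "e / 3"] e by auto
  have "isCont (h t0) x0" using x[OF z0(2)] by (simp add: continuous_on_eq_continuous_at)
  then obtain d2 where d2: "0 < d2" "\<And>y. dist y x0 < d2 \<Longrightarrow> dist (h t0 y) (h t0 x0) < e / 3"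
    unfolding continuous_at_eps_delta using e by (metis divide_pos_pos zero_less_numeral)
  show "\<exists>d>0. \<forall>z'\<in>I \<times> UNIV. dist z' z < d \<longrightarrow> dist (case z' of (t, x) \<Rightarrow> h t x) (case z of (t, x) \<Rightarrow> h t x) < e"
  proof (intro exI[of _ "min d1 d2"] conjI ballI impI)
    fix z' assume z': "z' \<in> I \<times> (UNIV :: real set)" and dz: "dist z' z < min d1 d2"
    obtain t1 x1 where z1: "z' = (t1, x1)" "t1 \<in> I" using z' by auto
    have "dist t1 t0 < d1" "dist x1 x0 < d2"
      using dist_fst_le[of z' z] dist_snd_le[of z' z] dz by (auto simp: z0 z1)
    then have "\<bar>h t1 x1 - h t0 x1\<bar> \<le> e / 3" "\<bar>h t0 x1 - h t0 x0\<bar> < e / 3"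
      using d1(2)[OF z1(2)] d2(2) by (auto simp: dist_real_def)
    then show "dist (case z' of (t, x) \<Rightarrow> h t x) (case z of (t, x) \<Rightarrow> h t x) < e"
      unfolding z0 z1 prod.case dist_real_def using e by linarith
  qed (use d1 d2 in auto)
qed

text \<open>The bound M is left free: the actual supremum may be 0, whereas the flow needs a
  positive M, so it is applied later to slightly larger values.\<close>

lemma CH_strong_solution_regular:
  assumes s: "3 / 2 < s" and sol: "CH_strong_solution T s u u0"
  obtains K where
    "\<And>t x. t \<in> {0..T} \<Longrightarrow> \<bar>u t x\<bar> \<le> K" "\<And>t x. t \<in> {0..T} \<Longrightarrow> \<bar>deriv (u t) x\<bar> \<le> K"
    "\<And>t. t \<in> {0..T} \<Longrightarrow> continuous_on UNIV (u t)" "\<And>t. t \<in> {0..T} \<Longrightarrow> continuous_on UNIV (deriv (u t))"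
    "\<And>M. 0 < M \<Longrightarrow> (\<And>t x y. t \<in> {0..T} \<Longrightarrow> \<bar>u t x\<bar> + \<bar>deriv (u t) y\<bar> \<le> M) \<Longrightarrow>
      ch_flow T M u (\<lambda>t. deriv (u t)) (\<lambda>t. G_conv_deriv (CH_F (u t))) (\<lambda>t. G_conv (CH_F (u t)))"
proof -
  have C: "C_Hs T s u"
    and eq: "\<And>t x. t \<in> {0..T} \<Longrightarrow> ((\<lambda>\<tau>. u \<tau> x) has_real_derivative
           (- (u t x * deriv (u t) x + deriv (CH_conv (u t)) x))) (at t within {0..T})"
    using sol by (auto simp: CH_strong_solution_def)
  obtain K where K: "\<And>t x. t \<in> {0..T} \<Longrightarrow> \<bar>u t x\<bar> \<le> K" "\<And>t x. t \<in> {0..T} \<Longrightarrow> \<bar>deriv (u t) x\<bar> \<le> K"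
    and ux: "\<And>t x. t \<in> {0..T} \<Longrightarrow> (u t has_real_derivative deriv (u t) x) (at x)"
    and uxc: "\<And>t. t \<in> {0..T} \<Longrightarrow> continuous_on UNIV (deriv (u t))"
    and unif: "\<And>t e. t \<in> {0..T} \<Longrightarrow> 0 < e \<Longrightarrow> \<exists>d>0. \<forall>\<tau>\<in>{0..T}. \<bar>\<tau> - t\<bar> < d \<longrightarrow>
        (\<forall>x. \<bar>u \<tau> x - u t x\<bar> \<le> e \<and> \<bar>deriv (u \<tau>) x - deriv (u t) x\<bar> \<le> e)"
    using C_Hs_regular[OF s C] by blast
  have uc: "continuous_on UNIV (u t)" if "t \<in> {0..T}" for t
    using ux[OF that] by (intro continuous_at_imp_continuous_on) (auto intro: DERIV_isCont)
  have Fc: "continuous_on UNIV (CH_F (u t))" if "t \<in> {0..T}" for t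
    unfolding CH_F_def using uc[OF that] uxc[OF that] by (intro continuous_intros) auto
  have Fm: "CH_F (u t) \<in> borel_measurable borel" if "t \<in> {0..T}" for t
    by (rule borel_measurable_continuous_onI[OF Fc[OF that]])
  have Fnn: "0 \<le> CH_F f y" for f y by (simp add: CH_F_def)
  have sq: "\<bar>a\<^sup>2 - b\<^sup>2\<bar> \<le> 2 * K * e" if "\<bar>a\<bar> \<le> K" "\<bar>b\<bar> \<le> K" "\<bar>a - b\<bar> \<le> e" for a b e
  proof -
    have "\<bar>a\<^sup>2 - b\<^sup>2\<bar> = \<bar>a + b\<bar> * \<bar>a - b\<bar>" by (simp add: power2_eq_square algebra_simps flip: abs_mult)
    also have "\<dots> \<le> (2 * K) * e" using that by (intro mult_mono) auto
    finally show ?thesis .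
  qed
  have Fb: "\<bar>CH_F (u t) y\<bar> \<le> 2 * K * K + 2 * K * K" if t: "t \<in> {0..T}" for t y
  proof -
    have "(u t y)\<^sup>2 \<le> 2 * K * K" "(deriv (u t) y)\<^sup>2 \<le> 2 * K * K"
      using K(1)[OF t, of y] K(2)[OF t, of y] sq[of "u t y" 0 K] sq[of "deriv (u t) y" 0 K] by auto
    then show ?thesis
      unfolding CH_F_def using zero_le_power2[of "u t y"] zero_le_power2[of "deriv (u t) y"] by linarith
  qed
  have Fd: "\<bar>CH_F (u \<tau>) y - CH_F (u t) y\<bar> \<le> 4 * K * e"
    if t: "t \<in> {0..T}" "\<tau> \<in> {0..T}" and e: "\<bar>u \<tau> y - u t y\<bar> \<le> e" "\<bar>deriv (u \<tau>) y - deriv (u t) y\<bar> \<le> e" for t \<tau> y e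
  proof -
    have "\<bar>(u \<tau> y)\<^sup>2 - (u t y)\<^sup>2\<bar> \<le> 2 * K * e" "\<bar>(deriv (u \<tau>) y)\<^sup>2 - (deriv (u t) y)\<^sup>2\<bar> \<le> 2 * K * e"
      using K t e by (auto intro!: sq)
    then show ?thesis unfolding CH_F_def by linarith
  qed
  have conv: "CH_conv f = G_conv (CH_F f)" for f by (auto simp: CH_conv_def G_conv_def)
  have Gd: "(G_conv (CH_F (u t)) has_real_derivative G_conv_deriv (CH_F (u t)) x) (at x)"
    "(G_conv_deriv (CH_F (u t)) has_real_derivative G_conv (CH_F (u t)) x - CH_F (u t) x) (at x)"
    if t: "t \<in> {0..T}" for t x
    using G_conv_has_deriv[OF Fc[OF t] Fb[OF t]] G_conv_deriv_has_deriv[OF Fc[OF t] Fb[OF t]] by auto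
  have jc: "continuous_on ({0..T} \<times> UNIV) (\<lambda>(t, x). u t x)" "continuous_on ({0..T} \<times> UNIV) (\<lambda>(t, x). deriv (u t) x)"
    by (rule joint_continuity[of "{0..T}"]; use uc uxc unif in meson)+
  have Gc: "continuous_on ({0..T} \<times> UNIV) (\<lambda>(t, x). G_conv (CH_F (u t)) x)"
  proof (rule joint_continuity)
    show "continuous_on UNIV (G_conv (CH_F (u t)))" if "t \<in> {0..T}" for t
      using Gd(1)[OF that] by (intro continuous_at_imp_continuous_on) (auto intro: DERIV_isCont)
    fix t e :: real assume t: "t \<in> {0..T}" and e: "0 < e"
    have K0: "0 \<le> K" using K(1)[OF t, of 0] by linarith
    \<comment> \<open>F changes by at most 4 K times the change of u and u_x; the 1 avoids division
      by 0.\<close>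
    have e': "0 < e / (4 * K + 1)" using e K0 by simp
    have le: "4 * K * (e / (4 * K + 1)) \<le> e" using e K0 by (simp add: field_simps)
    obtain d where d: "0 < d" "\<And>\<tau> x. \<tau> \<in> {0..T} \<Longrightarrow> \<bar>\<tau> - t\<bar> < d \<Longrightarrow>
        \<bar>u \<tau> x - u t x\<bar> \<le> e / (4 * K + 1) \<and> \<bar>deriv (u \<tau>) x - deriv (u t) x\<bar> \<le> e / (4 * K + 1)"
      using unif[OF t e'] by blast
    have "\<bar>G_conv (CH_F (u \<tau>)) x - G_conv (CH_F (u t)) x\<bar> \<le> e" if \<tau>: "\<tau> \<in> {0..T}" "\<bar>\<tau> - t\<bar> < d" for \<tau> x
    proof (rule G_conv_diff_bound[OF Fm[OF \<tau>(1)] Fm[OF t] Fb[OF \<tau>(1)] Fb[OF t]])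
      show "\<bar>CH_F (u \<tau>) y - CH_F (u t) y\<bar> \<le> e" for y
        using Fd[OF t \<tau>(1), of y "e / (4 * K + 1)"] d(2)[OF \<tau>, of y] le by linarith
    qed
    then show "\<exists>d>0. \<forall>\<tau>\<in>{0..T}. \<bar>\<tau> - t\<bar> < d \<longrightarrow> (\<forall>x. \<bar>G_conv (CH_F (u \<tau>)) x - G_conv (CH_F (u t)) x\<bar> \<le> e)"
      using d(1) by blast
  qed
  show thesis
  proof (rule that[OF K uc uxc])
    fix M assume M: "0 < M" "\<And>t x y. t \<in> {0..T} \<Longrightarrow> \<bar>u t x\<bar> + \<bar>deriv (u t) y\<bar> \<le> M"
    show "ch_flow T M u (\<lambda>t. deriv (u t)) (\<lambda>t. G_conv_deriv (CH_F (u t))) (\<lambda>t. G_conv (CH_F (u t)))"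
    proof
      fix t x assume t: "t \<in> {0..T}"
      show "((\<lambda>\<tau>. u \<tau> x) has_real_derivative - (u t x * deriv (u t) x + G_conv_deriv (CH_F (u t)) x)) (at t within {0..T})"
        using eq[OF t, of x] DERIV_imp_deriv[OF Gd(1)[OF t, of x]] by (simp add: conv)
      show "(G_conv_deriv (CH_F (u t)) has_real_derivative G_conv (CH_F (u t)) x - ((u t x)\<^sup>2 + (deriv (u t) x)\<^sup>2 / 2)) (at x)"
        using Gd(2)[OF t, of x] by (simp add: CH_F_def)
      show "\<bar>G_conv_deriv (CH_F (u t)) x\<bar> \<le> G_conv (CH_F (u t)) x"
        by (rule G_conv_deriv_le[OF Fc[OF t] Fb[OF t] Fnn])
    qed (use M ux jc Gc in auto)
  qed
qed

lemma weighted_persistence: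
  assumes p: "2 \<le> p" and adm: "CH_admissible \<phi> v A C0" and M: "0 < M"
    and fl: "ch_flow T M u (\<lambda>t. deriv (u t)) (\<lambda>t. G_conv_deriv (CH_F (u t))) (\<lambda>t. G_conv (CH_F (u t)))"
    and a: "0 < a" "Lp_bounded p (\<lambda>x. u 0 x * \<phi> x) a"
    and b: "0 < b" "Lp_bounded p (\<lambda>x. deriv (u 0) x * \<phi> x) b"
    and t: "t \<in> {0..T}"
    and meas: "u t \<in> borel_measurable borel" "deriv (u t) \<in> borel_measurable borel"
  shows "Lp_norm p (\<lambda>x. u t x * \<phi> x) + Lp_norm p (\<lambda>x. deriv (u t) x * \<phi> x)
    \<le> ennreal ((a + b) * exp ((A + C0 * (LINT x|lborel. v x * exp (- \<bar>x\<bar>)) + 8) * M * t))"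
proof -
  define J where "J = (LINT x|lborel. v x * exp (- \<bar>x\<bar>))"
  define \<kappa> where "\<kappa> x = C0 * v x + exp (\<bar>x\<bar> / 2)" for x
  have A: "0 < A" and C0: "0 < C0" and \<phi>c: "continuous_on UNIV \<phi>" and \<phi>p: "\<And>x. 0 < \<phi> x"
    and mod: "\<And>x y. \<phi> (x + y) \<le> C0 * v x * \<phi> y" and vc: "continuous_on UNIV v" and vnn: "\<And>x. 0 \<le> v x"
    and vint: "integrable lborel (\<lambda>x. v x * exp (- \<bar>x\<bar>))"
    using adm by (auto simp: CH_admissible_def v_moderate_def submultiplicative_def)
  have lip: "\<phi> x \<le> exp (A * \<bar>x - y\<bar>) * \<phi> y" for x y
    using adm A by (intro log_lipschitz_of_abs_cont \<phi>c \<phi>p) (auto simp: CH_admissible_def)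
  have [measurable]: "v \<in> borel_measurable borel" "\<phi> \<in> borel_measurable borel"
    using vc \<phi>c by (auto intro: borel_measurable_continuous_onI)
  \<comment> \<open>One half of G absorbs v and contributes C0 J / 2; the other meets exp (|z| / 2),
    and the integral of exp (- |z| / 2) is 4.\<close>
  have kern: "CH_G z * \<kappa> z = (C0 * (v z * exp (- \<bar>z\<bar>)) + exp (- (1 / 2 * \<bar>z\<bar>))) / 2" for z
    by (simp add: CH_G_def \<kappa>_def algebra_simps add_divide_distrib flip: exp_add)
  have ki: "integrable lborel (\<lambda>z. CH_G z * \<kappa> z)"
    unfolding kern using vint integrable_exp_neg_abs[of "1 / 2"] by auto
  have kv: "(LINT z|lborel. CH_G z * \<kappa> z) = (C0 * J + 4) / 2"
    unfolding kern using vint integrable_exp_neg_abs[of "1 / 2"] integral_exp_neg_abs[of "1 / 2"]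
    by (simp add: J_def)
  have loc: "ch_weighted T M u (\<lambda>t. deriv (u t)) (\<lambda>t. G_conv_deriv (CH_F (u t))) (\<lambda>t. G_conv (CH_F (u t)))
      p (trunc_weight \<phi> (real n + 1)) \<kappa> (A + 1) (real n + 1)" for n
  proof (intro ch_weighted.intro fl ch_weighted_axioms.intro)
    show "trunc_weight \<phi> (real n + 1) x \<le> exp ((A + 1) * \<bar>x - y\<bar>) * trunc_weight \<phi> (real n + 1) y" for x y
      by (rule trunc_weight_log_lipschitz[OF lip \<phi>p A]) simp
    show "trunc_weight \<phi> (real n + 1) (x + y) \<le> \<kappa> x * trunc_weight \<phi> (real n + 1) y" for x y
      unfolding \<kappa>_def by (rule trunc_weight_moderate[OF mod \<phi>p _ vnn]) (use C0 in auto)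
    show "0 \<le> trunc_weight \<phi> (real n + 1) x" for x using \<phi>p[of x] by (intro trunc_weight_nonneg) auto
    show "0 < \<kappa> x" for x unfolding \<kappa>_def using C0 vnn[of x] by (intro add_nonneg_pos) auto
    show "\<kappa> \<in> borel_measurable borel" unfolding \<kappa>_def by measurable
    show "G_conv (CH_F (u t)) x = G_conv (\<lambda>y. (u t y)\<^sup>2 + (deriv (u t) y)\<^sup>2 / 2) x" for t x
      by (simp add: CH_F_def[abs_def])
  qed (use p A ki trunc_weight_le continuous_trunc_weight[OF \<phi>c] in auto)
  have K: "ch_weighted.K \<kappa> = (C0 * J + 4) / 2"
    using ch_weighted.K_def[OF loc] kv by simp
  \<comment> \<open>The first 1 added to A comes from the truncation, the second from the change of
    variables.\<close>
  define R where "R d = exp ((A + 1 + 1) * M * t) * (d + (a + b) * (exp (2 * ((1 + (C0 * J + 4) / 2) * M) * t) - 1) / 2)" for d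
  have J0: "0 \<le> J" unfolding J_def using vnn by (intro integral_nonneg_AE) auto
  have E0: "0 \<le> (a + b) * (exp (2 * ((1 + (C0 * J + 4) / 2) * M) * t) - 1)"
    using a b t M C0 J0 by (intro mult_nonneg_nonneg) (auto intro!: mult_nonneg_nonneg)
  have R0: "0 < R d" if "0 < d" for d using that E0 by (simp add: R_def add_pos_nonneg)
  have trunc_le: "Lp_bounded p (\<lambda>x. w x * trunc_weight \<phi> (real n + 1) x) c" if "Lp_bounded p (\<lambda>x. w x * \<phi> x) c" "0 < c" for w c n
  proof (rule Lp_bounded_mono[OF that(1) _ order_refl])
    show "\<bar>w x * trunc_weight \<phi> (real n + 1) x\<bar> \<le> \<bar>w x * \<phi> x\<bar>" for x
      using trunc_weight_le(1)[of \<phi> "real n + 1" x] trunc_weight_nonneg[of \<phi> x "real n + 1"] \<phi>p[of x]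
      by (simp add: abs_mult mult_left_mono)
  qed (use that in auto)
  have "Lp_bounded p (\<lambda>x. u t x * trunc_weight \<phi> (real n + 1) x) (R a)"
    "Lp_bounded p (\<lambda>x. deriv (u t) x * trunc_weight \<phi> (real n + 1) x) (R b)" for n
    using ch_weighted.weighted_estimate[OF loc a(1) trunc_le[OF a(2,1)] b(1) trunc_le[OF b(2,1)] t]
    by (simp_all add: K R_def)
  then have "Lp_bounded p (\<lambda>x. u t x * \<phi> x) (R a)" "Lp_bounded p (\<lambda>x. deriv (u t) x * \<phi> x) (R b)"
    using \<phi>p meas by (auto intro: Lp_bounded_trunc_limit)
  then have "Lp_norm p (\<lambda>x. u t x * \<phi> x) + Lp_norm p (\<lambda>x. deriv (u t) x * \<phi> x) \<le> ennreal (R a) + ennreal (R b)"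
    using a(1) b(1) R0 p by (intro add_mono Lp_norm_le_of_bounded) auto
  also have "\<dots> = ennreal (R a + R b)" using a(1) b(1) R0 by (simp add: less_imp_le)
  \<comment> \<open>The coupling terms of the two bounds add up to (a + b) (exp c - 1), so that only
    a product of exponentials is left, with rates (A + 2) M and (C0 J + 6) M.\<close>
  also have "R a + R b = (a + b) * exp ((A + C0 * J + 8) * M * t)"
  proof -
    have "R a + R b = (a + b) * (exp ((A + 1 + 1) * M * t) * exp (2 * ((1 + (C0 * J + 4) / 2) * M) * t))"
      by (simp add: R_def algebra_simps)
    also have "(A + 1 + 1) * M * t + 2 * ((1 + (C0 * J + 4) / 2) * M) * t = (A + C0 * J + 8) * M * t"
      by (simp add: algebra_simps)
    then have "exp ((A + 1 + 1) * M * t) * exp (2 * ((1 + (C0 * J + 4) / 2) * M) * t) = exp ((A + C0 * J + 8) * M * t)"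
      by (simp flip: exp_add)
    finally show ?thesis .
  qed
  finally show ?thesis by (simp add: J_def)
qed

theorem theorem2p1:
  "\<exists>Cf :: real \<Rightarrow> real \<Rightarrow> real \<Rightarrow> real \<Rightarrow> real.
     (\<forall>A C0 m I. A > 0 \<longrightarrow> C0 > 0 \<longrightarrow> m > 0 \<longrightarrow> I > 0 \<longrightarrow> Cf A C0 m I > 0) \<and>
     (\<forall>(T::real) (s::real) (p::ennreal) u u0 \<phi> v A C0.
        T > 0 \<longrightarrow> s > 3/2 \<longrightarrow> 2 \<le> p \<longrightarrow>
        CH_strong_solution T s u u0 \<longrightarrow>
        CH_admissible \<phi> v A C0 \<longrightarrow>
        in_Lp p (\<lambda>x. u0 x * \<phi> x) \<longrightarrow>
        in_Lp p (\<lambda>x. deriv u0 x * \<phi> x) \<longrightarrow>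
        (let C = Cf A C0 (INF x. v x) (LINT x|lborel. v x * exp (- \<bar>x\<bar>));
             M = (SUP t\<in>{0..T}. Linf_norm (u t) + Linf_norm (deriv (u t)))
         in M < \<infinity> \<and>
            (\<forall>t\<in>{0..T}.
               Lp_norm p (\<lambda>x. u t x * \<phi> x) + Lp_norm p (\<lambda>x. deriv (u t) x * \<phi> x)
               \<le> (Lp_norm p (\<lambda>x. u0 x * \<phi> x) + Lp_norm p (\<lambda>x. deriv u0 x * \<phi> x))
                  * ennreal (exp (C * enn2real M * t)))))"
\<comment> \<open>The four arguments are A, \<open>C0\<close>, inf v and the integral of v exp (-
  |x|); the choice is uniform in p, T and s.\<close>
proof (intro exI[of _ "\<lambda>A C0 m I. A + C0 * I + 8"] conjI allI impI)
  show "0 < A + C0 * I + 8" if "A > 0" "C0 > 0" "m > 0" "I > 0" for A C0 m I :: real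
    using that by (intro add_pos_pos mult_pos_pos) auto
next
  fix T s :: real and p :: ennreal and u u0 \<phi> v A C0
  assume T: "T > 0" and s: "s > 3/2" and p: "2 \<le> p" and sol: "CH_strong_solution T s u u0"
    and adm: "CH_admissible \<phi> v A C0" and in0: "in_Lp p (\<lambda>x. u0 x * \<phi> x)"
    and in1: "in_Lp p (\<lambda>x. deriv u0 x * \<phi> x)"
  have u0: "u 0 = u0" using sol by (simp add: CH_strong_solution_def)
  obtain K where K: "\<And>t x. t \<in> {0..T} \<Longrightarrow> \<bar>u t x\<bar> \<le> K" "\<And>t x. t \<in> {0..T} \<Longrightarrow> \<bar>deriv (u t) x\<bar> \<le> K"
    and uc: "\<And>t. t \<in> {0..T} \<Longrightarrow> continuous_on UNIV (u t)" and uxc: "\<And>t. t \<in> {0..T} \<Longrightarrow> continuous_on UNIV (deriv (u t))"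
    and fl: "\<And>M. 0 < M \<Longrightarrow> (\<And>t x y. t \<in> {0..T} \<Longrightarrow> \<bar>u t x\<bar> + \<bar>deriv (u t) y\<bar> \<le> M) \<Longrightarrow>
      ch_flow T M u (\<lambda>t. deriv (u t)) (\<lambda>t. G_conv_deriv (CH_F (u t))) (\<lambda>t. G_conv (CH_F (u t)))"
    using CH_strong_solution_regular[OF s sol] by blast
  define M where "M = (SUP t\<in>{0..T}. Linf_norm (u t) + Linf_norm (deriv (u t)))"
  define C where "C = A + C0 * (LINT x|lborel. v x * exp (- \<bar>x\<bar>)) + 8"
  define \<alpha> where "\<alpha> = enn2real (Lp_norm p (\<lambda>x. u0 x * \<phi> x))"
  define \<beta> where "\<beta> = enn2real (Lp_norm p (\<lambda>x. deriv u0 x * \<phi> x))"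
  have "M \<le> ennreal K + ennreal K"
    unfolding M_def using K by (intro SUP_least add_mono Linf_norm_le) auto
  then have Mfin: "M < \<infinity>" by (rule le_less_trans) (simp add: less_top)
  have Mbd: "\<bar>u t x\<bar> + \<bar>deriv (u t) y\<bar> \<le> enn2real M" if t: "t \<in> {0..T}" for t x y
  proof -
    have "ennreal (\<bar>u t x\<bar> + \<bar>deriv (u t) y\<bar>) \<le> Linf_norm (u t) + Linf_norm (deriv (u t))"
      using le_Linf_norm[OF uc[OF t]] le_Linf_norm[OF uxc[OF t]] by (simp add: add_mono)
    also have "\<dots> \<le> M" unfolding M_def using t by (rule SUP_upper)
    also have "\<dots> = ennreal (enn2real M)" using Mfin by simp
    finally show ?thesis by (subst (asm) ennreal_le_iff) auto
  qed
  have \<phi>c: "continuous_on UNIV \<phi>" using adm by (simp add: CH_admissible_def v_moderate_def)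
  have zero: "0 \<in> {0..T}" using T by simp
  have est: "Lp_norm p (\<lambda>x. u t x * \<phi> x) + Lp_norm p (\<lambda>x. deriv (u t) x * \<phi> x)
       \<le> (Lp_norm p (\<lambda>x. u0 x * \<phi> x) + Lp_norm p (\<lambda>x. deriv u0 x * \<phi> x)) * ennreal (exp (C * enn2real M * t))"
    if t: "t \<in> {0..T}" for t
  proof -
    \<comment> \<open>The initial norms and M may vanish, while \<open>weighted_persistence\<close>
      asks for positive bounds. All three are enlarged by \<open>e n\<close>, and the estimate
      survives the limit because its left-hand side does not depend on n.\<close>
    define e where "e n = inverse (real (Suc n))" for n
    have e: "0 < e n" for n by (simp add: e_def)
    have lime: "e \<longlonglongrightarrow> 0" unfolding e_def by (rule LIMSEQ_inverse_real_of_nat)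
    have bd: "Lp_norm p (\<lambda>x. u t x * \<phi> x) + Lp_norm p (\<lambda>x. deriv (u t) x * \<phi> x)
        \<le> ennreal (((\<alpha> + e n) + (\<beta> + e n)) * exp (C * (enn2real M + e n) * t))" for n
      unfolding C_def
    proof (rule weighted_persistence[OF p adm])
      show Mn: "0 < enn2real M + e n" using e[of n] by (simp add: add_nonneg_pos)
      show "ch_flow T (enn2real M + e n) u (\<lambda>t. deriv (u t)) (\<lambda>t. G_conv_deriv (CH_F (u t))) (\<lambda>t. G_conv (CH_F (u t)))"
      proof (rule fl[OF Mn])
        show "\<bar>u t x\<bar> + \<bar>deriv (u t) y\<bar> \<le> enn2real M + e n" if "t \<in> {0..T}" for t x y
          using Mbd[OF that, of x y] e[of n] by simp
      qed
      show "Lp_bounded p (\<lambda>x. u 0 x * \<phi> x) (\<alpha> + e n)" "Lp_bounded p (\<lambda>x. deriv (u 0) x * \<phi> x) (\<beta> + e n)"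
        unfolding \<alpha>_def \<beta>_def u0 using uc[OF zero] uxc[OF zero]
        by (auto intro!: Lp_bounded_of_in_Lp in0 in1 e p continuous_intros \<phi>c simp: u0)
      show "0 < \<alpha> + e n" "0 < \<beta> + e n" using e[of n] by (auto simp: \<alpha>_def \<beta>_def add_nonneg_pos)
    qed (use t uc[OF t] uxc[OF t] in \<open>auto intro: borel_measurable_continuous_onI\<close>)
    have "(\<lambda>n. ennreal (((\<alpha> + e n) + (\<beta> + e n)) * exp (C * (enn2real M + e n) * t)))
        \<longlonglongrightarrow> ennreal (((\<alpha> + 0) + (\<beta> + 0)) * exp (C * (enn2real M + 0) * t))"
      by (intro tendsto_ennrealI tendsto_intros lime)
    then have "Lp_norm p (\<lambda>x. u t x * \<phi> x) + Lp_norm p (\<lambda>x. deriv (u t) x * \<phi> x)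
        \<le> ennreal (((\<alpha> + 0) + (\<beta> + 0)) * exp (C * (enn2real M + 0) * t))"
      by (rule LIMSEQ_le_const) (use bd in blast)
    also have "\<dots> = (ennreal \<alpha> + ennreal \<beta>) * ennreal (exp (C * enn2real M * t))"
      by (simp add: \<alpha>_def \<beta>_def ennreal_mult flip: ennreal_plus)
    also have "ennreal \<alpha> = Lp_norm p (\<lambda>x. u0 x * \<phi> x)" using in0 by (simp add: \<alpha>_def in_Lp_def)
    also have "ennreal \<beta> = Lp_norm p (\<lambda>x. deriv u0 x * \<phi> x)" using in1 by (simp add: \<beta>_def in_Lp_def)
    finally show ?thesis .
  qed
  show "let C = A + C0 * (LINT x|lborel. v x * exp (- \<bar>x\<bar>)) + 8;
             M = (SUP t\<in>{0..T}. Linf_norm (u t) + Linf_norm (deriv (u t)))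
         in M < \<infinity> \<and>
            (\<forall>t\<in>{0..T}.
               Lp_norm p (\<lambda>x. u t x * \<phi> x) + Lp_norm p (\<lambda>x. deriv (u t) x * \<phi> x)
               \<le> (Lp_norm p (\<lambda>x. u0 x * \<phi> x) + Lp_norm p (\<lambda>x. deriv u0 x * \<phi> x))
                  * ennreal (exp (C * enn2real M * t)))"
    using Mfin est by (simp add: Let_def M_def C_def)
qed

end
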